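(* Let $G=(V,E)$ be an $n$-vertex simple graph, and let $G'=(V',E')$ be a contraction of $G$ with $q$ supervertices, where $q\ge\log^{2+\varepsilon}(n)$ for some $\varepsilon>0$, and let $r$ be a positive integer. There is a zero-error randomized algorithm that makes $O(n+rq\log(n)/\log(q))$ cut queries to $G$ in expectation and outputs a sparse $r$-edge connectivity certificate for $G'$.
   Context: A simple graph is undirected, unweighted, loopless, with at most one edge per pair of vertices. For $S\subseteq V$, $\mathrm{cut}_G(S)$ is the set of edges with exactly one endpoint in $S$; a cut query on $S$ returns $|\mathrm{cut}_G(S)|$. A contraction of $G$ is given by a partition of $V$ into $q$ sets (supervertices), known explicitly to the algorithm; $G'$ is the multigraph on these supervertices with $|E_G(S,T)|$ parallel edges between distinct supervertices $S,T$, where $E_G(S,T)$ is the set of edges of $G$ with one endpoint in $S$ and one in $T$. A sparse $r$-edge connectivity certificate for a multigraph $G'=(V',E')$ is a subgraph $\hat H=(V',F)$ with at most $r|V'|$ edges such that $|\mathrm{cut}_{\hat H}(S)|=\min\{r,|\mathrm{cut}_{G'}(S)|\}$ for every $S\subseteq V'$. Zero-error means the output is always correct; only the number of queries is random.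
   Formalization: The certificate condition is read as min{r,|cut_H(S)|} = min{r,|cut_G'(S)|}, since |cut_H(S)| = min{r,|cut_G'(S)|} as printed fails already for a triangle with r = 1 (three degrees equal to 1); vertices are named by natural numbers. *)

theory Defs
  imports "HOL-Probability.Probability" "HOL-Library.Disjoint_Sets" "HOL-Library.Multiset"
begin

definition simple_graph :: "'a set \<Rightarrow> 'a set set \<Rightarrow> bool" where
  "simple_graph V E \<longleftrightarrow> finite V \<and> E \<subseteq> {e. e \<subseteq> V \<and> card e = 2}"

definition cut :: "'a set set \<Rightarrow> 'a set \<Rightarrow> 'a set set" where
  "cut E S = {e \<in> E. card (e \<inter> S) = 1}"

definition edges_between :: "'a set set \<Rightarrow> 'a set \<Rightarrow> 'a set \<Rightarrow> 'a set set" where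
  "edges_between E S T = {e \<in> E. \<exists>u\<in>S. \<exists>v\<in>T. e = {u, v}}"

text \<open>
  A multigraph on a vertex set \<open>V'\<close> is given by its multiset of edges, each edge being a
  two-element subset of \<open>V'\<close>; parallel edges are repeated occurrences.
\<close>

definition mcut :: "'v set multiset \<Rightarrow> 'v set \<Rightarrow> 'v set multiset" where
  "mcut M S = filter_mset (\<lambda>e. card (e \<inter> S) = 1) M"

text \<open>
  The edges of the contraction of a graph with edge set \<open>E\<close> along a partition \<open>P\<close>: an edge of
  the graph is sent to the set of parts that it meets, and edges inside a single part disappear.
  The multiplicities are made explicit in \<open>count_contract\<close>.
\<close>

definition parts_met :: "'a set set \<Rightarrow> 'a set \<Rightarrow> 'a set set" where
  "parts_met P e = {S \<in> P. S \<inter> e \<noteq> {}}"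

definition contract :: "'a set set \<Rightarrow> 'a set set \<Rightarrow> 'a set set multiset" where
  "contract P E = image_mset (parts_met P) (mset_set {e \<in> E. card (parts_met P e) = 2})"

lemma finite_simple_graph: "simple_graph V E \<Longrightarrow> finite E"
  by (rule finite_subset[of _ "Pow V"]) (auto simp: simple_graph_def)

lemma count_contract:
  assumes G: "simple_graph V E" and P: "partition_on V P"
    and ST: "S \<in> P" "T \<in> P" "S \<noteq> T"
  shows "count (contract P E) {S, T} = card (edges_between E S T)"
proof -
  have disj: "A \<inter> B = {}" if "A \<in> P" "B \<in> P" "A \<noteq> B" for A B
    using P that by (auto simp: partition_on_def disjoint_def)
  have met: "parts_met P e = {S, T} \<longleftrightarrow> e \<in> edges_between E S T" if e: "e \<in> E" for e
  proof
    assume *: "parts_met P e = {S, T}"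
    have "S \<in> parts_met P e" "T \<in> parts_met P e"
      by (simp_all add: *)
    then obtain u v where uv: "u \<in> S" "u \<in> e" "v \<in> T" "v \<in> e"
      by (auto simp: parts_met_def)
    then have "u \<noteq> v" using disj[OF ST] by auto
    moreover have "card e = 2" using G e by (auto simp: simple_graph_def)
    ultimately have "{u, v} = e"
      by (intro card_subset_eq) (use uv in \<open>auto intro: card_ge_0_finite\<close>)
    with uv e show "e \<in> edges_between E S T"
      by (auto simp: edges_between_def)
  next
    assume "e \<in> edges_between E S T"
    then obtain u v where uv: "u \<in> S" "v \<in> T" "e = {u, v}"
      by (auto simp: edges_between_def)
    have "A \<inter> e \<noteq> {} \<longleftrightarrow> A = S \<or> A = T" if "A \<in> P" for A
      using disj[OF that ST(1)] disj[OF that ST(2)] uv by blast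
    then show "parts_met P e = {S, T}"
      using ST by (auto simp: parts_met_def)
  qed
  have fin: "finite {e \<in> E. card (parts_met P e) = 2}"
    using finite_simple_graph[OF G] by simp
  have "e \<in> parts_met P -` {{S, T}} \<inter> {e \<in> E. card (parts_met P e) = 2} \<longleftrightarrow>
      e \<in> edges_between E S T" for e
  proof (cases "e \<in> E")
    case True
    have "card {S, T} = 2" using ST(3) by simp
    then have "parts_met P e = {S, T} \<and> card (parts_met P e) = 2 \<longleftrightarrow> parts_met P e = {S, T}"
      by metis
    with True met[OF True] show ?thesis by simp
  next
    case False
    then show ?thesis by (simp add: edges_between_def)
  qed
  then have eq: "parts_met P -` {{S, T}} \<inter> {e \<in> E. card (parts_met P e) = 2} = edges_between E S T"
    by (rule set_eqI)
  have "count (mset_set {e \<in> E. card (parts_met P e) = 2}) e = 1"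
    if "e \<in> edges_between E S T" for e
    using that fin unfolding eq[symmetric] by (intro count_mset_set(1)) blast+
  then have "(\<Sum>e\<in>edges_between E S T. count (mset_set {e \<in> E. card (parts_met P e) = 2}) e)
      = card (edges_between E S T)"
    by simp
  then show ?thesis
    using fin eq by (simp add: contract_def count_image_mset)
qed

text \<open>
  Cuts are compared after truncation at \<open>r\<close> on both sides. As \<open>F\<close> is a sub-multiset of \<open>M\<close>,
  this says that the cut of \<open>S\<close> in \<open>F\<close> has at least \<open>min r (size (mcut M S))\<close> edges.  Without
  the truncation of the cut in \<open>F\<close> certificates need not exist: for the triangle and \<open>r = 1\<close>,
  all three degrees in \<open>F\<close> would have to be 1.
\<close>

definition sparse_certificate :: "nat \<Rightarrow> 'v set \<Rightarrow> 'v set multiset \<Rightarrow> 'v set multiset \<Rightarrow> bool" where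
  "sparse_certificate r V' M F \<longleftrightarrow>
     F \<subseteq># M \<and> size F \<le> r * card V' \<and>
     (\<forall>S\<subseteq>V'. min r (size (mcut F S)) = min r (size (mcut M S)))"

text \<open>
  Randomized query algorithms: decision trees in which every inner node either asks a query and
  branches on the answer, or continues with a random subtree (internal randomness).
  Computation between queries is free.
\<close>

datatype ('a, 'b) query_alg =
    Output 'b
  | Query "'a set" "nat \<Rightarrow> ('a, 'b) query_alg"
  | Sample "('a, 'b) query_alg pmf"

text \<open>The joint distribution of the output and of the number of queries made.\<close>

primrec run :: "('a set \<Rightarrow> nat) \<Rightarrow> ('a, 'b) query_alg \<Rightarrow> ('b \<times> nat) pmf" where
  "run f (Output x) = return_pmf (x, 0)"
| "run f (Query S k) = map_pmf (map_prod id Suc) (run f (k (f S)))"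
| "run f (Sample p) = bind_pmf (map_pmf (run f) p) (\<lambda>d. d)"

text \<open>
  A query set need not be contained in the vertex set; vertices outside it do not affect the answer.
\<close>

definition run_cut :: "'a set set \<Rightarrow> ('a, 'b) query_alg \<Rightarrow> ('b \<times> nat) pmf" where
  "run_cut E A = run (\<lambda>S. card (cut E S)) A"

definition zero_error :: "'a set set \<Rightarrow> ('a, 'b) query_alg \<Rightarrow> ('b \<Rightarrow> bool) \<Rightarrow> bool" where
  "zero_error E A correct \<longleftrightarrow> (\<forall>(x, k) \<in> set_pmf (run_cut E A). correct x)"

definition expected_queries :: "'a set set \<Rightarrow> ('a, 'b) query_alg \<Rightarrow> ennreal" where
  "expected_queries E A = (\<integral>\<^sup>+ (x, k). of_nat k \<partial>measure_pmf (run_cut E A))"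

end

(*
  Nagamochi and Ibaraki: r rounds suffice if each round finds a set of edges of the remaining
  multigraph that meets all of its nonempty cuts, so it is enough to find a spanning forest of a
  weighted graph on q vertices with O(q log n / log q) expected queries.  This is done by a variant
  of Boruvka's algorithm.  In a phase every component C is put on the left or on the right at
  random, and the right vertices are sampled at all densities 2^-k.  Going from the sparsest sample
  to the densest one, the weights between the samples and the components without a known neighbour
  form a sparse matrix (the expected size is linear in the number of components), which is
  learned with O(m log n / log q) nonadaptive queries to its bilinear form, where m is the number
  of nonzero entries; the existence of the queries follows from the Littlewood-Offord inequality
  and a union bound over all sparse matrices.  A neighbour v of C then gives an edge by binary
  search in C, which costs O(log |C|).  The number of active components decreases by a constant
  factor in expectation, while the average |C| increases; the costs of all phases add up to a
  geometric series.  After O(log log q) phases about q / log q active components are expected, and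
  plain binary search is affordable.
*)
theory Submission
  imports Defs
begin

text \<open>The saving over binary search comes from one fact: a random test of a matrix with t
  nonzero rows misses it with probability of order 1/sqrt t, so a query is worth order log t bits in
  a union bound. Matrices with few nonzero rows escape this gain, but they are so few that a
  constant miss probability is enough for them. The designs work only under a sparsity promise, and
  the algorithm must never err. So their answers merely pick a candidate, which is checked by direct
  queries; a failed check proves that the promise was false. The promise has to bound each row as
  well as the whole matrix, hence sparsity is measured by a weight that is exponential in the row
  sizes. The two sides ensure that merges do not interfere: the neighbours of left components lie on
  the right, and each neighbour found removes one active component. Expected costs are carried by
  bounds that depend on the unknown input; a bad event enters them through Markov's inequality,
  which keeps the bound linear in a quantity whose average is known.\<close>

section \<open>The Littlewood-Offord inequality\<close>

text \<open>The summand counts the orderings of \<open>S\<close> in which \<open>X\<close> is an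
  initial segment. As \<open>v\<close> is positive, sums along an ordering increase strictly, so at
  most one initial segment has sum \<open>a\<close>. The induction fixes the last element of the
  ordering, which lies outside \<open>X\<close> unless \<open>X = S\<close>.\<close>

lemma sum_fact_subset_sum_le:
  fixes v :: "'a \<Rightarrow> int"
  assumes "finite S" "\<And>x. x \<in> S \<Longrightarrow> v x > 0"
  shows "(\<Sum>X | X \<subseteq> S \<and> sum v X = a. fact (card X) * fact (card S - card X)) \<le> (fact (card S) :: nat)"
  using assms
proof (induction "card S" arbitrary: S)
  case 0
  then have "S = {}" by simp
  then have "{X. X \<subseteq> S \<and> sum v X = a} \<subseteq> {{}}" by auto
  then have "(\<Sum>X | X \<subseteq> S \<and> sum v X = a. fact (card X) * fact (card S - card X)) \<le>
    (\<Sum>X\<in>{{}::'a set}. fact (card X) * fact (card S - card X) :: nat)"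
    by (intro sum_mono2) auto
  then show ?case by (simp add: \<open>S = {}\<close>)
next
  case (Suc s S)
  have psub: "sum v X < sum v S" if "X \<subset> S" for X
  proof -
    have "sum v S = sum v (S - X) + sum v X"
      using that Suc.prems(1) by (intro sum.subset_diff) auto
    moreover have "0 < sum v (S - X)"
      using that Suc.prems by (intro sum_pos) auto
    ultimately show ?thesis by simp
  qed
  show ?case
  proof (cases "sum v S = a")
    case True
    have "X = S" if "X \<subseteq> S" "sum v X = a" for X
      using psub[of X] that True by (cases "X = S") auto
    then have "{X. X \<subseteq> S \<and> sum v X = a} = {S}" using True by blast
    then show ?thesis by simp
  next
    case False
    let ?f = "\<lambda>X. fact (card X) * fact (s - card X) :: nat"
    let ?T = "{X. X \<subseteq> S \<and> sum v X = a}"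
    have T: "X \<subset> S" if "X \<in> ?T" for X using that False by auto
    have "fact (card X) * fact (card S - card X) = (\<Sum>x\<in>S - X. ?f X)" if "X \<in> ?T" for X
    proof -
      have c: "card X < card S" using T[OF that] Suc.prems(1) by (rule psubset_card_mono[rotated])
      have "card (S - X) = card S - card X" using that Suc.prems(1)
        by (intro card_Diff_subset) (auto intro: finite_subset)
      moreover have "card S - card X = Suc (s - card X)" using c Suc.hyps(2) by simp
      ultimately show ?thesis by (simp add: algebra_simps)
    qed
    then have "(\<Sum>X\<in>?T. fact (card X) * fact (card S - card X)) = (\<Sum>X\<in>?T. \<Sum>x\<in>S - X. ?f X)"
      by (rule sum.cong[OF refl])
    also have "\<dots> = (\<Sum>X\<in>?T. \<Sum>x\<in>{x\<in>S. x \<notin> X}. ?f X)"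
      by (simp add: set_diff_eq)
    also have "\<dots> = (\<Sum>x\<in>S. \<Sum>X\<in>{X\<in>?T. x \<notin> X}. ?f X)"
      by (rule sum.swap_restrict) (use Suc.prems in auto)
    also have "\<dots> = (\<Sum>x\<in>S. \<Sum>X | X \<subseteq> S - {x} \<and> sum v X = a. ?f X)"
      by (intro sum.cong refl) auto
    also have "\<dots> \<le> (\<Sum>x\<in>S. fact s)"
    proof (intro sum_mono)
      fix x assume x: "x \<in> S"
      then have cs: "card (S - {x}) = s" using Suc by simp
      have "s = card (S - {x})" using cs by simp
      then show "(\<Sum>X | X \<subseteq> S - {x} \<and> sum v X = a. ?f X) \<le> fact s"
        using Suc.hyps(1)[of "S - {x}"] Suc.prems unfolding cs by auto
    qed
    also have "\<dots> = fact (card S)" using Suc.hyps(2)[symmetric] by simp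
    finally show ?thesis .
  qed
qed

text \<open>Sperner's bound by the argument of Lubell: no summand above is smaller than that of a
  middle layer, because the middle binomial coefficient is the largest.\<close>

lemma card_subset_sum_le_binomial:
  fixes v :: "'a \<Rightarrow> int"
  assumes "finite S" "\<And>x. x \<in> S \<Longrightarrow> v x > 0"
  shows "card {X. X \<subseteq> S \<and> sum v X = a} \<le> card S choose (card S div 2)"
proof -
  let ?s = "card S" let ?m = "?s div 2"
  let ?T = "{X. X \<subseteq> S \<and> sum v X = a}"
  have "card ?T * (fact ?m * fact (?s - ?m)) = (\<Sum>X\<in>?T. fact ?m * fact (?s - ?m))" by simp
  also have "\<dots> \<le> (\<Sum>X\<in>?T. fact (card X) * fact (?s - card X))"
  proof (intro sum_mono)
    fix X assume "X \<in> ?T"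
    then have le: "card X \<le> ?s" using assms(1) by (simp add: card_mono)
    have m: "?m \<le> ?s" by simp
    have "fact ?m * fact (?s - ?m) * (?s choose card X) \<le> fact ?m * fact (?s - ?m) * (?s choose ?m)"
      by (intro mult_left_mono binomial_maximum) auto
    also have "\<dots> = fact (card X) * fact (?s - card X) * (?s choose card X)"
      using binomial_fact_lemma[OF le] binomial_fact_lemma[OF m] by simp
    finally show "(fact ?m * fact (?s - ?m) :: nat) \<le> fact (card X) * fact (?s - card X)"
      using le by (simp add: zero_less_binomial)
  qed
  also have "\<dots> \<le> fact ?s" by (rule sum_fact_subset_sum_le[OF assms])
  also have "\<dots> = (?s choose ?m) * (fact ?m * fact (?s - ?m))"
    using binomial_fact_lemma[of ?m ?s] by (simp add: ac_simps)
  finally show ?thesis by simp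
qed

lemma Suc_mult_eq_double_iff: "Suc h * a = (2*h+2) * b \<longleftrightarrow> a = 2 * (b::nat)"
proof -
  have "(2*h+2) * b = Suc h * (2 * b)" by simp
  then show ?thesis by (metis Suc_not_Zero mult_cancel1)
qed

text \<open>The bound 4^h / sqrt(2h+1), squared to stay within the natural numbers. Successive
  central coefficients have quotient 2(2h+1)/(h+1), and (2h+1)(2h+3) is at most (2h+2)^2.\<close>

lemma central_binomial_sqr_le: "((2*h) choose h)\<^sup>2 * (2*h+1) \<le> 16 ^ h"
proof (induction h)
  case (Suc h)
  let ?c = "(2*h) choose h" let ?d = "(2 * Suc h) choose Suc h"
  have "Suc h * ?d = (2*h+2) * ((2*h+1) choose h)"
    using Suc_times_binomial_eq[of "2*h+1" h] by (simp add: ac_simps)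
  then have 1: "?d = 2 * ((2*h+1) choose h)"
    by (simp only: Suc_mult_eq_double_iff)
  have 2: "(h+1) * ((2*h+1) choose h) = (2*h+1) * ?c"
    using binomial_absorb_comp[of "2*h+1" h] by simp
  have "(h+1) * ?d = 2 * ((h+1) * ((2*h+1) choose h))" using 1 by simp
  then have 3: "(h+1) * ?d = 2 * (2*h+1) * ?c" using 2 by simp
  have "(h+1)\<^sup>2 * (?d\<^sup>2 * (2*h+3)) = ((h+1) * ?d)\<^sup>2 * (2*h+3)"
    by (simp only: power_mult_distrib mult.assoc)
  also have "\<dots> = 4 * (2*h+1) * (2*h+3) * (?c\<^sup>2 * (2*h+1))"
    unfolding 3 by (simp add: power2_eq_square algebra_simps)
  also have "\<dots> \<le> 4 * (2*h+1) * (2*h+3) * 16^h" using Suc by (intro mult_left_mono) auto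
  also have "\<dots> \<le> (4 * (2 * (h+1))\<^sup>2) * 16 ^ h"
    by (intro mult_right_mono) (auto simp: power2_eq_square algebra_simps)
  also have "\<dots> = (h+1)\<^sup>2 * 16 ^ Suc h" by (simp add: power2_eq_square algebra_simps)
  finally have "?d\<^sup>2 * (2*h+3) \<le> 16 ^ Suc h" by (simp del: power_Suc)
  then show ?case by (simp add: eval_nat_numeral)
qed simp

lemma middle_binomial_sqr_le: "(s choose (s div 2))\<^sup>2 * (s+1) \<le> 4 ^ s"
proof (cases "even s")
  case True
  then obtain h where "s = 2*h" by blast
  then show ?thesis using central_binomial_sqr_le[of h] by (simp add: power_mult)
next
  case False
  then obtain h where s: "s = 2*h+1" using oddE by blast
  have "Suc h * (2 * Suc h choose Suc h) = (2*h+2) * ((2*h+1) choose h)"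
    using Suc_times_binomial_eq[of "2*h+1" h] by (simp add: ac_simps)
  then have 1: "(2 * Suc h choose Suc h) = 2 * ((2*h+1) choose h)"
    by (simp only: Suc_mult_eq_double_iff)
  have "4 * (((2*h+1) choose h)\<^sup>2 * (2*h+2)) \<le> (2 * Suc h choose Suc h)\<^sup>2 * (2 * Suc h + 1)"
    unfolding 1 by (simp add: power_mult_distrib)
  also have "\<dots> \<le> 16 ^ Suc h" by (rule central_binomial_sqr_le)
  also have "\<dots> = 4 * 4 ^ (2*h+1)" by (simp add: power_mult)
  finally show ?thesis by (simp add: s)
qed

text \<open>Reflection: the symmetric difference with the set of negative elements replaces
  \<open>v\<close> by its absolute value and shifts all sums by the same amount, so signs do not
  matter.\<close>

lemma card_subset_sum_eq_nonzero:
  fixes v :: "'a \<Rightarrow> int"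
  assumes "finite S" "\<And>x. x \<in> S \<Longrightarrow> v x \<noteq> 0"
  shows "card {X. X \<subseteq> S \<and> sum v X = a} \<le> card S choose (card S div 2)"
proof -
  let ?N = "{x\<in>S. v x < 0}" let ?g = "\<lambda>X. sym_diff X ?N"
  let ?b = "a + sum (\<lambda>x. \<bar>v x\<bar>) ?N"
  have "card {X. X \<subseteq> S \<and> sum v X = a} \<le> card {X. X \<subseteq> S \<and> sum (\<lambda>x. \<bar>v x\<bar>) X = ?b}"
  proof (rule card_inj_on_le)
    show "inj_on ?g {X. X \<subseteq> S \<and> sum v X = a}" by (rule inj_onI) blast
    have "sum (\<lambda>x. \<bar>v x\<bar>) (?g X) = ?b" if X: "X \<subseteq> S" "sum v X = a" for X
    proof -
      have f: "finite X" using X assms(1) finite_subset by blast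
      have "sum (\<lambda>x. \<bar>v x\<bar>) (?g X) = sum (\<lambda>x. \<bar>v x\<bar>) (X - ?N) + sum (\<lambda>x. \<bar>v x\<bar>) (?N - X)"
        using f assms(1) by (intro sum.union_disjoint) auto
      moreover have "sum (\<lambda>x. \<bar>v x\<bar>) (X - ?N) = sum v (X - ?N)"
        using X by (intro sum.cong) auto
      moreover have "sum v X = sum v (X - ?N) + sum v (X \<inter> ?N)"
        using f by (subst sum.Int_Diff[of X _ ?N]) simp_all
      moreover have "sum v (X \<inter> ?N) = - sum (\<lambda>x. \<bar>v x\<bar>) (X \<inter> ?N)"
        unfolding sum_negf[symmetric] by (intro sum.cong) auto
      moreover have "sum (\<lambda>x. \<bar>v x\<bar>) ?N = sum (\<lambda>x. \<bar>v x\<bar>) (?N - X) + sum (\<lambda>x. \<bar>v x\<bar>) (X \<inter> ?N)"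
        using assms(1) by (subst sum.Int_Diff[of ?N _ X]) (auto simp: Int_commute)
      ultimately show ?thesis using X by simp
    qed
    then show "?g ` {X. X \<subseteq> S \<and> sum v X = a} \<subseteq> {X. X \<subseteq> S \<and> sum (\<lambda>x. \<bar>v x\<bar>) X = ?b}"
      by auto
  qed (use assms in auto)
  also have "\<dots> \<le> card S choose (card S div 2)"
    using assms by (intro card_subset_sum_le_binomial) auto
  finally show ?thesis .
qed

text \<open>Elements of value zero are free and contribute their full power of 2; the rest is the
  middle binomial bound. With 1 added under the root, the bound also makes sense if all values
  vanish.\<close>

theorem littlewood_offord:
  fixes v :: "'a \<Rightarrow> int"
  assumes "finite U"
  shows "real (card {X \<in> Pow U. sum v X = a}) \<le> 2 ^ card U / sqrt (1 + card {x \<in> U. v x \<noteq> 0})"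
proof -
  let ?S = "{x\<in>U. v x \<noteq> 0}" let ?Z = "{x\<in>U. v x = 0}"
  let ?T = "{X. X \<subseteq> ?S \<and> sum v X = a}"
  have fin: "finite ?T" "finite (Pow ?Z)" using assms by auto
  have "card {X \<in> Pow U. sum v X = a} \<le> card (?T \<times> Pow ?Z)"
  proof (rule card_inj_on_le)
    show "inj_on (\<lambda>X. (X \<inter> ?S, X \<inter> ?Z)) {X \<in> Pow U. sum v X = a}"
      by (rule inj_onI) blast
    have "sum v (X \<inter> ?S) = sum v X" if "X \<subseteq> U" for X
      using that assms by (intro sum.mono_neutral_left) (auto intro: finite_subset)
    then show "(\<lambda>X. (X \<inter> ?S, X \<inter> ?Z)) ` {X \<in> Pow U. sum v X = a} \<subseteq> ?T \<times> Pow ?Z" by auto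
    show "finite (?T \<times> Pow ?Z)" using fin by blast
  qed
  also have "\<dots> = card ?T * 2 ^ card ?Z"
    using assms by (simp add: card_cartesian_product card_Pow)
  also have "\<dots> \<le> (card ?S choose (card ?S div 2)) * 2 ^ card ?Z"
    using assms by (intro mult_right_mono card_subset_sum_eq_nonzero) auto
  finally have "real (card {X \<in> Pow U. sum v X = a}) \<le>
      real ((card ?S choose (card ?S div 2)) * 2 ^ card ?Z)"
    by (rule of_nat_mono)
  then have 1: "real (card {X \<in> Pow U. sum v X = a}) \<le>
      real (card ?S choose (card ?S div 2)) * 2 ^ card ?Z" by simp
  have "real ((card ?S choose (card ?S div 2))\<^sup>2 * (card ?S + 1)) \<le> real (4 ^ card ?S)"
    by (rule of_nat_mono[OF middle_binomial_sqr_le])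
  moreover have "real (4 ^ card ?S) = (2 ^ card ?S)\<^sup>2"
    by (simp add: power2_eq_square flip: power_mult_distrib)
  ultimately have "(real (card ?S choose (card ?S div 2)) * sqrt (1 + card ?S))\<^sup>2 \<le> (2 ^ card ?S)\<^sup>2"
    unfolding power_mult_distrib by (simp add: algebra_simps)
  then have "real (card ?S choose (card ?S div 2)) * sqrt (1 + card ?S) \<le> 2 ^ card ?S"
    by (rule power2_le_imp_le) simp
  then have 2: "real (card ?S choose (card ?S div 2)) \<le> 2 ^ card ?S / sqrt (1 + card ?S)"
    by (subst pos_le_divide_eq) auto
  have "card U = card (?S \<union> ?Z)" by (rule arg_cong[of _ _ card]) auto
  also have "\<dots> = card ?S + card ?Z" using assms by (intro card_Un_disjoint) auto
  finally have "2 ^ card U / sqrt (1 + card ?S) = 2 ^ card ?S / sqrt (1 + card ?S) * 2 ^ card ?Z"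
    by (simp add: power_add)
  moreover have "real (card ?S choose (card ?S div 2)) * 2 ^ card ?Z \<le>
      2 ^ card ?S / sqrt (1 + card ?S) * 2 ^ card ?Z"
    using 2 by (rule mult_right_mono) simp
  ultimately show ?thesis using 1 by linarith
qed

section \<open>Detecting sparse matrices\<close>

lemma exists_le_average:
  fixes f :: "'a \<Rightarrow> real" and c :: real
  assumes "finite \<Omega>" "\<Omega> \<noteq> {}" "(\<Sum>\<omega>\<in>\<Omega>. f \<omega>) \<le> c * card \<Omega>"
  shows "\<exists>\<omega>\<in>\<Omega>. f \<omega> \<le> c"
proof (rule ccontr)
  assume "\<not> ?thesis"
  then have "(\<Sum>\<omega>\<in>\<Omega>. c) < (\<Sum>\<omega>\<in>\<Omega>. f \<omega>)"
    using assms by (intro sum_strict_mono) auto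
  with assms show False by (simp add: mult.commute)
qed

text \<open>The method of conditional expectations, with one independent choice per index.\<close>

lemma exists_choices_le_average:
  fixes g :: "nat \<Rightarrow> 'z \<Rightarrow> 'w \<Rightarrow> real" and p :: "nat \<Rightarrow> 'z \<Rightarrow> real" and a :: "'z \<Rightarrow> real"
  assumes fin: "finite Z" "finite \<Omega>" "\<Omega> \<noteq> {}"
    and nn: "\<And>k z \<omega>. g k z \<omega> \<ge> 0" and p: "\<And>k z. p k z \<ge> 0"
    and avg: "\<And>k z. k < K \<Longrightarrow> z \<in> Z \<Longrightarrow> (\<Sum>\<omega>\<in>\<Omega>. g k z \<omega>) \<le> p k z * card \<Omega>"
    and a: "\<And>z. a z \<ge> 0"
  shows "\<exists>\<omega>. (\<forall>k. \<omega> k \<in> \<Omega>) \<and> (\<Sum>z\<in>Z. a z * (\<Prod>k<K. g k z (\<omega> k))) \<le> (\<Sum>z\<in>Z. a z * (\<Prod>k<K. p k z))"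
  using avg a
proof (induction K arbitrary: a)
  case 0
  obtain w where "w \<in> \<Omega>" using fin by blast
  then show ?case by (intro exI[of _ "\<lambda>_. w"]) simp
next
  case (Suc K)
  \<comment> \<open>The weights take over the average of the last factor, so the earlier choices are
    made as if index \<open>K\<close> were still random.\<close>
  have "\<exists>\<omega>. (\<forall>k. \<omega> k \<in> \<Omega>) \<and> (\<Sum>z\<in>Z. (a z * p K z) * (\<Prod>k<K. g k z (\<omega> k)))
      \<le> (\<Sum>z\<in>Z. (a z * p K z) * (\<Prod>k<K. p k z))"
    using Suc.prems p by (intro Suc.IH) auto
  then obtain \<omega> where \<omega>: "\<And>k. \<omega> k \<in> \<Omega>"
    and le: "(\<Sum>z\<in>Z. (a z * p K z) * (\<Prod>k<K. g k z (\<omega> k))) \<le> (\<Sum>z\<in>Z. (a z * p K z) * (\<Prod>k<K. p k z))"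
    by blast
  let ?b = "\<lambda>z. a z * (\<Prod>k<K. g k z (\<omega> k))"
  have b: "?b z \<ge> 0" for z using Suc.prems(2) nn by (simp add: prod_nonneg)
  have "(\<Sum>w\<in>\<Omega>. \<Sum>z\<in>Z. ?b z * g K z w) = (\<Sum>z\<in>Z. ?b z * (\<Sum>w\<in>\<Omega>. g K z w))"
    by (subst sum.swap) (simp add: sum_distrib_left)
  also have "\<dots> \<le> (\<Sum>z\<in>Z. ?b z * (p K z * card \<Omega>))"
    using Suc.prems(1) b by (intro sum_mono mult_left_mono) auto
  also have "\<dots> = (\<Sum>z\<in>Z. ?b z * p K z) * card \<Omega>"
    by (simp add: sum_distrib_right mult.assoc)
  finally obtain w where w: "w \<in> \<Omega>" "(\<Sum>z\<in>Z. ?b z * g K z w) \<le> (\<Sum>z\<in>Z. ?b z * p K z)"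
    using exists_le_average[OF fin(2,3)] by blast
  define \<omega>' where "\<omega>' = fun_upd \<omega> K w"
  have "(\<Prod>k<K. g k z (\<omega>' k)) = (\<Prod>k<K. g k z (\<omega> k))" for z
    by (rule prod.cong) (auto simp: \<omega>'_def)
  then have "(\<Sum>z\<in>Z. a z * (\<Prod>k<Suc K. g k z (\<omega>' k))) = (\<Sum>z\<in>Z. ?b z * g K z w)"
    by (simp add: mult.assoc) (simp add: \<omega>'_def)
  also have "\<dots> \<le> (\<Sum>z\<in>Z. ?b z * p K z)" by (rule w(2))
  also have "\<dots> = (\<Sum>z\<in>Z. (a z * p K z) * (\<Prod>k<K. g k z (\<omega> k)))"
    by (simp add: ac_simps)
  also note le
  also have "(\<Sum>z\<in>Z. (a z * p K z) * (\<Prod>k<K. p k z)) = (\<Sum>z\<in>Z. a z * (\<Prod>k<Suc K. p k z))"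
    by (simp add: ac_simps)
  finally show ?case using w(1) \<omega> by (intro exI[of _ "\<omega>'"]) (auto simp: \<omega>'_def)
qed

definition sparse_funs :: "'a set \<Rightarrow> nat \<Rightarrow> nat \<Rightarrow> ('a \<Rightarrow> int) set" where
  "sparse_funs J W e = {z. (\<forall>i. i \<notin> J \<longrightarrow> z i = 0) \<and> (\<forall>i. \<bar>z i\<bar> \<le> int W) \<and> card {i\<in>J. z i \<noteq> 0} \<le> e}"

text \<open>A sparse function is coded by a list of \<open>e\<close> pairs of a position and a
  value. The count is crude, but only its logarithm matters later.\<close>

lemma sparse_funs_finite_card:
  assumes "finite J" "J \<noteq> {}"
  shows "finite (sparse_funs J W e)" "card (sparse_funs J W e) \<le> (card J * (2*W+1)) ^ e"
proof -
  let ?X = "J \<times> {- int W..int W}"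
  let ?L = "{xs. set xs \<subseteq> ?X \<and> length xs = e}"
  let ?F = "\<lambda>xs i. case_option (0::int) id (map_of xs i)"
  have finX: "finite ?X" using assms by simp
  have sub: "sparse_funs J W e \<subseteq> ?F ` ?L"
  proof
    fix z assume z: "z \<in> sparse_funs J W e"
    let ?S = "{i\<in>J. z i \<noteq> 0}"
    have "finite ?S" using assms by simp
    then obtain ys where ys: "set ys = ?S" "length ys = card ?S"
      using finite_distinct_list[of ?S] distinct_card by fastforce
    obtain i0 where i0: "i0 \<in> J" using assms by blast
    \<comment> \<open>The padding repeats the true pair at \<open>i0\<close>, possibly with value 0,
      so the list has length exactly \<open>e\<close> and \<open>map_of\<close> still returns values
      of \<open>z\<close>.\<close>
    define xs where "xs = map (\<lambda>i. (i, z i)) (ys @ replicate (e - card ?S) i0)"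
    have "map_of (map (\<lambda>i. (i, z i)) zs) i = (if i \<in> set zs then Some (z i) else None)" for zs i
      by (induction zs) auto
    then have "map_of xs i = (if i \<in> set (ys @ replicate (e - card ?S) i0) then Some (z i) else None)" for i
      unfolding xs_def .
    then have "?F xs i = z i" for i
      using z ys by (auto simp: sparse_funs_def)
    then have "?F xs = z" by blast
    moreover have "xs \<in> ?L"
      using z ys i0 by (auto simp: xs_def sparse_funs_def abs_le_iff minus_le_iff)
    ultimately show "z \<in> ?F ` ?L" by blast
  qed
  have fin: "finite ?L" by (rule finite_lists_length_eq[OF finX])
  with sub show "finite (sparse_funs J W e)" by (blast intro: finite_subset)
  have "card (sparse_funs J W e) \<le> card ?L"
    using sub fin by (meson card_image_le card_mono finite_imageI order_trans)
  also have "\<dots> = (card J * (2*W+1)) ^ e"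
    using card_lists_length_eq[OF finX] by (simp add: card_cartesian_product nat_add_distrib nat_mult_distrib mult.commute)
  finally show "card (sparse_funs J W e) \<le> (card J * (2*W+1)) ^ e" .
qed

text \<open>Toggling an element of nonzero value maps the subsets with sum 0 injectively to subsets
  with nonzero sum.\<close>

lemma card_sum_eq_zero_le_half:
  fixes v :: "'a \<Rightarrow> int"
  assumes "finite U" "\<exists>x\<in>U. v x \<noteq> 0"
  shows "2 * card {X\<in>Pow U. sum v X = 0} \<le> 2 ^ card U"
proof -
  obtain x where x: "x \<in> U" "v x \<noteq> 0" using assms by blast
  let ?A = "{X\<in>Pow U. sum v X = 0}" and ?B = "{X\<in>Pow U. sum v X \<noteq> 0}"
  let ?g = "\<lambda>X. sym_diff X {x}"
  have "card ?A \<le> card ?B"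
  proof (rule card_inj_on_le)
    show "inj_on ?g ?A" by (rule inj_onI) blast
    have "sum v (?g X) \<noteq> 0" if "X \<subseteq> U" "sum v X = 0" for X
    proof (cases "x \<in> X")
      case True
      have "finite X" using that assms finite_subset by blast
      moreover have "?g X = X - {x}" using True by blast
      ultimately show ?thesis using True that x by (simp add: sum_diff1)
    next
      case False
      have "finite X" using that assms finite_subset by blast
      moreover have "?g X = insert x X" using False by blast
      ultimately show ?thesis using False that x by simp
    qed
    then show "?g ` ?A \<subseteq> ?B" using x by auto
  qed (use assms in auto)
  moreover have "card (Pow U) = card ?A + card ?B"
  proof -
    have "Pow U = ?A \<union> ?B" by blast
    then show ?thesis using assms by (metis (no_types, lifting) card_Un_disjoint disjoint_iff
          finite_Pow_iff finite_Un mem_Collect_eq)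
  qed
  ultimately show ?thesis using assms by (simp add: card_Pow)
qed

text \<open>A Chernoff bound: an index that detects \<open>z\<close> contributes the factor 1/16 and
  any other the factor 1, so the mean factor is at most (1 + 1/16)/2 = 17/32. Its eighth power is
  below 2^-7. Over at most 2^(3k) functions this leaves a total of at most 16^-k, whereas a function
  detected fewer than k times would alone contribute more.\<close>

lemma exists_column_sets:
  assumes R: "finite R" "R \<noteq> {}" and B: "card R * (2*W+1) \<le> 2 ^ \<beta>" and k: "\<beta> * d \<le> 3 * k"
  shows "\<exists>Y. (\<forall>i. Y i \<subseteq> R) \<and> (\<forall>z\<in>sparse_funs R W d. (\<exists>v\<in>R. z v \<noteq> 0) \<longrightarrow>
    k \<le> card {i. i < 8*k \<and> sum z (Y i) \<noteq> 0})"
proof -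
  let ?Z = "{z\<in>sparse_funs R W d. \<exists>v\<in>R. z v \<noteq> 0}"
  let ?g = "\<lambda>(k::nat) z Y. if sum z Y = 0 then 1 else 1/16 :: real"
  have finZ: "finite ?Z" using sparse_funs_finite_card(1)[OF R] by simp
  have "\<exists>Y. (\<forall>k. Y k \<in> Pow R) \<and> (\<Sum>z\<in>?Z. 1 * (\<Prod>i<8*k. ?g i z (Y i))) \<le> (\<Sum>z\<in>?Z. 1 * (\<Prod>i<8*k. 17/32))"
  proof (rule exists_choices_le_average[where p = "\<lambda>_ _. 17/32" and a = "\<lambda>_. 1"])
    fix k z assume "z \<in> ?Z"
    then have h: "2 * card {X\<in>Pow R. sum z X = 0} \<le> 2 ^ card R"
      by (intro card_sum_eq_zero_le_half) (use R in auto)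
    have "(\<Sum>Y\<in>Pow R. if sum z Y = 0 then 1 else 1/16 :: real) =
       (\<Sum>Y\<in>Pow R. 1/16 + (if sum z Y = 0 then 15/16 else 0))"
      by (intro sum.cong) auto
    also have "\<dots> = 2 ^ card R / 16 + (\<Sum>Y\<in>Pow R. if sum z Y = 0 then 15/16 else 0)"
      using R by (simp add: sum.distrib card_Pow)
    also have "(\<Sum>Y\<in>Pow R. if sum z Y = 0 then 15/16 else 0 :: real) = 15/16 * card {X\<in>Pow R. sum z X = 0}"
      using R by (simp flip: sum.inter_filter)
    also have "\<dots> \<le> 15/16 * (2 ^ card R / 2)"
      using of_nat_mono[OF h, where 'a = real] by simp
    finally show "(\<Sum>Y\<in>Pow R. if sum z Y = 0 then 1 else 1/16 :: real) \<le> 17/32 * real (card (Pow R))"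
      using R by (simp add: card_Pow)
  qed (use R finZ in auto)
  then obtain Y where Y: "\<And>k. Y k \<in> Pow R"
    and le: "(\<Sum>z\<in>?Z. (\<Prod>i<8*k. ?g i z (Y i))) \<le> card ?Z * (17/32)^(8*k)"
    by auto
  have "card ?Z \<le> card (sparse_funs R W d)"
    using sparse_funs_finite_card(1)[OF R] by (intro card_mono) auto
  also have "\<dots> \<le> (card R * (2*W+1)) ^ d" by (rule sparse_funs_finite_card(2)[OF R])
  also have "\<dots> \<le> (2 ^ \<beta>) ^ d" using B by (intro power_mono) auto
  also have "\<dots> \<le> 2 ^ (3*k)" using k by (simp flip: power_mult)
  finally have c: "real (card ?Z) \<le> 2 ^ (3*k)"
    using of_nat_mono[where 'a = real] by fastforce
  have "(17/32 :: real)^(8*k) \<le> (1/2^7)^k"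
    unfolding power_mult by (intro power_mono) (auto simp: power_divide)
  then have "card ?Z * (17/32)^(8*k) \<le> (2 ^ (3*k)) * (1/2^7 :: real)^k"
    using c by (intro mult_mono) auto
  also have "\<dots> = (2^3 * (1/2^7)) ^ k"
    unfolding power_mult power_mult_distrib by simp
  also have "\<dots> = (1/16)^k" by simp
  finally have le2: "(\<Sum>z\<in>?Z. (\<Prod>i<8*k. ?g i z (Y i))) \<le> (1/16)^k" using le by linarith
  have "k \<le> card {i. i < 8*k \<and> sum z (Y i) \<noteq> 0}" if z: "z \<in> sparse_funs R W d" "\<exists>v\<in>R. z v \<noteq> 0" for z
  proof (rule ccontr)
    assume neg: "\<not> ?thesis"
    let ?N = "{i. i < 8*k \<and> sum z (Y i) \<noteq> 0}"
    have "(\<Prod>i<8*k. ?g i z (Y i)) = (\<Prod>i\<in>?N. ?g i z (Y i))"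
      by (rule prod.mono_neutral_right) auto
    also have "\<dots> = (\<Prod>i\<in>?N. 1/16)" by (rule prod.cong) auto
    also have "\<dots> = (1/16) ^ card ?N" by simp
    finally have "(\<Prod>i<8*k. ?g i z (Y i)) = (1/16) ^ card ?N" .
    moreover have "(1/16::real) ^ card ?N > (1/16) ^ k" using neg by (intro power_strict_decreasing) auto
    moreover have "(\<Prod>i<8*k. ?g i z (Y i)) \<le> (\<Sum>z\<in>?Z. (\<Prod>i<8*k. ?g i z (Y i)))"
      using finZ z by (intro member_le_sum) (auto intro!: prod_nonneg)
    ultimately show False using le2 by linarith
  qed
  then show ?thesis using Y by (intro exI[of _ Y]) auto
qed

text \<open>If fewer than 2k indices reached t/16, the average of \<open>s\<close> would fall below
  t/8.\<close>

lemma card_good_indices: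
  fixes s :: "nat \<Rightarrow> nat"
  assumes le: "\<And>i. i < 32*k \<Longrightarrow> s i \<le> t" and sum: "4 * k * t \<le> (\<Sum>i<32*k. s i)" and t: "t > 0"
  shows "2 * k \<le> card {i. i < 32*k \<and> t \<le> 16 * s i}"
proof -
  let ?G = "{i. i < 32*k \<and> t \<le> 16 * s i}"
  have G: "{i\<in>{..<32*k}. t \<le> 16 * s i} = ?G" by auto
  have cG: "card ?G \<le> 32*k" using card_mono[of "{..<32*k}" ?G] by auto
  have "16 * (\<Sum>i<32*k. s i) = (\<Sum>i<32*k. 16 * s i)" by (simp add: sum_distrib_left)
  also have "\<dots> \<le> (\<Sum>i<32*k. t + (if t \<le> 16 * s i then 15 * t else 0))"
    using le by (intro sum_mono) fastforce
  also have "\<dots> = 32 * k * t + 15 * t * card ?G"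
    by (simp add: sum.distrib G flip: sum.inter_filter)
  finally have "16 * (4 * k * t) \<le> 32 * k * t + 15 * t * card ?G"
    using sum by linarith
  then have "(64 * k) * t \<le> (32 * k + 15 * card ?G) * t"
    unfolding distrib_right by (simp only: ac_simps)
  then have "64 * k \<le> 32 * k + 15 * card ?G" using t by (simp only: mult_le_cancel2)
  then show ?thesis by linarith
qed

lemma prod_le_power_on_subset:
  fixes f :: "nat \<Rightarrow> real"
  assumes f: "\<And>i. i < K \<Longrightarrow> 0 \<le> f i \<and> f i \<le> 1" and G: "G \<subseteq> {..<K}" "m \<le> card G"
    and c: "\<And>i. i \<in> G \<Longrightarrow> f i \<le> c" "0 \<le> c" "c \<le> 1"
  shows "(\<Prod>i<K. f i) \<le> c ^ m"
proof -
  have fG: "finite G" using G finite_subset by blast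
  have "(\<Prod>i<K. f i) = (\<Prod>i\<in>G. f i) * (\<Prod>i\<in>{..<K} - G. f i)"
    using G by (subst prod.subset_diff[of G]) (auto simp: mult.commute)
  also have "\<dots> \<le> (\<Prod>i\<in>G. c) * 1"
    using f G c by (intro mult_mono prod_mono prod_le_1) (auto intro!: prod_nonneg)
  also have "\<dots> = c ^ card G" by simp
  also have "\<dots> \<le> c ^ m" using G c by (intro power_decreasing) auto
  finally show ?thesis .
qed

text \<open>\<open>\<beta>\<close> bits code an entry with its position. The column sets are fixed
  before the row sets, so that each nonzero row is seen by an eighth of them; then a sixteenth of
  the indices see at least a sixteenth of the t nonzero rows, and there Littlewood-Offord applies to
  a random set of rows. For t below \<open>16 * 2^\<tau>\<close> there are at most
  \<open>2 ^ (\<beta> * (d * (16 * 2^\<tau>)))\<close> matrices, each missed with probability at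
  most 2^-k (\<open>H2\<close>); for larger t at most \<open>2 ^ (\<beta> * e)\<close> matrices are
  missed with probability at most 2^-(\<tau> k) each (\<open>H3\<close>). So \<open>k\<close> is of
  order \<beta> e / \<tau>, and the division by \<tau> is the gain.\<close>

theorem exists_detecting_design:
  fixes U :: "'u set" and R :: "'v set" and W \<beta> d e \<tau> k :: nat
  assumes U: "finite U" "U \<noteq> {}" and R: "finite R" "R \<noteq> {}"
    and B: "card U * card R * (2*W+1) \<le> 2 ^ \<beta>"
    and H2: "\<beta> * (d * (16 * 2^\<tau>)) + 2 \<le> k"
    and H3: "\<beta> * e + 2 \<le> \<tau> * k"
  shows "\<exists>X Y. (\<forall>i. X i \<subseteq> U \<and> Y i \<subseteq> R) \<and> (\<forall>Z :: 'u \<Rightarrow> 'v \<Rightarrow> int.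
    (\<forall>u\<in>U. \<forall>v\<in>R. \<bar>Z u v\<bar> \<le> int W) \<longrightarrow> (\<forall>u\<in>U. card {v\<in>R. Z u v \<noteq> 0} \<le> d) \<longrightarrow>
    (\<Sum>u\<in>U. card {v\<in>R. Z u v \<noteq> 0}) \<le> e \<longrightarrow> (\<exists>u\<in>U. \<exists>v\<in>R. Z u v \<noteq> 0) \<longrightarrow>
    (\<exists>i<32*k. (\<Sum>u\<in>X i. \<Sum>v\<in>Y i. Z u v) \<noteq> 0))"
proof -
  have "card U \<ge> 1" using U by (simp add: Suc_le_eq card_gt_0_iff)
  then have "1 * (card R * (2*W+1)) \<le> card U * (card R * (2*W+1))" by (rule mult_right_mono) simp
  with B have BR: "card R * (2*W+1) \<le> 2 ^ \<beta>" by (simp only: mult.assoc mult_1)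
  have "\<beta> * d \<le> \<beta> * (d * (16 * 2^\<tau>))" by simp
  with H2 have "\<beta> * d \<le> 3 * (4*k)" by linarith
  note Yex = exists_column_sets[OF R BR this]
  define Y where "Y = (SOME Y. (\<forall>i. Y i \<subseteq> R) \<and> (\<forall>z\<in>sparse_funs R W d. (\<exists>v\<in>R. z v \<noteq> 0) \<longrightarrow>
      4*k \<le> card {i. i < 8*(4*k) \<and> sum z (Y i) \<noteq> 0}))"
  note YY = someI_ex[OF Yex, folded Y_def]
  have Y: "Y i \<subseteq> R" for i using YY by (rule conjE) (erule allE)
  have Yd: "4*k \<le> card {i. i < 32*k \<and> sum z (Y i) \<noteq> 0}"
    if "z\<in>sparse_funs R W d" "\<exists>v\<in>R. z v \<noteq> 0" for z
    using bspec[OF conjunct2[OF YY] that(1)] that(2) by simp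
  let ?J = "U \<times> R"
  have J: "finite ?J" "?J \<noteq> {}" using U R by auto
  have BJ: "card ?J * (2*W+1) \<le> 2^\<beta>" using B by (simp add: card_cartesian_product)
  define C where "C = {Z \<in> sparse_funs ?J W e. (\<forall>u\<in>U. card {v\<in>R. Z (u,v) \<noteq> 0} \<le> d) \<and> (\<exists>u\<in>U. \<exists>v\<in>R. Z (u,v) \<noteq> 0)}"
  define w where "w i Z u = (\<Sum>v\<in>Y i. Z (u,v))" for i and Z :: "'u \<times> 'v \<Rightarrow> int" and u
  define s where "s i Z = card {u\<in>U. w i Z u \<noteq> 0}" for i Z
  define t where "t Z = card {u\<in>U. \<exists>v\<in>R. Z (u,v) \<noteq> 0}" for Z :: "'u \<times> 'v \<Rightarrow> int"
  define g :: "nat \<Rightarrow> ('u \<times> 'v \<Rightarrow> int) \<Rightarrow> 'u set \<Rightarrow> real"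
    where "g i Z X = (if (\<Sum>u\<in>X. w i Z u) = 0 then 1 else 0)" for i Z X
  define p where "p i Z = 1 / sqrt (1 + real (s i Z))" for i Z
  have finC: "finite C" unfolding C_def using sparse_funs_finite_card(1)[OF J] by simp
  have "\<exists>X. (\<forall>i. X i \<in> Pow U) \<and> (\<Sum>z\<in>C. 1 * (\<Prod>i<32*k. g i z (X i))) \<le> (\<Sum>z\<in>C. 1 * (\<Prod>i<32*k. p i z))"
  proof (rule exists_choices_le_average)
    fix i z
    have "(\<Sum>X\<in>Pow U. g i z X) = card {X\<in>Pow U. sum (w i z) X = 0}"
      unfolding g_def using U by (simp flip: sum.inter_filter)
    also have "\<dots> \<le> 2 ^ card U / sqrt (1 + card {u\<in>U. w i z u \<noteq> 0})"
      by (rule littlewood_offord[OF U(1)])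
    finally show "(\<Sum>X\<in>Pow U. g i z X) \<le> p i z * card (Pow U)"
      using U by (simp add: p_def s_def card_Pow)
  qed (use U finC in \<open>auto simp: g_def p_def\<close>)
  then obtain X where X: "\<And>i. X i \<subseteq> U"
    and le: "(\<Sum>z\<in>C. (\<Prod>i<32*k. g i z (X i))) \<le> (\<Sum>z\<in>C. (\<Prod>i<32*k. p i z))"
    by auto
  have p01: "0 \<le> p i z \<and> p i z \<le> 1" for i z by (simp add: p_def)
  have good: "2 * k \<le> card {i. i < 32*k \<and> t Z \<le> 16 * s i Z}" and tpos: "t Z > 0" if Z: "Z \<in> C" for Z
  proof -
    let ?T = "{u\<in>U. \<exists>v\<in>R. Z (u,v) \<noteq> 0}"
    have finT: "finite ?T" using U by simp
    show "t Z > 0" unfolding t_def card_gt_0_iff using Z finT by (auto simp: C_def)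
    show "2 * k \<le> card {i. i < 32*k \<and> t Z \<le> 16 * s i Z}"
    proof (rule card_good_indices)
      show "s i Z \<le> t Z" for i
        unfolding s_def t_def
      proof (rule card_mono[OF finT], rule subsetI)
        fix u assume "u \<in> {u\<in>U. w i Z u \<noteq> 0}"
        then have "u \<in> U" "w i Z u \<noteq> 0" by simp_all
        moreover from this(2) obtain v where "v \<in> Y i" "Z (u,v) \<noteq> 0"
          unfolding w_def by (rule sum.not_neutral_contains_not_neutral)
        ultimately show "u \<in> ?T" using Y[of i] by blast
      qed
      have row: "4*k \<le> card {i. i < 32*k \<and> w i Z u \<noteq> 0}" if u: "u \<in> ?T" for u
      proof -
        let ?z = "\<lambda>v. Z (u,v)"
        have "?z \<in> sparse_funs R W d"
          using Z u by (auto simp: C_def sparse_funs_def)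
        from Yd[OF this] u show ?thesis by (auto simp: w_def)
      qed
      have "4 * k * t Z = (\<Sum>u\<in>?T. 4 * k)" by (simp add: t_def)
      also have "\<dots> \<le> (\<Sum>u\<in>?T. card {i. i < 32*k \<and> w i Z u \<noteq> 0})"
        by (rule sum_mono[OF row])
      also have "\<dots> \<le> (\<Sum>u\<in>U. card {i. i < 32*k \<and> w i Z u \<noteq> 0})"
        using U by (intro sum_mono2) auto
      also have "\<dots> = (\<Sum>u\<in>U. \<Sum>i\<in>{i\<in>{..<32*k}. w i Z u \<noteq> 0}. 1)" by simp
      also have "\<dots> = (\<Sum>i<32*k. \<Sum>u\<in>{u\<in>U. w i Z u \<noteq> 0}. 1)"
        using U by (intro sum.swap_restrict) auto
      also have "\<dots> = (\<Sum>i<32*k. s i Z)" by (simp add: s_def)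
      finally show "4 * k * t Z \<le> (\<Sum>i<32*k. s i Z)" .
    qed (rule \<open>t Z > 0\<close>)
  qed
  let ?y = "1 / sqrt 2 :: real"
  define T0 where "T0 = (16 * 2^\<tau> :: nat)"
  define C1 where "C1 = {Z\<in>C. t Z < T0}" 
  define C2 where "C2 = {Z\<in>C. t Z \<ge> T0}"
  have y2: "?y ^ (2 * n) = (1/2)^n" for n by (simp add: power_mult power_divide)
  have p1: "(\<Prod>i<32*k. p i Z) \<le> (1/2)^k" if Z: "Z \<in> C" for Z
  proof -
    have "(\<Prod>i<32*k. p i Z) \<le> ?y ^ (2 * k)"
    proof (rule prod_le_power_on_subset[OF p01 _ good[OF Z]])
      fix i assume "i \<in> {i. i < 32*k \<and> t Z \<le> 16 * s i Z}"
      with tpos[OF Z] have "s i Z \<ge> 1" by (cases "s i Z") auto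
      then show "p i Z \<le> ?y" unfolding p_def by (intro divide_left_mono) auto
    qed auto
    then show ?thesis by (simp only: y2)
  qed
  have p2: "(\<Prod>i<32*k. p i Z) \<le> (1/2)^(\<tau> * k)" if Z: "Z \<in> C2" for Z
  proof -
    have ZC: "Z \<in> C" and tZ: "16 * 2^\<tau> \<le> t Z" using Z by (auto simp: C2_def T0_def)
    have "(\<Prod>i<32*k. p i Z) \<le> (?y ^ \<tau>) ^ (2 * k)"
    proof (rule prod_le_power_on_subset[OF p01 _ good[OF ZC]])
      fix i assume "i \<in> {i. i < 32*k \<and> t Z \<le> 16 * s i Z}"
      with tZ have "2 ^ \<tau> \<le> s i Z" by auto
      then have "real (2 ^ \<tau>) \<le> real (s i Z)" by (rule of_nat_mono)
      then have "2 ^ \<tau> \<le> 1 + real (s i Z)" unfolding of_nat_power of_nat_numeral by linarith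
      then have "sqrt 2 ^ \<tau> \<le> sqrt (1 + s i Z)" by (simp flip: real_sqrt_power)
      then have "p i Z \<le> 1 / sqrt 2 ^ \<tau>" unfolding p_def by (intro divide_left_mono) auto
      then show "p i Z \<le> ?y ^ \<tau>" by (simp add: power_divide)
    qed (auto intro: power_le_one)
    also have "(?y ^ \<tau>) ^ (2 * k) = ?y ^ (2 * (\<tau> * k))" by (simp add: ac_simps flip: power_mult)
    finally show ?thesis by (simp only: y2)
  qed
  have card_le: "real (card S) \<le> 2 ^ (\<beta> * m)" if "S \<subseteq> sparse_funs ?J W m" for S m
  proof -
    have "card S \<le> card (sparse_funs ?J W m)"
      using that sparse_funs_finite_card(1)[OF J] by (rule card_mono[rotated])
    also have "\<dots> \<le> (card ?J * (2*W+1)) ^ m" by (rule sparse_funs_finite_card(2)[OF J])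
    also have "\<dots> \<le> (2 ^ \<beta>) ^ m" using BJ by (intro power_mono) auto
    finally have "card S \<le> 2 ^ (\<beta> * m)" by (simp add: power_mult)
    then have "real (card S) \<le> real (2 ^ (\<beta> * m))" by (rule of_nat_mono)
    then show ?thesis by simp
  qed
  have quarter: "2 ^ a * (1/2)^b \<le> (1/4 :: real)" if "a + 2 \<le> b" for a b :: nat
  proof -
    have "(1/2::real)^b \<le> (1/2)^(a+2)" using that by (intro power_decreasing) auto
    then have "2 ^ a * (1/2)^b \<le> 2 ^ a * (1/2::real)^(a+2)" by (intro mult_left_mono) auto
    also have "\<dots> = (2 * (1/2))^a * (1/4)" unfolding power_mult_distrib by (simp add: power2_eq_square)
    finally show ?thesis by simp
  qed
  have C1sub: "C1 \<subseteq> sparse_funs ?J W (d * T0)"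
  proof
    fix Z assume Z: "Z \<in> C1"
    let ?T = "{u\<in>U. \<exists>v\<in>R. Z (u,v) \<noteq> 0}"
    have "{i\<in>?J. Z i \<noteq> 0} = (SIGMA u:?T. {v\<in>R. Z (u,v) \<noteq> 0})" by auto
    then have "card {i\<in>?J. Z i \<noteq> 0} = (\<Sum>u\<in>?T. card {v\<in>R. Z (u,v) \<noteq> 0})"
      using U R by (simp add: card_SigmaI)
    also have "\<dots> \<le> (\<Sum>u\<in>?T. d)" using Z by (intro sum_mono) (auto simp: C1_def C_def)
    also have "\<dots> = d * t Z" by (simp add: t_def)
    also have "\<dots> \<le> d * T0" using Z by (simp add: C1_def)
    finally show "Z \<in> sparse_funs ?J W (d * T0)"
      using Z by (auto simp: C1_def C_def sparse_funs_def)
  qed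
  have "(\<Sum>z\<in>C1. (\<Prod>i<32*k. p i z)) \<le> (\<Sum>z\<in>C1. (1/2)^k)"
    using p1 by (intro sum_mono) (auto simp: C1_def)
  also have "\<dots> = card C1 * (1/2)^k" by simp
  also have "\<dots> \<le> 2 ^ (\<beta> * (d * T0)) * (1/2)^k"
    by (intro mult_right_mono card_le[OF C1sub]) simp
  also have "\<dots> \<le> 1/4" using H2 by (intro quarter) (simp add: T0_def)
  finally have s1: "(\<Sum>z\<in>C1. (\<Prod>i<32*k. p i z)) \<le> 1/4" .
  have "(\<Sum>z\<in>C2. (\<Prod>i<32*k. p i z)) \<le> (\<Sum>z\<in>C2. (1/2)^(\<tau> * k))"
    by (intro sum_mono p2)
  also have "\<dots> = card C2 * (1/2)^(\<tau> * k)" by simp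
  also have "\<dots> \<le> 2 ^ (\<beta> * e) * (1/2)^(\<tau> * k)"
    by (intro mult_right_mono card_le) (auto simp: C2_def C_def)
  also have "\<dots> \<le> 1/4" using H3 by (intro quarter)
  finally have s2: "(\<Sum>z\<in>C2. (\<Prod>i<32*k. p i z)) \<le> 1/4" .
  have "C = C1 \<union> C2" "C1 \<inter> C2 = {}" by (auto simp: C1_def C2_def)
  then have "(\<Sum>z\<in>C. (\<Prod>i<32*k. p i z)) = (\<Sum>z\<in>C1. (\<Prod>i<32*k. p i z)) + (\<Sum>z\<in>C2. (\<Prod>i<32*k. p i z))"
    using finC by (simp add: sum.union_disjoint)
  \<comment> \<open>The product over \<open>i\<close> is the indicator of being missed by all tests,
    so a sum below 1 means that nothing in \<open>C\<close> is missed.\<close>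
  with le s1 s2 have lt1: "(\<Sum>z\<in>C. (\<Prod>i<32*k. g i z (X i))) < 1" by linarith
  have det: "\<exists>i<32*k. (\<Sum>u\<in>X i. w i z u) \<noteq> 0" if z: "z \<in> C" for z
  proof (rule ccontr)
    assume "\<not> ?thesis"
    then have "(\<Prod>i<32*k. g i z (X i)) = 1" by (intro prod.neutral) (auto simp: g_def)
    moreover have "(\<Prod>i<32*k. g i z (X i)) \<le> (\<Sum>z\<in>C. (\<Prod>i<32*k. g i z (X i)))"
      using finC z by (intro member_le_sum) (auto intro!: prod_nonneg simp: g_def)
    ultimately show False using lt1 by linarith
  qed
  have "\<exists>i<32*k. (\<Sum>u\<in>X i. \<Sum>v\<in>Y i. Z u v) \<noteq> 0"
    if Z: "\<forall>u\<in>U. \<forall>v\<in>R. \<bar>Z u v\<bar> \<le> int W" "\<forall>u\<in>U. card {v\<in>R. Z u v \<noteq> 0} \<le> d"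
      "(\<Sum>u\<in>U. card {v\<in>R. Z u v \<noteq> 0}) \<le> e" "\<exists>u\<in>U. \<exists>v\<in>R. Z u v \<noteq> 0" for Z :: "'u \<Rightarrow> 'v \<Rightarrow> int"
  proof -
    define z where "z = (\<lambda>(u,v). if u \<in> U \<and> v \<in> R then Z u v else 0)"
    have row: "{v\<in>R. z (u,v) \<noteq> 0} = {v\<in>R. Z u v \<noteq> 0}" if "u \<in> U" for u
      using that by (auto simp: z_def)
    have "{i\<in>?J. z i \<noteq> 0} = (SIGMA u:U. {v\<in>R. Z u v \<noteq> 0})" by (auto simp: z_def)
    then have "card {i\<in>?J. z i \<noteq> 0} = (\<Sum>u\<in>U. card {v\<in>R. Z u v \<noteq> 0})"
      using U R by (simp add: card_SigmaI)
    then have "z \<in> sparse_funs ?J W e" using Z by (auto simp: sparse_funs_def z_def)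
    moreover have "\<exists>u\<in>U. \<exists>v\<in>R. z (u,v) \<noteq> 0" using Z(4) by (auto simp: z_def)
    ultimately have "z \<in> C" using Z row by (simp add: C_def)
    from det[OF this] obtain i where i: "i < 32*k" "(\<Sum>u\<in>X i. w i z u) \<noteq> 0" by blast
    have "(\<Sum>u\<in>X i. w i z u) = (\<Sum>u\<in>X i. \<Sum>v\<in>Y i. Z u v)"
      unfolding w_def using X[of i] Y[of i] by (intro sum.cong refl) (auto simp: z_def)
    with i show ?thesis by auto
  qed
  note * = this
  show ?thesis
    by (intro exI[of _ X] exI[of _ Y] conjI allI impI X Y *)
qed

section \<open>Query problems as sets of consistent inputs\<close>

definition query_cost :: "('a set \<Rightarrow> nat) \<Rightarrow> ('b \<Rightarrow> bool) \<Rightarrow> ('a, 'b) query_alg \<Rightarrow> ennreal" where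
  "query_cost f ok A = (\<integral>\<^sup>+ (x, k). of_nat k + (if ok x then 0 else \<infinity>) \<partial>measure_pmf (run f A))"

lemma query_cost_Output: "ok x \<Longrightarrow> query_cost f ok (Output x) = 0"
  by (simp add: query_cost_def nn_integral_return)

lemma query_cost_Query: "query_cost f ok (Query S k) = 1 + query_cost f ok (k (f S))"
proof -
  have "query_cost f ok (Query S k) =
     (\<integral>\<^sup>+ z. 1 + (case z of (x, k) \<Rightarrow> of_nat k + (if ok x then 0 else \<infinity>)) \<partial>measure_pmf (run f (k (f S))))"
    unfolding query_cost_def by (auto simp: case_prod_unfold ac_simps intro!: nn_integral_cong)
  then show ?thesis
    by (simp add: nn_integral_add query_cost_def)
qed

lemma query_cost_Sample: "query_cost f ok (Sample p) = (\<integral>\<^sup>+ A. query_cost f ok A \<partial>measure_pmf p)"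
  by (simp add: query_cost_def nn_integral_bind_pmf)

text \<open>
  A set of inputs describes what an algorithm knows at some point: the inputs consistent with the
  answers so far.  An infinite cost of wrong outputs makes \<open>B\<close> bound the number of
  queries and the correctness at once.
\<close>

locale query_problem =
  fixes orc :: "'i \<Rightarrow> 'a set \<Rightarrow> nat" and ok :: "'i \<Rightarrow> 'b \<Rightarrow> bool"
begin

text \<open>One algorithm must serve every input of \<open>I\<close>, but the bound may depend on
  the input that is actually present, hence on quantities that the algorithm does not know.\<close>

definition solvable :: "'i set \<Rightarrow> ('i \<Rightarrow> real) \<Rightarrow> bool" where
  "solvable I B \<longleftrightarrow> (\<exists>A. \<forall>i\<in>I. query_cost (orc i) (ok i) A \<le> ennreal (B i))"

lemma solvable_empty: "solvable {} B"
  by (simp add: solvable_def)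

lemma solvable_mono:
  assumes "solvable I B" "J \<subseteq> I" "\<And>i. i \<in> J \<Longrightarrow> B i \<le> B' i"
  shows "solvable J B'"
proof -
  obtain A where A: "\<And>i. i \<in> I \<Longrightarrow> query_cost (orc i) (ok i) A \<le> ennreal (B i)"
    using assms(1) unfolding solvable_def by blast
  have "query_cost (orc i) (ok i) A \<le> ennreal (B' i)" if "i \<in> J" for i
    using A[of i] assms(2,3) that by (meson ennreal_leI order_trans subsetD)
  then show ?thesis unfolding solvable_def by blast
qed

lemma solvable_output: "(\<And>i. i \<in> I \<Longrightarrow> ok i x) \<Longrightarrow> solvable I (\<lambda>_. 0)"
  unfolding solvable_def by (rule exI[of _ "Output x"]) (simp add: query_cost_Output)

text \<open>An answer is represented by an input \<open>i0\<close> that gives it; branches for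
  answers that no input gives are arbitrary, and choice glues all branches into one tree.\<close>

lemma solvable_query:
  assumes B: "\<And>i. i \<in> I \<Longrightarrow> B i \<ge> 0"
    and *: "\<And>i0. i0 \<in> I \<Longrightarrow> solvable {i\<in>I. orc i S = orc i0 S} B"
  shows "solvable I (\<lambda>i. 1 + B i)"
proof -
  have "solvable {i\<in>I. orc i S = a} B" for a
  proof (cases "\<exists>i0\<in>I. orc i0 S = a")
    case True then show ?thesis using * by blast
  next
    case False
    then have empty: "{i\<in>I. orc i S = a} = {}" by blast
    show ?thesis unfolding empty by (rule solvable_empty)
  qed
  then have "\<forall>a. \<exists>A. \<forall>i\<in>{i\<in>I. orc i S = a}. query_cost (orc i) (ok i) A \<le> ennreal (B i)"
    unfolding solvable_def by blast
  from choice[OF this] obtain A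
    where "\<forall>a. \<forall>i\<in>{i\<in>I. orc i S = a}. query_cost (orc i) (ok i) (A a) \<le> ennreal (B i)" ..
  then have A: "query_cost (orc i) (ok i) (A (orc i S)) \<le> ennreal (B i)" if "i \<in> I" for i
    using that by simp
  have "query_cost (orc i) (ok i) (Query S A) \<le> ennreal (1 + B i)" if "i \<in> I" for i
  proof -
    have "1 + query_cost (orc i) (ok i) (A (orc i S)) \<le> 1 + ennreal (B i)"
      using A[OF that] by (rule add_left_mono)
    also have "\<dots> = ennreal (1 + B i)" using B[OF that] by (subst ennreal_plus) auto
    finally show ?thesis by (simp add: query_cost_Query)
  qed
  then show ?thesis unfolding solvable_def by blast
qed

lemma solvable_queries:
  assumes "finite \<S>" and B: "\<And>i. i \<in> I \<Longrightarrow> B i \<ge> 0"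
    and *: "\<And>i0. i0 \<in> I \<Longrightarrow> solvable {i\<in>I. \<forall>S\<in>\<S>. orc i S = orc i0 S} B"
  shows "solvable I (\<lambda>i. real (card \<S>) + B i)"
  using assms
proof (induction arbitrary: I)
  case empty
  show ?case
  proof (cases "I = {}")
    case False
    then obtain i0 where "i0 \<in> I" by blast
    from empty.prems(2)[OF this] show ?thesis by simp
  qed (simp add: solvable_empty)
next
  case (insert S \<S>)
  have "solvable I (\<lambda>i. 1 + (real (card \<S>) + B i))"
  proof (rule solvable_query)
    fix i0 assume i0: "i0 \<in> I"
    show "solvable {i\<in>I. orc i S = orc i0 S} (\<lambda>i. real (card \<S>) + B i)"
    proof (rule insert.IH)
      fix i1 assume i1: "i1 \<in> {i\<in>I. orc i S = orc i0 S}"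
      then have "i1 \<in> I" by simp
      from insert.prems(2)[OF this]
      show "solvable {i \<in> {i\<in>I. orc i S = orc i0 S}. \<forall>S\<in>\<S>. orc i S = orc i1 S} B"
        by (rule solvable_mono) (use i1 in auto)
    qed (use insert.prems in auto)
  qed (use insert.prems in auto)
  then show ?case using insert.hyps by (simp add: add.assoc)
qed

text \<open>Computation is free, so a batch of queries that determines \<open>g\<close> can be
  continued as if the value of \<open>g\<close> itself had been returned.\<close>

lemma solvable_learn:
  assumes fin: "finite \<S>" "card \<S> \<le> c" and B: "\<And>i. i \<in> I \<Longrightarrow> B i \<ge> 0"
    and det: "\<And>i j. i \<in> I \<Longrightarrow> j \<in> I \<Longrightarrow> (\<And>S. S \<in> \<S> \<Longrightarrow> orc i S = orc j S) \<Longrightarrow> g i = g j"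
    and *: "\<And>i0. i0 \<in> I \<Longrightarrow> solvable {i\<in>I. g i = g i0} B"
  shows "solvable I (\<lambda>i. real c + B i)"
proof -
  have "solvable I (\<lambda>i. real (card \<S>) + B i)"
  proof (rule solvable_queries[OF fin(1)])
    fix i0 assume "i0 \<in> I"
    show "solvable {i\<in>I. \<forall>S\<in>\<S>. orc i S = orc i0 S} B"
    proof (rule solvable_mono[OF *[OF \<open>i0 \<in> I\<close>]])
      show "{i\<in>I. \<forall>S\<in>\<S>. orc i S = orc i0 S} \<subseteq> {i\<in>I. g i = g i0}"
        using det \<open>i0 \<in> I\<close> by blast
    qed simp
  qed (use B in auto)
  then show ?thesis by (rule solvable_mono) (use fin in auto)
qed

lemma solvable_sample:
  assumes \<Omega>: "finite \<Omega>" "\<Omega> \<noteq> {}" and B: "\<And>\<omega> i. \<omega> \<in> \<Omega> \<Longrightarrow> i \<in> I \<Longrightarrow> B \<omega> i \<ge> 0"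
    and *: "\<And>\<omega>. \<omega> \<in> \<Omega> \<Longrightarrow> solvable I (B \<omega>)"
  shows "solvable I (\<lambda>i. (\<Sum>\<omega>\<in>\<Omega>. B \<omega> i) / card \<Omega>)"
proof -
  have "\<forall>\<omega>\<in>\<Omega>. \<exists>A. \<forall>i\<in>I. query_cost (orc i) (ok i) A \<le> ennreal (B \<omega> i)"
    using * unfolding solvable_def by blast
  then obtain A where A: "\<And>\<omega> i. \<omega> \<in> \<Omega> \<Longrightarrow> i \<in> I \<Longrightarrow> query_cost (orc i) (ok i) (A \<omega>) \<le> ennreal (B \<omega> i)"
    by (metis bchoice)
  let ?p = "map_pmf A (pmf_of_set \<Omega>)"
  have "query_cost (orc i) (ok i) (Sample ?p) \<le> ennreal ((\<Sum>\<omega>\<in>\<Omega>. B \<omega> i) / card \<Omega>)" if i: "i \<in> I" for i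
  proof -
    have "query_cost (orc i) (ok i) (Sample ?p) = (\<Sum>\<omega>\<in>\<Omega>. query_cost (orc i) (ok i) (A \<omega>)) / of_nat (card \<Omega>)"
      using \<Omega> by (simp add: query_cost_Sample nn_integral_pmf_of_set)
    also have "\<dots> \<le> (\<Sum>\<omega>\<in>\<Omega>. ennreal (B \<omega> i)) / of_nat (card \<Omega>)"
      using A i by (intro divide_right_mono_ennreal sum_mono) auto
    also have "\<dots> = ennreal ((\<Sum>\<omega>\<in>\<Omega>. B \<omega> i) / card \<Omega>)"
      using B i \<Omega> by (simp add: divide_ennreal sum_nonneg card_gt_0_iff ennreal_of_nat_eq_real_of_nat)
    finally show ?thesis .
  qed
  then show ?thesis unfolding solvable_def by blast
qed

end

section \<open>Spanning forests of weighted graphs\<close>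

text \<open>One round works on a weighted graph \<open>w\<close> that depends on the unknown input.
  The oracle has to determine the cut weights, not to return them: edges taken in earlier rounds are
  known, but they still show up in the answers.\<close>

locale cut_round = query_problem orc ok
  for orc :: "'i \<Rightarrow> 'a set \<Rightarrow> nat" and ok :: "'i \<Rightarrow> 'b \<Rightarrow> bool" +
  fixes I0 :: "'i set" and P :: "'v set" and Q :: "'v set \<Rightarrow> 'a set" and w :: "'i \<Rightarrow> 'v \<Rightarrow> 'v \<Rightarrow> nat"
  assumes finP: "finite P"
    and w_sym: "\<And>i x y. i \<in> I0 \<Longrightarrow> w i x y = w i y x"
    and cut_determined: "\<And>X i j. X \<subseteq> P \<Longrightarrow> i \<in> I0 \<Longrightarrow> j \<in> I0 \<Longrightarrow> orc i (Q X) = orc j (Q X) \<Longrightarrow>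
      (\<Sum>x\<in>X. \<Sum>y\<in>P - X. w i x y) = (\<Sum>x\<in>X. \<Sum>y\<in>P - X. w j x y)"
begin

definition ew :: "'i \<Rightarrow> 'v set \<Rightarrow> 'v set \<Rightarrow> nat" where
  "ew i X Y = (\<Sum>x\<in>X. \<Sum>y\<in>Y. w i x y)"

lemma ew_sym: "i \<in> I0 \<Longrightarrow> ew i X Y = ew i Y X"
  unfolding ew_def by (subst sum.swap) (simp add: w_sym)

lemma finite_subset_P: "X \<subseteq> P \<Longrightarrow> finite X"
  using finP finite_subset by blast

lemma ew_Un_right:
  "Y \<subseteq> P \<Longrightarrow> Z \<subseteq> P \<Longrightarrow> Y \<inter> Z = {} \<Longrightarrow> ew i X (Y \<union> Z) = ew i X Y + ew i X Z"
  unfolding ew_def by (simp add: sum.union_disjoint finite_subset_P sum.distrib)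

lemma ew_Un_left:
  "Y \<subseteq> P \<Longrightarrow> Z \<subseteq> P \<Longrightarrow> Y \<inter> Z = {} \<Longrightarrow> ew i (Y \<union> Z) X = ew i Y X + ew i Z X"
  unfolding ew_def by (simp add: sum.union_disjoint finite_subset_P)

lemma ew_pos_iff:
  assumes "X \<subseteq> P" "Y \<subseteq> P"
  shows "ew i X Y > 0 \<longleftrightarrow> (\<exists>x\<in>X. \<exists>y\<in>Y. w i x y > 0)"
proof -
  have "ew i X Y = 0 \<longleftrightarrow> (\<forall>x\<in>X. \<forall>y\<in>Y. w i x y = 0)"
    using assms by (simp add: ew_def finite_subset_P)
  then show ?thesis by auto
qed

text \<open>Edges between \<open>X\<close> and \<open>Y\<close> lie in both single cuts and not in
  the cut of the union. Hence the weight between two disjoint sets costs three queries, the factor 3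
  in the bounds below.\<close>

lemma ew_cut_identity:
  assumes "i \<in> I0" "X \<subseteq> P" "Y \<subseteq> P" "X \<inter> Y = {}"
  shows "ew i X (P - X) + ew i Y (P - Y) = ew i (X \<union> Y) (P - (X \<union> Y)) + 2 * ew i X Y"
proof -
  let ?Z = "P - (X \<union> Y)"
  have X: "P - X = Y \<union> ?Z" and Y: "P - Y = X \<union> ?Z" using assms by auto
  have "ew i X (P - X) = ew i X Y + ew i X ?Z" unfolding X using assms by (intro ew_Un_right) auto
  moreover have "ew i Y (P - Y) = ew i Y X + ew i Y ?Z" unfolding Y using assms by (intro ew_Un_right) auto
  moreover have "ew i (X \<union> Y) ?Z = ew i X ?Z + ew i Y ?Z" using assms by (intro ew_Un_left) auto
  ultimately show ?thesis using ew_sym[OF assms(1), of X Y] by simp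
qed

lemma ew_determined:
  assumes ij: "i \<in> I0" "j \<in> I0" and XY: "X \<subseteq> P" "Y \<subseteq> P" "X \<inter> Y = {}"
    and eq: "orc i (Q X) = orc j (Q X)" "orc i (Q Y) = orc j (Q Y)" "orc i (Q (X \<union> Y)) = orc j (Q (X \<union> Y))"
  shows "ew i X Y = ew j X Y"
proof -
  have "ew i X (P - X) = ew j X (P - X)"
    unfolding ew_def using cut_determined[OF XY(1) ij eq(1)] .
  moreover have "ew i Y (P - Y) = ew j Y (P - Y)"
    unfolding ew_def using cut_determined[OF XY(2) ij eq(2)] .
  moreover have "ew i (X \<union> Y) (P - (X \<union> Y)) = ew j (X \<union> Y) (P - (X \<union> Y))"
    unfolding ew_def using cut_determined[OF _ ij eq(3)] XY by simp
  ultimately show ?thesis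
    using ew_cut_identity[OF ij(1) XY] ew_cut_identity[OF ij(2) XY] by linarith
qed

lemma solvable_ews:
  assumes T: "finite T" "\<And>X Y. (X, Y) \<in> T \<Longrightarrow> X \<subseteq> P \<and> Y \<subseteq> P \<and> X \<inter> Y = {}" "card T \<le> c"
    and I: "I \<subseteq> I0" and B: "\<And>i. i \<in> I \<Longrightarrow> B i \<ge> 0"
    and *: "\<And>i0. i0 \<in> I \<Longrightarrow> solvable {i\<in>I. \<forall>(X, Y)\<in>T. ew i X Y = ew i0 X Y} B"
  shows "solvable I (\<lambda>i. 3 * real c + B i)"
proof -
  let ?S = "(\<lambda>p. Q (fst p)) ` T \<union> (\<lambda>p. Q (snd p)) ` T \<union> (\<lambda>p. Q (fst p \<union> snd p)) ` T"
  let ?g = "\<lambda>i. restrict (\<lambda>(X, Y). ew i X Y) T"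
  have "card ?S \<le> card ((\<lambda>p. Q (fst p)) ` T) + card ((\<lambda>p. Q (snd p)) ` T) + card ((\<lambda>p. Q (fst p \<union> snd p)) ` T)"
    by (meson add_mono_thms_linordered_semiring(1) card_Un_le order_refl order_trans)
  also have "\<dots> \<le> card T + card T + card T"
    using T(1) by (intro add_mono card_image_le)
  finally have c: "card ?S \<le> 3 * c" using T(3) by linarith
  have "solvable I (\<lambda>i. real (3 * c) + B i)"
  proof (rule solvable_learn[where g = ?g, OF _ c B])
    show "finite ?S" using T(1) by simp
    fix i j assume ij: "i \<in> I" "j \<in> I" and eq: "\<And>S. S \<in> ?S \<Longrightarrow> orc i S = orc j S"
    have "ew i X Y = ew j X Y" if p: "(X, Y) \<in> T" for X Y
    proof (rule ew_determined)
      show "orc i (Q X) = orc j (Q X)" by (rule eq) (use p in force)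
      show "orc i (Q Y) = orc j (Q Y)" by (rule eq) (use p in force)
      show "orc i (Q (X \<union> Y)) = orc j (Q (X \<union> Y))" by (rule eq) (use p in force)
    qed (use ij I T(2)[OF p] in auto)
    then show "?g i = ?g j" by (intro ext) (auto simp: restrict_def)
  next
    fix i0 assume i0: "i0 \<in> I"
    show "solvable {i\<in>I. ?g i = ?g i0} B"
    proof (rule solvable_mono[OF *[OF i0]])
      show "{i\<in>I. ?g i = ?g i0} \<subseteq> {i\<in>I. \<forall>(X, Y)\<in>T. ew i X Y = ew i0 X Y}"
      proof safe
        fix i X Y assume "?g i = ?g i0" "(X, Y) \<in> T"
        then show "ew i X Y = ew i0 X Y" by (auto dest: fun_cong[of _ _ "(X, Y)"])
      qed
    qed simp
  qed
  then show ?thesis by simp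
qed

lemma solvable_ew:
  assumes "X \<subseteq> P" "Y \<subseteq> P" "X \<inter> Y = {}" "I \<subseteq> I0" "\<And>i. i \<in> I \<Longrightarrow> B i \<ge> 0"
    and *: "\<And>i0. i0 \<in> I \<Longrightarrow> solvable {i\<in>I. ew i X Y = ew i0 X Y} B"
  shows "solvable I (\<lambda>i. 3 + B i)"
  using solvable_ews[of "{(X,Y)}" 1 I B] assms by simp

text \<open>Binary search: one half of \<open>Y\<close> is weighed, and if its weight is 0, the
  positive total lies in the other half.\<close>

lemma solvable_neighbour:
  assumes "X \<subseteq> P" "Y \<subseteq> P" "X \<inter> Y = {}" "I \<subseteq> I0" and B: "\<And>i. i \<in> I \<Longrightarrow> B i \<ge> 0"
    and "card Y \<le> 2 ^ k" "\<And>i. i \<in> I \<Longrightarrow> ew i X Y > 0"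
    and "\<And>y. y \<in> Y \<Longrightarrow> solvable {i\<in>I. ew i X {y} > 0} B"
  shows "solvable I (\<lambda>i. 3 * real k + B i)"
  using assms
proof (induction k arbitrary: I Y)
  case 0
  have "finite Y" using 0 finite_subset_P by blast
  show ?case
  proof (cases "I = {} \<or> Y = {}")
    case True
    then have "I = {}" using 0(7) by (auto simp: ew_def)
    then show ?thesis by (simp add: solvable_empty)
  next
    case False
    then have "card Y = 1" using 0(6) \<open>finite Y\<close> by (simp add: le_Suc_eq)
    then obtain y where y: "Y = {y}" using card_1_singletonE by blast
    have "{i\<in>I. ew i X {y} > 0} = I" using 0(7) y by auto
    then show ?thesis using 0(8)[of y] y by simp
  qed
next
  case (Suc k)
  have finY: "finite Y" using Suc.prems finite_subset_P by blast
  obtain Y1 where Y1: "Y1 \<subseteq> Y" "card Y1 = card Y div 2"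
    by (rule obtain_subset_with_card_n[of "card Y div 2" Y]) auto
  let ?Y2 = "Y - Y1"
  have "card ?Y2 = card Y - card Y1" using Y1 finY by (simp add: card_Diff_subset finite_subset)
  then have c: "card Y1 \<le> 2 ^ k" "card ?Y2 \<le> 2 ^ k" using Y1 Suc.prems(6) by auto
  have half: "solvable J (\<lambda>i. 3 * real k + B i)"
    if J: "J \<subseteq> I" and Z: "Z \<subseteq> Y" "card Z \<le> 2 ^ k" "\<And>i. i \<in> J \<Longrightarrow> ew i X Z > 0" for J Z
  proof (rule Suc.IH)
    fix y assume "y \<in> Z"
    then have "solvable {i\<in>I. ew i X {y} > 0} B" using Suc.prems(8) Z by blast
    then show "solvable {i\<in>J. ew i X {y} > 0} B" by (rule solvable_mono) (use J in auto)
  qed (use Suc.prems J Z in auto)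
  have split: "ew i X Y = ew i X Y1 + ew i X ?Y2" for i
  proof -
    have "Y = Y1 \<union> ?Y2" using Y1 by blast
    then show ?thesis using ew_Un_right[of Y1 ?Y2 i X] Y1 Suc.prems(2) by auto
  qed
  have "solvable I (\<lambda>i. 3 + (3 * real k + B i))"
  proof (rule solvable_ew)
    fix i0 assume i0: "i0 \<in> I"
    let ?J = "{i\<in>I. ew i X Y1 = ew i0 X Y1}"
    show "solvable ?J (\<lambda>i. 3 * real k + B i)"
    proof (cases "ew i0 X Y1 > 0")
      case True
      show ?thesis by (rule half[of _ Y1]) (use True Y1 c in auto)
    next
      case False
      show ?thesis
      proof (rule half[of _ ?Y2])
        fix i assume "i \<in> ?J"
        then show "ew i X ?Y2 > 0" using False split[of i] Suc.prems(7)[of i] by auto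
      qed (use c in auto)
    qed
  qed (use Suc.prems Y1 in auto)
  then show ?case by (simp add: algebra_simps)
qed

section \<open>Spanning forests in cut form and the invariant of the algorithm\<close>

definition present :: "'i \<Rightarrow> 'v set set \<Rightarrow> bool" where
  "present i F \<longleftrightarrow> (\<forall>e\<in>F. \<exists>x\<in>P. \<exists>y\<in>P. x \<noteq> y \<and> e = {x, y} \<and> w i x y > 0)"

text \<open>\<open>C\<close> lies within one connected component of \<open>F\<close>; this is
  expressed by cuts because certificates are about cuts.\<close>

definition connects :: "'v set set \<Rightarrow> 'v set \<Rightarrow> bool" where
  "connects F C \<longleftrightarrow> (\<forall>S\<subseteq>P. S \<inter> C \<noteq> {} \<longrightarrow> \<not> C \<subseteq> S \<longrightarrow> (\<exists>e\<in>F. card (e \<inter> S) = 1))"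

definition spanning :: "'i \<Rightarrow> 'v set set \<Rightarrow> bool" where
  "spanning i F \<longleftrightarrow> finite F \<and> card F \<le> card P \<and> present i F \<and>
    (\<forall>S\<subseteq>P. ew i S (P - S) > 0 \<longrightarrow> (\<exists>e\<in>F. card (e \<inter> S) = 1))"

text \<open>\<open>U\<close> holds the parts that may still have outgoing edges. The inequality
  between cardinalities counts the forest: a merge adds at most one edge and removes at least one
  part.\<close>

definition state :: "'i set \<Rightarrow> 'v set set \<Rightarrow> 'v set set \<Rightarrow> 'v set set \<Rightarrow> bool" where
  "state I \<C> F U \<longleftrightarrow> I \<subseteq> I0 \<and> partition_on P \<C> \<and> U \<subseteq> \<C> \<and> finite F \<and> card F + card \<C> \<le> card P \<and>
    (\<forall>i\<in>I. present i F) \<and> (\<forall>C\<in>\<C>. connects F C) \<and> (\<forall>i\<in>I. \<forall>C\<in>\<C> - U. ew i C (P - C) = 0)"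

lemma state_subset: "state I \<C> F U \<Longrightarrow> J \<subseteq> I \<Longrightarrow> state J \<C> F U"
  unfolding state_def by blast

lemma state_remove:
  assumes "state I \<C> F U" "\<And>i C. i \<in> I \<Longrightarrow> C \<in> U - U' \<Longrightarrow> ew i C (P - C) = 0" "U' \<subseteq> U"
  shows "state I \<C> F U'"
  using assms unfolding state_def by blast

lemma state_initial: "I \<subseteq> I0 \<Longrightarrow> state I ((\<lambda>x. {x}) ` P) {} ((\<lambda>x. {x}) ` P)"
proof -
  have "card ((\<lambda>x. {x}) ` P) = card P" by (rule card_image) (simp add: inj_on_def)
  moreover have "partition_on P ((\<lambda>x. {x}) ` P)" by (auto simp: partition_on_def disjoint_def)
  ultimately show "I \<subseteq> I0 \<Longrightarrow> ?thesis"
    unfolding state_def by (auto simp: present_def connects_def)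
qed

lemma state_finite:
  assumes "state I \<C> F U"
  shows "finite \<C>" "finite U" "\<And>C. C \<in> \<C> \<Longrightarrow> C \<subseteq> P" "card \<C> \<le> card P"
proof -
  have p: "partition_on P \<C>" using assms by (simp add: state_def)
  show "finite \<C>" using finite_elements[OF finP p] .
  then show "finite U" using assms finite_subset by (auto simp: state_def)
  show "\<And>C. C \<in> \<C> \<Longrightarrow> C \<subseteq> P" using p by (auto simp: partition_on_def)
  show "card \<C> \<le> card P" using assms by (simp add: state_def)
qed

text \<open>A cut of positive weight has an edge leaving \<open>S\<close> at some x. The part of x
  has no outgoing edge, so it contains both ends and is split by \<open>S\<close>; hence
  \<open>F\<close> crosses the cut.\<close>

lemma state_spanning:
  assumes st: "state I \<C> F {}" and i: "i \<in> I"
  shows "spanning i F"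
proof -
  have "\<exists>e\<in>F. card (e \<inter> S) = 1" if S: "S \<subseteq> P" "ew i S (P - S) > 0" for S
  proof -
    obtain x y where xy: "x \<in> S" "y \<in> P - S" "w i x y > 0"
      using S ew_pos_iff[of S "P - S"] by auto
    obtain C where C: "C \<in> \<C>" "x \<in> C"
      using st xy S by (auto simp: state_def partition_on_def)
    have "ew i C (P - C) = 0" using st C i by (auto simp: state_def)
    then have "\<forall>x\<in>C. \<forall>y\<in>P - C. w i x y = 0"
      using ew_pos_iff[of C "P - C" i] state_finite(3)[OF st C(1)] by auto
    then have "y \<in> C" using xy C by (metis DiffD1 DiffI less_irrefl)
    with C xy S have "S \<inter> C \<noteq> {}" "\<not> C \<subseteq> S" by auto
    moreover have "connects F C" using st C by (simp add: state_def)
    ultimately show ?thesis using S by (simp add: connects_def)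
  qed
  then show ?thesis using st i unfolding state_def spanning_def by auto
qed

lemma state_merge:
  assumes st: "state I \<C> F U" and C: "C \<in> U" and x: "x \<in> C" and y: "y \<in> P - C"
    and w: "\<And>i. i \<in> I \<Longrightarrow> w i x y > 0" and ne: "I \<noteq> {}"
  obtains D where "D \<in> U" "D \<noteq> C" "y \<in> D"
    "state I (insert (C \<union> D) (\<C> - {C, D})) (insert {x, y} F) (insert (C \<union> D) (U - {C, D}))"
    "card (insert (C \<union> D) (U - {C, D})) + 1 \<le> card U"
proof -
  note fin = state_finite[OF st]
  have p: "partition_on P \<C>" and UC: "U \<subseteq> \<C>" and IO: "I \<subseteq> I0" using st by (auto simp: state_def)
  obtain D where D: "D \<in> \<C>" "y \<in> D" using p y by (auto simp: partition_on_def)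
  have CC: "C \<in> \<C>" using C UC by blast
  have DC: "D \<noteq> C" using D y by blast
  have disj: "A \<inter> A' = {}" if "A \<in> \<C>" "A' \<in> \<C>" "A \<noteq> A'" for A A'
    using p that by (auto simp: partition_on_def disjoint_def)
  have xD: "x \<in> P - D" using disj[OF CC D(1)] DC x fin(3)[OF CC] by auto
  \<comment> \<open>A finished part has no outgoing edge, but \<open>D\<close> has one to
    \<open>C\<close>; this is read off from some input of \<open>I\<close>.\<close>
  have DU: "D \<in> U"
  proof (rule ccontr)
    assume "D \<notin> U"
    obtain i where i: "i \<in> I" using ne by blast
    then have "ew i D (P - D) = 0" using st D \<open>D \<notin> U\<close> by (auto simp: state_def)
    moreover have "w i y x > 0" using w[OF i] w_sym i IO by auto
    ultimately show False using ew_pos_iff[of D "P - D" i] D xD fin(3)[OF D(1)] by auto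
  qed
  have p': "partition_on P (insert (C \<union> D) (\<C> - {C, D}))"
    unfolding partition_on_def
  proof (intro conjI)
    show "\<Union> (insert (C \<union> D) (\<C> - {C, D})) = P"
      using p CC D(1) by (auto simp: partition_on_def)
    have "(C \<union> D) \<inter> A = {}" if "A \<in> \<C> - {C, D}" for A
      using that disj[OF CC, of A] disj[OF D(1), of A] by auto
    then show "disjoint (insert (C \<union> D) (\<C> - {C, D}))"
      using disj by (auto simp: disjoint_def)
    show "{} \<notin> insert (C \<union> D) (\<C> - {C, D})" using p D by (auto simp: partition_on_def)
  qed
  have card2: "card (insert (C \<union> D) (X - {C, D})) + 1 \<le> card X" if "C \<in> X" "D \<in> X" "finite X" for X
  proof -
    have "card (X - {C, D}) = card X - 2" using that DC by (subst card_Diff_subset) auto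
    moreover have "card X \<ge> 2" using that DC card_mono[of X "{C, D}"] by auto
    ultimately show ?thesis using card_insert_le_m1[of "card X - 1" "X - {C,D}" "C \<union> D"] by linarith
  qed
  have split: "\<exists>e\<in>insert {x, y} F. card (e \<inter> S) = 1"
    if S: "A \<in> insert (C \<union> D) (\<C> - {C, D})" "S \<subseteq> P" "S \<inter> A \<noteq> {}" "\<not> A \<subseteq> S" for A S
  proof (cases "A = C \<union> D")
    case False
    then have "connects F A" using S st by (auto simp: state_def)
    then show ?thesis using S by (auto simp: connects_def)
  next
    case True
    show ?thesis
    proof (rule ccontr)
      assume neg: "\<not> ?thesis"
      then have nF: "\<not> (\<exists>e\<in>F. card (e \<inter> S) = 1)" by blast
      then have "S \<inter> C = {} \<or> C \<subseteq> S" "S \<inter> D = {} \<or> D \<subseteq> S"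
        using st CC D(1) S(2) unfolding state_def connects_def by meson+
      with S True have "C \<subseteq> S \<and> S \<inter> D = {} \<or> D \<subseteq> S \<and> S \<inter> C = {}" by blast
      then have "{x, y} \<inter> S = {x} \<or> {x, y} \<inter> S = {y}" using x D by auto
      then have "card ({x, y} \<inter> S) = 1" by auto
      with neg show False by blast
    qed
  qed
  have "state I (insert (C \<union> D) (\<C> - {C, D})) (insert {x, y} F) (insert (C \<union> D) (U - {C, D}))"
    unfolding state_def
  proof (intro conjI)
    show "card (insert {x, y} F) + card (insert (C \<union> D) (\<C> - {C, D})) \<le> card P"
      using card2[OF CC D(1) fin(1)] st card_insert_le_m1[of "card F + 1" F "{x,y}"]
      by (simp add: state_def)
    have "x \<noteq> y" "x \<in> P" "y \<in> P" using x y fin(3)[OF CC] by auto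
    then show "\<forall>i\<in>I. present i (insert {x, y} F)"
      using st w unfolding state_def present_def by blast
    show "\<forall>A\<in>insert (C \<union> D) (\<C> - {C, D}). connects (insert {x, y} F) A"
      using split unfolding connects_def by blast
    show "\<forall>i\<in>I. \<forall>A\<in>insert (C \<union> D) (\<C> - {C, D}) - insert (C \<union> D) (U - {C, D}). ew i A (P - A) = 0"
      using st unfolding state_def by blast
  qed (use st UC p' in \<open>auto simp: state_def\<close>)
  with that[OF DU DC D(2)] card2[OF C DU fin(2)] show ?thesis by blast
qed

end

section \<open>Merging parts by binary search\<close>

context cut_round
begin

lemma solvable_edge:
  assumes "C \<subseteq> P" "y \<in> P - C" "card C \<le> 2 ^ k" "I \<subseteq> I0" and B: "\<And>i. i \<in> I \<Longrightarrow> B i \<ge> 0"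
    and pos: "\<And>i. i \<in> I \<Longrightarrow> ew i C {y} > 0"
    and *: "\<And>x. x \<in> C \<Longrightarrow> solvable {i\<in>I. w i x y > 0} B"
  shows "solvable I (\<lambda>i. 3 * real k + B i)"
proof (rule solvable_neighbour)
  fix x assume x: "x \<in> C"
  have "ew i {y} {x} = w i x y" if "i \<in> I" for i
    using w_sym[of i] that assms(4) by (auto simp: ew_def)
  then have "{i\<in>I. ew i {y} {x} > 0} = {i\<in>I. w i x y > 0}" by auto
  with *[OF x] show "solvable {i\<in>I. ew i {y} {x} > 0} B" by simp
next
  fix i assume "i \<in> I"
  then show "ew i {y} C > 0" using pos[of i] ew_sym[of i C "{y}"] assms(4) by auto
qed (use assms in auto)

text \<open>An active part costs one weight to test for outgoing edges (3 queries) and two binary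
  searches over at most \<open>2 ^ l\<close> vertices, for the outer and for the inner endpoint (3l
  queries each). Afterwards one part fewer is active.\<close>

lemma solvable_fallback:
  assumes l: "card P \<le> 2 ^ l" and B: "\<And>i. B i \<ge> 0"
    and final: "\<And>J F. J \<subseteq> I0 \<Longrightarrow> (\<And>i. i \<in> J \<Longrightarrow> spanning i F) \<Longrightarrow> solvable J B"
    and "state I \<C> F U"
  shows "solvable I (\<lambda>i. real (card U) * (3 + 6 * real l) + B i)"
  using assms(4)
proof (induction "card U" arbitrary: I \<C> F U rule: less_induct)
  case less
  note st = less.prems and fin = state_finite[OF less.prems]
  have IO: "I \<subseteq> I0" using st by (simp add: state_def)
  show ?case
  proof (cases "U = {}")
    case True
    have "solvable I B" using state_spanning st True by (intro final[OF IO]) auto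
    then show ?thesis by (simp add: True)
  next
    case False
    then obtain C where C: "C \<in> U" by blast
    have CP: "C \<subseteq> P" using C st fin(3) by (auto simp: state_def)
    let ?K = "3 + 6 * real l"
    have IH: "solvable J (\<lambda>i. real (card U - 1) * ?K + B i)"
      if "state J \<C>' F' U'" "card U' + 1 \<le> card U" for J \<C>' F' U'
    proof (rule solvable_mono[OF less.hyps[OF _ that(1)]])
      fix i
      have "real (card U') * ?K \<le> real (card U - 1) * ?K" using that(2) by (intro mult_right_mono) auto
      then show "real (card U') * ?K + B i \<le> real (card U - 1) * ?K + B i" by simp
    qed (use that in auto)
    have "solvable I (\<lambda>i. 3 + (3 * real l + (3 * real l + (real (card U - 1) * ?K + B i))))"
    proof (rule solvable_ew)
      fix i0 assume i0: "i0 \<in> I"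
      let ?J = "{i\<in>I. ew i C (P - C) = ew i0 C (P - C)}"
      have stJ: "state ?J \<C> F U" using st by (rule state_subset) auto
      show "solvable ?J (\<lambda>i. 3 * real l + (3 * real l + (real (card U - 1) * ?K + B i)))"
      proof (cases "ew i0 C (P - C) = 0")
        case True
        have "state ?J \<C> F (U - {C})" using stJ by (rule state_remove) (use True in auto)
        moreover have "card (U - {C}) + 1 \<le> card U" using card_Suc_Diff1[OF fin(2) C] by simp
        ultimately have "solvable ?J (\<lambda>i. real (card U - 1) * ?K + B i)" by (rule IH)
        then show ?thesis by (rule solvable_mono) auto
      next
        case False
        show ?thesis
        proof (rule solvable_neighbour)
          fix y assume y: "y \<in> P - C"
          let ?J1 = "{i\<in>?J. ew i C {y} > 0}"
          show "solvable ?J1 (\<lambda>i. 3 * real l + (real (card U - 1) * ?K + B i))"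
          proof (rule solvable_edge[OF CP y])
            fix x assume x: "x \<in> C"
            let ?J2 = "{i\<in>?J1. w i x y > 0}"
            have stJ2: "state ?J2 \<C> F U" using st by (rule state_subset) auto
            show "solvable ?J2 (\<lambda>i. real (card U - 1) * ?K + B i)"
            proof (cases "?J2 = {}")
              case True
              show ?thesis unfolding True by (rule solvable_empty)
            next
              case ne: False
              show ?thesis
              proof (rule state_merge[OF stJ2 C x y])
                fix D assume "state ?J2 (insert (C \<union> D) (\<C> - {C, D})) (insert {x, y} F) (insert (C \<union> D) (U - {C, D}))"
                  "card (insert (C \<union> D) (U - {C, D})) + 1 \<le> card U"
                then show ?thesis by (rule IH)
              qed (use ne in auto)
            qed
          qed (use IO B l CP in \<open>auto intro: order_trans[OF card_mono[OF finP]]\<close>)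
        qed (use IO B CP l False in \<open>auto intro: order_trans[OF card_mono[OF finP]]\<close>)
      qed
    qed (use IO CP B in auto)
    moreover obtain n where "card U = Suc n"
      using card_Suc_Diff1[OF fin(2) C] by metis
    ultimately show ?thesis by (simp add: algebra_simps)
  qed
qed

text \<open>The neighbours avoid all of \<open>S\<close>, so a merge swallows no other member of
  \<open>S\<close> and leaves the remaining neighbours valid. Hence every member of \<open>S\<close>
  lowers the number of active parts by one.\<close>

lemma solvable_merges:
  assumes st: "state I \<C> F U" and S: "S \<subseteq> U"
    and s: "\<And>C. C \<in> S \<Longrightarrow> s C \<in> P - \<Union> S" "\<And>C i. C \<in> S \<Longrightarrow> i \<in> I \<Longrightarrow> ew i C {s C} > 0"
    and k: "\<And>C. C \<in> S \<Longrightarrow> card C \<le> 2 ^ k C" and B: "\<And>i. B i \<ge> 0"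
    and cont: "\<And>J \<C>' F' U'. J \<subseteq> I \<Longrightarrow> state J \<C>' F' U' \<Longrightarrow> card U' + card S \<le> card U \<Longrightarrow> solvable J B"
  shows "solvable I (\<lambda>i. (\<Sum>C\<in>S. 3 * real (k C)) + B i)"
proof -
  have "finite S" using S state_finite(2)[OF st] finite_subset by blast
  then show ?thesis using assms
  proof (induction S arbitrary: I \<C> F U)
    case empty
    then show ?case by simp
  next
    case (insert C S)
    note st = insert.prems(1) and fin = state_finite[OF insert.prems(1)]
    have IO: "I \<subseteq> I0" and C: "C \<in> U" and UC: "U \<subseteq> \<C>" using st insert.prems(2) by (auto simp: state_def)
    have CP: "C \<subseteq> P" using C UC fin(3) by auto
    have y: "s C \<in> P - C" using insert.prems(3)[of C] by auto
    have "solvable I (\<lambda>i. 3 * real (k C) + ((\<Sum>C\<in>S. 3 * real (k C)) + B i))"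
    proof (rule solvable_edge[OF CP y])
      fix x assume x: "x \<in> C"
      let ?J = "{i\<in>I. w i x (s C) > 0}"
      have stJ: "state ?J \<C> F U" using st by (rule state_subset) auto
      show "solvable ?J (\<lambda>i. (\<Sum>C\<in>S. 3 * real (k C)) + B i)"
      proof (cases "?J = {}")
        case True
        show ?thesis unfolding True by (rule solvable_empty)
      next
        case ne: False
        show ?thesis
        proof (rule state_merge[OF stJ C x y])
          fix D assume D: "D \<in> U" "D \<noteq> C" "s C \<in> D"
            and stD: "state ?J (insert (C \<union> D) (\<C> - {C, D})) (insert {x, s C} F) (insert (C \<union> D) (U - {C, D}))"
            and cD: "card (insert (C \<union> D) (U - {C, D})) + 1 \<le> card U"
          have "D \<notin> S" using D(3) insert.prems(3)[of C] by auto
          show ?thesis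
          proof (rule insert.IH[OF stD])
            show "S \<subseteq> insert (C \<union> D) (U - {C, D})" using insert.prems(2) insert.hyps(2) \<open>D \<notin> S\<close> by auto
            show "solvable J B" if "J \<subseteq> ?J" "state J \<C>' F' U'"
              "card U' + card S \<le> card (insert (C \<union> D) (U - {C, D}))" for J \<C>' F' U'
              using that cD insert.hyps by (intro insert.prems(7)) auto
            show "s C' \<in> P - \<Union> S" if "C' \<in> S" for C' using insert.prems(3)[of C'] that by auto
            show "ew i C' {s C'} > 0" if "C' \<in> S" "i \<in> ?J" for C' i
              using insert.prems(4)[of C' i] that by auto
          qed (use insert.prems in auto)
        qed (use ne in auto)
      qed
    qed (use IO insert.prems in \<open>auto intro!: add_nonneg_nonneg sum_nonneg\<close>)
    then show ?case using insert.hyps by (simp add: add.assoc)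
  qed
qed

end

section \<open>Learning sparse matrices\<close>

text \<open>It dominates e, so it bounds the number of nonzero entries, and it is exponential, so a
  bound \<open>2 ^ (l + 6)\<close> on the total also bounds each row by \<open>3 * l\<close>. The
  base 3/2 is below 2: a random half of e neighbours is empty with probability 2^-e, and (3/2) *
  (1/2) < 1 keeps the expected weight bounded.\<close>

definition row_weight :: "nat \<Rightarrow> real" where
  "row_weight e = 2 * ((3/2) ^ e - 1)"

lemma row_weight_0 [simp]: "row_weight 0 = 0"
  by (simp add: row_weight_def)

lemma row_weight_nonneg: "row_weight e \<ge> 0"
  by (simp add: row_weight_def)

lemma le_row_weight: "real e \<le> row_weight e"
proof -
  have "1 + real e * (1/2) \<le> (1 + 1/2) ^ e" by (rule Bernoulli_inequality) simp
  then show ?thesis by (simp add: row_weight_def)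
qed

lemma row_weight_le_imp_le:
  assumes "row_weight e \<le> 2 ^ (l + 6)" "l \<ge> 12"
  shows "e \<le> 3 * l"
proof (rule ccontr)
  assume "\<not> ?thesis"
  then have e: "2 * (l + 6) \<le> e" using assms(2) by simp
  have pow: "2 ^ n \<le> (3/2 :: real) ^ (2 * n)" for n
    unfolding power_mult by (intro power_mono) (auto simp: power2_eq_square)
  have "2 ^ (l + 6) \<le> (3/2 :: real) ^ (2 * (l + 6))" by (rule pow)
  also have "\<dots> \<le> (3/2) ^ e" using e by (intro power_increasing) auto
  finally have 1: "2 ^ (l + 6) \<le> (3/2 :: real) ^ e" .
  have "(2::real) ^ 2 \<le> 2 ^ (l + 6)" by (intro power_increasing) auto
  moreover have "2 * (3/2 :: real) ^ e - 2 \<le> 2 ^ (l + 6)"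
    using assms(1) by (simp add: row_weight_def)
  ultimately have "(4::real) \<le> 2" using 1 unfolding power2_eq_square by linarith
  then show False by simp
qed

lemma sq_times_power_le: "m \<ge> 8 \<Longrightarrow> 128 * (m+1)\<^sup>2 \<le> (8::nat) ^ m"
proof (induction m rule: nat_induct_at_least)
  case base
  show ?case by (simp add: power2_eq_square)
next
  case (Suc n)
  have "128 * (Suc n + 1)\<^sup>2 \<le> 8 * (128 * (n+1)\<^sup>2)" by (simp add: power2_eq_square algebra_simps)
  with Suc show ?case by simp
qed

text \<open>This makes two lower-order terms negligible: the matrices with few nonzero rows in
  \<open>exists_design\<close> and the fixed cost of the levels in
  \<open>level_overhead\<close>.\<close>

lemma square_times_power_le:
  assumes "l \<ge> 64"
  shows "2 * l\<^sup>2 * 2 ^ (l div 8) \<le> (2::nat) ^ (l div 2)"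
proof -
  let ?m = "l div 8"
  have "l \<le> 8 * (?m + 1)" by simp
  then have "l\<^sup>2 \<le> (8 * (?m + 1))\<^sup>2" by (rule power_mono) simp
  then have "2 * l\<^sup>2 \<le> 128 * (?m + 1)\<^sup>2" unfolding power_mult_distrib by simp
  also have "\<dots> \<le> 8 ^ ?m" using assms by (intro sq_times_power_le) linarith
  finally have "2 * l\<^sup>2 * 2 ^ ?m \<le> 8 ^ ?m * 2 ^ ?m" by (rule mult_right_mono) simp
  also have "\<dots> = 2 ^ (4 * ?m)" by (simp add: power_mult flip: power_mult_distrib)
  also have "\<dots> \<le> 2 ^ (l div 2)" by (intro power_increasing) auto
  finally show ?thesis .
qed

text \<open>\<open>2 ^ l\<close> stands for q and \<open>2 ^ b\<close> for n, both rounded up.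
  Weights are at most n^2, so a signed value takes \<open>4 * b\<close> bits and a position in the
  matrix twice \<open>l\<close> bits; hence \<open>6 * b\<close> bits suffice for an entry.\<close>

locale bounded_cut_round = cut_round orc ok I0 P Q w
  for orc :: "'i \<Rightarrow> 'a set \<Rightarrow> nat" and ok :: "'i \<Rightarrow> 'b \<Rightarrow> bool"
    and I0 and P :: "'v set" and Q w +
  fixes W l b :: nat
  assumes l: "l \<ge> 64" and lb: "l \<le> b" and card_P: "card P \<le> 2 ^ l"
    and W: "2 * W + 1 \<le> 2 ^ (4 * b)"
    and ew_le: "\<And>i X Y. i \<in> I0 \<Longrightarrow> X \<subseteq> P \<Longrightarrow> Y \<subseteq> P \<Longrightarrow> X \<inter> Y = {} \<Longrightarrow> ew i X Y \<le> W"
begin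

definition nbrs :: "'i \<Rightarrow> 'v set \<Rightarrow> 'v set" where
  "nbrs i C = {v \<in> P - C. ew i C {v} > 0}"

definition weight :: "'i \<Rightarrow> 'v set set \<Rightarrow> 'v set \<Rightarrow> real" where
  "weight i U R = (\<Sum>C\<in>U. row_weight (card (nbrs i C \<inter> R)))"

text \<open>The price of one unit of weight, of order log n / log q. The constant covers 96 * 384,
  from three queries per weight, 32 tests per unit of \<open>design_size\<close> and its factor 384,
  and leaves room for verifying the entries.\<close>

definition \<kappa> :: real where "\<kappa> = 40000 * real b / real l"

lemma kappa_ge: "\<kappa> \<ge> 40000"
proof -
  have "real l \<le> real b" using lb by simp
  then have "real b / real l \<ge> 1" using l by (simp add: field_simps)
  then show ?thesis by (simp add: \<kappa>_def)
qed

lemma weight_nonneg: "weight i U R \<ge> 0"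
  unfolding weight_def by (intro sum_nonneg row_weight_nonneg)

lemma card_nbrs_le_weight:
  assumes "finite U"
  shows "(\<Sum>C\<in>U. real (card (nbrs i C \<inter> R))) \<le> weight i U R"
  unfolding weight_def by (intro sum_mono le_row_weight)

lemma row_le:
  assumes "finite U" "C \<in> U" "weight i U R \<le> 2 ^ (l + 6)"
  shows "card (nbrs i C \<inter> R) \<le> 3 * l"
proof (rule row_weight_le_imp_le)
  have "row_weight (card (nbrs i C \<inter> R)) \<le> weight i U R"
    unfolding weight_def using assms by (intro member_le_sum) (auto intro: row_weight_nonneg)
  with assms show "row_weight (card (nbrs i C \<inter> R)) \<le> 2 ^ (l + 6)" by linarith
qed (use l in simp)

text \<open>The value of \<open>k\<close> in \<open>exists_detecting_design\<close>. With
  \<open>\<beta> = 6 * b\<close>, \<open>e = 2 * 2 ^ j\<close> and \<open>\<tau> = l div 8\<close>,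
  which is at least l/16, condition \<open>H3\<close> asks for about 192 b 2^j / l; doubling this
  absorbs the additive terms.\<close>

definition design_size :: "nat \<Rightarrow> nat" where
  "design_size j = (384 * b * 2 ^ j) div l + 1"

lemma design_size_cost:
  assumes "l div 2 \<le> j"
  shows "3 * real (32 * design_size j) + 3 * real (2 ^ j + 1) \<le> \<kappa> * 2 ^ j"
proof -
  have j: "j \<ge> 32" using assms l by linarith
  have "real ((384 * b * 2 ^ j) div l) \<le> real (384 * b * 2 ^ j) / real l" by (rule of_nat_div_le_of_nat)
  then have d: "real (design_size j) \<le> 384 * (real b / real l * 2 ^ j) + 1" by (simp add: design_size_def)
  have "(2::real) ^ 32 \<le> 2 ^ j" using j by (intro power_increasing) auto
  then have j2: "(100::real) \<le> 2 ^ j" by simp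
  have "real b / real l \<ge> 1" using l lb by (simp add: field_simps)
  then have "1 * 2 ^ j \<le> (real b / real l) * 2 ^ j" by (rule mult_right_mono) simp
  moreover have "\<kappa> * 2 ^ j = 40000 * ((real b / real l) * 2 ^ j)" by (simp add: \<kappa>_def)
  moreover have "3 * real (32 * design_size j) + 3 * real (2 ^ j + 1) = 96 * real (design_size j) + 3 * 2 ^ j + 3"
    by simp
  moreover have "96 * d + 3 * y + 3 \<le> 40000 * x" if "1 * y \<le> x" "d \<le> 384 * x + 1" "100 \<le> y" for d x y :: real
    using that by linarith
  ultimately show ?thesis using d j2 by metis
qed

text \<open>The sparsity bounds are twice those of a single matrix, since the design is applied to a
  difference of two. The choice \<open>\<tau> = l div 8\<close> is proportional to log q, yet it
  keeps the power of 2 in \<open>H2\<close> far below \<open>2 ^ j\<close>, which is at least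
  \<open>2 ^ (l div 2)\<close>.\<close>

lemma exists_design:
  assumes U: "finite U" "U \<noteq> {}" "card U \<le> 2 ^ l" and R: "R \<subseteq> P" "R \<noteq> {}" and j: "l div 2 \<le> j"
  shows "\<exists>X Y. (\<forall>i. X i \<subseteq> U \<and> Y i \<subseteq> R) \<and> (\<forall>Z :: 'v set \<Rightarrow> 'v \<Rightarrow> int.
    (\<forall>u\<in>U. \<forall>v\<in>R. \<bar>Z u v\<bar> \<le> int W) \<longrightarrow> (\<forall>u\<in>U. card {v\<in>R. Z u v \<noteq> 0} \<le> 6 * l) \<longrightarrow>
    (\<Sum>u\<in>U. card {v\<in>R. Z u v \<noteq> 0}) \<le> 2 * 2 ^ j \<longrightarrow> (\<exists>u\<in>U. \<exists>v\<in>R. Z u v \<noteq> 0) \<longrightarrow>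
    (\<exists>i<32*design_size j. (\<Sum>u\<in>X i. \<Sum>v\<in>Y i. Z u v) \<noteq> 0))"
proof (rule exists_detecting_design[where \<beta> = "6 * b" and \<tau> = "l div 8"])
  let ?k = "design_size j"
  have lk: "384 * b * 2 ^ j \<le> l * ?k"
  proof -
    have "384 * b * 2 ^ j = l * ((384 * b * 2 ^ j) div l) + (384 * b * 2 ^ j) mod l" by simp
    also have "(384 * b * 2 ^ j) mod l \<le> l" using l by (simp add: less_imp_le)
    finally show ?thesis by (simp add: design_size_def algebra_simps)
  qed
  have b1: "b \<ge> 64" using l lb by simp
  show "finite R" using R finite_subset_P by blast
  have "card R \<le> 2 ^ l" using card_mono[OF finP R(1)] card_P by simp
  then have "card U * card R * (2 * W + 1) \<le> 2 ^ l * 2 ^ l * 2 ^ (4 * b)"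
    using U W by (intro mult_mono) auto
  also have "\<dots> = 2 ^ (l + l + 4 * b)" by (simp only: power_add)
  also have "\<dots> \<le> 2 ^ (6 * b)" using lb by (intro power_increasing) auto
  finally show "card U * card R * (2 * W + 1) \<le> 2 ^ (6 * b)" .
  let ?t = "2 ^ (l div 8) :: nat"
  have "(576 * b * l * ?t + 2) * l \<le> (576 * b * l * ?t + 2 * b * l * ?t) * l"
  proof (intro mult_right_mono add_left_mono)
    have "2 * (1 * 1 * 1) \<le> 2 * (b * l * ?t)" using b1 l by (intro mult_mono) auto
    then show "2 \<le> 2 * b * l * ?t" by simp
  qed simp
  also have "\<dots> = 289 * b * (2 * l\<^sup>2 * ?t)" by (simp add: power2_eq_square algebra_simps)
  also have "\<dots> \<le> 384 * b * 2 ^ (l div 2)" using square_times_power_le[OF l] by (intro mult_mono) auto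
  also have "\<dots> \<le> 384 * b * 2 ^ j" using j by (intro mult_left_mono power_increasing) auto
  also note lk
  finally have "(576 * b * l * ?t + 2) * l \<le> ?k * l" by (simp only: mult.commute[of l])
  then have "576 * b * l * ?t + 2 \<le> ?k" by (rule mult_right_le_imp_le) (use l in simp)
  then show "6 * b * (6 * l * (16 * ?t)) + 2 \<le> ?k" by (simp add: ac_simps)
  have "l \<le> 16 * (l div 8)" using l by linarith
  then have "l * ?k \<le> 16 * (l div 8) * ?k" by (rule mult_right_mono) simp
  with lk have "16 * (24 * (b * 2 ^ j)) \<le> 16 * (l div 8 * ?k)" by (simp only: ac_simps)
  then have "24 * (b * 2 ^ j) \<le> l div 8 * ?k" by (simp add: mult.commute)
  moreover have "1 * 1 \<le> b * 2 ^ j" using b1 by (intro mult_mono) auto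
  moreover have "6 * b * (2 * 2 ^ j) + 2 = 12 * (b * 2 ^ j) + 2" by simp
  ultimately show "6 * b * (2 * 2 ^ j) + 2 \<le> l div 8 * ?k" by linarith
qed (use U R in auto)

end

section \<open>Learning a matrix of bounded and of unknown weight\<close>

context bounded_cut_round
begin

lemma ew_Union_left:
  assumes U: "\<And>C. C \<in> U \<Longrightarrow> C \<subseteq> P" "disjoint U" and A: "A \<subseteq> U"
  shows "ew i (\<Union> A) D = (\<Sum>C\<in>A. \<Sum>v\<in>D. ew i C {v})"
proof -
  have fA: "finite C" if "C \<in> A" for C using that A U(1) finite_subset_P by blast
  have d: "\<forall>B\<in>A. \<forall>C\<in>A. B \<noteq> C \<longrightarrow> B \<inter> C = {}" using U(2) A by (auto simp: disjoint_def)
  have "ew i (\<Union> A) D = (\<Sum>C\<in>A. \<Sum>x\<in>C. \<Sum>y\<in>D. w i x y)"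
    unfolding ew_def using fA d by (simp add: sum.Union_disjoint)
  also have "\<dots> = (\<Sum>C\<in>A. \<Sum>y\<in>D. \<Sum>x\<in>C. w i x y)"
    by (intro sum.cong refl sum.swap)
  finally show ?thesis by (simp add: ew_def)
qed

text \<open>Two matrices that keep the promise have a difference within the doubled bounds of the
  design, so equal answers force equal matrices.\<close>

lemma design_separates:
  assumes U: "finite U" "\<And>C. C \<in> U \<Longrightarrow> C \<subseteq> P" and R: "R \<subseteq> P - \<Union> U" and j: "j \<le> l + 6"
    and XY: "\<And>Z :: 'v set \<Rightarrow> 'v \<Rightarrow> int. (\<forall>u\<in>U. \<forall>v\<in>R. \<bar>Z u v\<bar> \<le> int W) \<Longrightarrow> (\<forall>u\<in>U. card {v\<in>R. Z u v \<noteq> 0} \<le> 6 * l) \<Longrightarrow>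
      (\<Sum>u\<in>U. card {v\<in>R. Z u v \<noteq> 0}) \<le> 2 * 2 ^ j \<Longrightarrow> (\<exists>u\<in>U. \<exists>v\<in>R. Z u v \<noteq> 0) \<Longrightarrow>
      (\<exists>n<N. (\<Sum>u\<in>X n. \<Sum>v\<in>Y n. Z u v) \<noteq> 0)"
    and ii: "i \<in> I0" "i' \<in> I0" "weight i U R \<le> 2 ^ j" "weight i' U R \<le> 2 ^ j"
    and eq: "\<And>n. n < N \<Longrightarrow> (\<Sum>C\<in>X n. \<Sum>v\<in>Y n. ew i C {v}) = (\<Sum>C\<in>X n. \<Sum>v\<in>Y n. ew i' C {v})"
    and C: "C \<in> U" "v \<in> R"
  shows "ew i C {v} = ew i' C {v}"
proof (rule ccontr)
  assume ne: "\<not> ?thesis"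
  let ?Z = "\<lambda>C v. int (ew i C {v}) - int (ew i' C {v})"
  have le: "ew k D {v} \<le> W" if "k \<in> I0" "D \<in> U" "v \<in> R" for k D v
    using that U(2)[of D] R by (intro ew_le) auto
  have w6: "weight k U R \<le> 2 ^ (l + 6)" if "weight k U R \<le> 2 ^ j" for k
    by (rule order_trans[OF that power_increasing[OF j]]) simp
  have sub: "{v\<in>R. ?Z D v \<noteq> 0} \<subseteq> (nbrs i D \<inter> R) \<union> (nbrs i' D \<inter> R)" if "D \<in> U" for D
    using that R by (auto simp: nbrs_def)
  have fin: "finite (nbrs k D \<inter> R)" for k D
    using R finite_subset_P[of "nbrs k D \<inter> R"] by (auto simp: nbrs_def)
  have row: "card {v\<in>R. ?Z D v \<noteq> 0} \<le> card (nbrs i D \<inter> R) + card (nbrs i' D \<inter> R)" if "D \<in> U" for D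
    using card_mono[OF _ sub[OF that]] card_Un_le[of "nbrs i D \<inter> R" "nbrs i' D \<inter> R"] fin
    by (meson finite_UnI order_trans)
  have "\<exists>n<N. (\<Sum>u\<in>X n. \<Sum>v\<in>Y n. ?Z u v) \<noteq> 0"
  proof (rule XY)
    show "\<forall>u\<in>U. \<forall>v\<in>R. \<bar>?Z u v\<bar> \<le> int W"
    proof (intro ballI)
      fix D v assume "D \<in> U" "v \<in> R"
      then show "\<bar>?Z D v\<bar> \<le> int W" using le[OF ii(1), of D v] le[OF ii(2), of D v] by linarith
    qed
    show "\<forall>u\<in>U. card {v\<in>R. ?Z u v \<noteq> 0} \<le> 6 * l"
    proof
      fix D assume D: "D \<in> U"
      show "card {v\<in>R. ?Z D v \<noteq> 0} \<le> 6 * l"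
        using row[OF D] row_le[OF U(1) D w6[OF ii(3)]] row_le[OF U(1) D w6[OF ii(4)]] by linarith
    qed
    have "(\<Sum>u\<in>U. card {v\<in>R. ?Z u v \<noteq> 0}) \<le> (\<Sum>u\<in>U. card (nbrs i u \<inter> R) + card (nbrs i' u \<inter> R))"
      by (rule sum_mono[OF row])
    then have "real (\<Sum>u\<in>U. card {v\<in>R. ?Z u v \<noteq> 0}) \<le> real (\<Sum>u\<in>U. card (nbrs i u \<inter> R) + card (nbrs i' u \<inter> R))"
      by (rule of_nat_mono)
    also have "\<dots> = (\<Sum>C\<in>U. real (card (nbrs i C \<inter> R))) + (\<Sum>C\<in>U. real (card (nbrs i' C \<inter> R)))"
      by (simp add: sum.distrib)
    also have "\<dots> \<le> 2 ^ j + 2 ^ j"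
      using card_nbrs_le_weight[OF U(1), of i R] card_nbrs_le_weight[OF U(1), of i' R] ii by linarith
    also have "\<dots> = real (2 * 2 ^ j)" by simp
    finally show "(\<Sum>u\<in>U. card {v\<in>R. ?Z u v \<noteq> 0}) \<le> 2 * 2 ^ j" by (simp only: of_nat_le_iff)
    show "\<exists>u\<in>U. \<exists>v\<in>R. ?Z u v \<noteq> 0" using ne C by auto
  qed
  then obtain n where n: "n < N" "(\<Sum>u\<in>X n. \<Sum>v\<in>Y n. ?Z u v) \<noteq> 0" by blast
  have "(\<Sum>u\<in>X n. \<Sum>v\<in>Y n. ?Z u v) =
    int (\<Sum>C\<in>X n. \<Sum>v\<in>Y n. ew i C {v}) - int (\<Sum>C\<in>X n. \<Sum>v\<in>Y n. ew i' C {v})"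
    by (simp add: sum_subtractf)
  with n eq[OF n(1)] show False by simp
qed

text \<open>The answers to the design select a candidate \<open>i1\<close> of small weight, which is
  verified by direct queries. If the check fails, the actual weight exceeds \<open>2 ^ j\<close> for
  certain: an input of small weight with the same answers would have the matrix of
  \<open>i1\<close>.\<close>

lemma solvable_matrix:
  assumes U: "finite U" "\<And>C. C \<in> U \<Longrightarrow> C \<subseteq> P" "disjoint U" "card U \<le> 2 ^ l" and R: "R \<subseteq> P - \<Union> U"
    and j: "l div 2 \<le> j" "j \<le> l + 6"
    and I: "I \<subseteq> I0" and B: "\<And>i. B i \<ge> 0"
    and yes: "\<And>i0. i0 \<in> I \<Longrightarrow> weight i0 U R \<le> 2 ^ j \<Longrightarrow>
      solvable {i\<in>I. \<forall>C\<in>U. \<forall>v\<in>R. ew i C {v} = ew i0 C {v}} B"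
    and no: "solvable {i\<in>I. weight i U R > 2 ^ j} B"
  shows "solvable I (\<lambda>i. \<kappa> * 2 ^ j + B i)"
proof (cases "U = {} \<or> R = {} \<or> I = {}")
  case True
  have "solvable I B"
  proof (cases "I = {}")
    case False
    then obtain i0 where i0: "i0 \<in> I" by blast
    have "weight i0 U R \<le> 2 ^ j" using True False by (auto simp: weight_def)
    moreover have "{i\<in>I. \<forall>C\<in>U. \<forall>v\<in>R. ew i C {v} = ew i0 C {v}} = I" using True False by auto
    ultimately show ?thesis using yes[OF i0] by simp
  qed (simp add: solvable_empty)
  then show ?thesis using kappa_ge by (elim solvable_mono) auto
next
  case False
  then have U0: "U \<noteq> {}" and R0: "R \<noteq> {}" by auto
  have RP: "R \<subseteq> P" using R by blast
  let ?N = "32 * design_size j"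
  have "\<exists>X Y. (\<forall>n. X n \<subseteq> U \<and> Y n \<subseteq> R) \<and> (\<forall>Z :: 'v set \<Rightarrow> 'v \<Rightarrow> int.
    (\<forall>u\<in>U. \<forall>v\<in>R. \<bar>Z u v\<bar> \<le> int W) \<longrightarrow> (\<forall>u\<in>U. card {v\<in>R. Z u v \<noteq> 0} \<le> 6 * l) \<longrightarrow>
    (\<Sum>u\<in>U. card {v\<in>R. Z u v \<noteq> 0}) \<le> 2 * 2 ^ j \<longrightarrow> (\<exists>u\<in>U. \<exists>v\<in>R. Z u v \<noteq> 0) \<longrightarrow>
    (\<exists>n<?N. (\<Sum>u\<in>X n. \<Sum>v\<in>Y n. Z u v) \<noteq> 0))"
    by (rule exists_design[OF U(1) U0 U(4) RP R0 j(1)])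
  then obtain X Y where XY0: "(\<forall>n. X n \<subseteq> U \<and> Y n \<subseteq> R) \<and> (\<forall>Z :: 'v set \<Rightarrow> 'v \<Rightarrow> int.
    (\<forall>u\<in>U. \<forall>v\<in>R. \<bar>Z u v\<bar> \<le> int W) \<longrightarrow> (\<forall>u\<in>U. card {v\<in>R. Z u v \<noteq> 0} \<le> 6 * l) \<longrightarrow>
    (\<Sum>u\<in>U. card {v\<in>R. Z u v \<noteq> 0}) \<le> 2 * 2 ^ j \<longrightarrow> (\<exists>u\<in>U. \<exists>v\<in>R. Z u v \<noteq> 0) \<longrightarrow>
    (\<exists>n<?N. (\<Sum>u\<in>X n. \<Sum>v\<in>Y n. Z u v) \<noteq> 0))"
    by (elim exE)
  have X: "X n \<subseteq> U" and Y: "Y n \<subseteq> R" for n using conjunct1[OF XY0] by auto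
  note sep = conjunct2[OF XY0, THEN spec, THEN mp, THEN mp, THEN mp, THEN mp]
  have mat: "ew i (\<Union> A) D = (\<Sum>C\<in>A. \<Sum>v\<in>D. ew i C {v})" if "A \<subseteq> U" for i A D
    using ew_Union_left[OF U(2,3) that] .
  define T1 where "T1 = (\<lambda>n. (\<Union> (X n), Y n)) ` {..<?N}"
  let ?B1 = "\<lambda>i. 3 * real (2 ^ j + 1) + B i"
  have UP: "\<Union> (X n) \<subseteq> P" for n using X U(2) by blast
  have XYdisj: "\<Union> (X n) \<inter> Y n = {}" for n using X Y R by blast
  have "solvable I (\<lambda>i. 3 * real ?N + ?B1 i)"
  proof (rule solvable_ews[where T = T1])
    show "finite T1" by (simp add: T1_def)
    show "card T1 \<le> ?N" unfolding T1_def by (rule order_trans[OF card_image_le]) auto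
    show "A \<subseteq> P \<and> D \<subseteq> P \<and> A \<inter> D = {}" if AD: "(A, D) \<in> T1" for A D
    proof -
      obtain n where "A = \<Union> (X n)" "D = Y n" using AD by (auto simp: T1_def)
      then show ?thesis using UP[of n] XYdisj[of n] Y[of n] RP by auto
    qed
    show "?B1 i \<ge> 0" for i using B[of i] by simp
    fix i0 assume i0: "i0 \<in> I"
    let ?J = "{i\<in>I. \<forall>(A, D)\<in>T1. ew i A D = ew i0 A D}"
    have J: "(\<Sum>C\<in>X n. \<Sum>v\<in>Y n. ew i C {v}) = (\<Sum>C\<in>X n. \<Sum>v\<in>Y n. ew i' C {v})"
      if "i \<in> ?J" "i' \<in> ?J" "n < ?N" for i i' n
      using that mat[OF X] by (auto simp: T1_def)
    show "solvable ?J ?B1"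
    proof (cases "\<exists>i1\<in>?J. weight i1 U R \<le> 2 ^ j")
      case False
      then have "?J \<subseteq> {i\<in>I. weight i U R > 2 ^ j}" by force
      with no show ?thesis by (rule solvable_mono) auto
    next
      case True
      then obtain i1 where i1: "i1 \<in> ?J" "weight i1 U R \<le> 2 ^ j" by blast
      define S where "S = (SIGMA C:U. nbrs i1 C \<inter> R)"
      \<comment> \<open>The support of the candidate and the total are enough: if they agree, the
        entries of the input dominate those of the candidate, and equal totals leave no room for
        further entries.\<close>
      define T2 where "T2 = insert (\<Union> U, R) ((\<lambda>(C, v). (C, {v})) ` S)"
      have finN: "finite (nbrs i1 C \<inter> R)" for C
        using RP finite_subset_P[of "nbrs i1 C \<inter> R"] by auto
      have finS: "finite S" unfolding S_def using U(1) finN by blast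
      have "real (card S) = (\<Sum>C\<in>U. real (card (nbrs i1 C \<inter> R)))"
        unfolding S_def using U(1) finN by (simp add: card_SigmaI)
      also have "\<dots> \<le> 2 ^ j" using card_nbrs_le_weight[OF U(1), of i1 R] i1 by linarith
      finally have "card S \<le> 2 ^ j" using of_nat_le_iff[of "card S" "2 ^ j", where 'a = real] by simp
      moreover have "card T2 \<le> card S + 1"
        unfolding T2_def using finS card_image_le[OF finS, of "\<lambda>(C, v). (C, {v})"]
        by (simp add: card_insert_if)
      ultimately have cT2: "card T2 \<le> 2 ^ j + 1" by linarith
      have same: "\<forall>C\<in>U. \<forall>v\<in>R. ew i C {v} = ew i1 C {v}"
        if i: "i \<in> I" and eq: "\<forall>(A, D)\<in>T2. ew i A D = ew i1 A D" for i
      proof -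
        have tot: "ew k (\<Union> U) R = (\<Sum>p\<in>U \<times> R. ew k (fst p) {snd p})" for k
          using mat[OF order_refl, of _ R] by (simp add: sum.cartesian_product case_prod_beta)
        have le: "ew i1 (fst p) {snd p} \<le> ew i (fst p) {snd p}" if p: "p \<in> U \<times> R" for p
        proof (cases "p \<in> S")
          case True
          then have "(fst p, {snd p}) \<in> T2" by (force simp: T2_def)
          then show ?thesis using eq by auto
        next
          case False
          then have "ew i1 (fst p) {snd p} = 0" using p R by (auto simp: S_def nbrs_def)
          then show ?thesis by simp
        qed
        have "ew i (\<Union> U) R = ew i1 (\<Union> U) R" using eq by (auto simp: T2_def)
        then have eqs: "(\<Sum>p\<in>U \<times> R. ew i1 (fst p) {snd p}) = (\<Sum>p\<in>U \<times> R. ew i (fst p) {snd p})"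
          by (simp add: tot)
        have finUR: "finite (U \<times> R)" using U(1) RP finite_subset_P by blast
        have "ew i1 (fst p) {snd p} = ew i (fst p) {snd p}" if "p \<in> U \<times> R" for p
          using sum_mono_inv[OF eqs le that finUR] .
        then show ?thesis by force
      qed
      have "solvable ?J (\<lambda>i. 3 * real (2 ^ j + 1) + B i)"
      proof (rule solvable_ews[where T = T2, OF _ _ cT2])
        show "finite T2" using finS by (simp add: T2_def)
        show "A \<subseteq> P \<and> D \<subseteq> P \<and> A \<inter> D = {}" if "(A, D) \<in> T2" for A D
          using that U(2) R by (auto simp: T2_def S_def)
        fix i2 assume i2: "i2 \<in> ?J"
        let ?J2 = "{i\<in>?J. \<forall>(A, D)\<in>T2. ew i A D = ew i2 A D}"
        show "solvable ?J2 B"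
        proof (cases "\<forall>(A, D)\<in>T2. ew i2 A D = ew i1 A D")
          case True
          have "?J2 \<subseteq> {i\<in>I. \<forall>C\<in>U. \<forall>v\<in>R. ew i C {v} = ew i1 C {v}}"
          proof
            fix i assume i: "i \<in> ?J2"
            then have "ew i (fst p) (snd p) = ew i1 (fst p) (snd p)" if "p \<in> T2" for p
              using bspec[OF True that] that by auto
            then have "\<forall>(A, D)\<in>T2. ew i A D = ew i1 A D" by auto
            then show "i \<in> {i\<in>I. \<forall>C\<in>U. \<forall>v\<in>R. ew i C {v} = ew i1 C {v}}"
              using same[of i] i by blast
          qed
          moreover have "i1 \<in> I" using i1 by blast
          ultimately show ?thesis using solvable_mono[OF yes[of i1]] i1(2) by blast
        next
          case False
          have "weight i U R > 2 ^ j" if i: "i \<in> ?J2" for i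
          proof (rule ccontr)
            assume "\<not> ?thesis"
            then have wi: "weight i U R \<le> 2 ^ j" by simp
            have iJ: "i \<in> ?J" using i by blast
            have eq: "ew i C {v} = ew i1 C {v}" if "C \<in> U" "v \<in> R" for C v
            proof (rule design_separates[OF U(1,2) R j(2) _ _ _ wi i1(2) _ that])
              show "i \<in> I0" "i1 \<in> I0" using i i1 I by auto
              show "(\<Sum>C\<in>X n. \<Sum>v\<in>Y n. ew i C {v}) = (\<Sum>C\<in>X n. \<Sum>v\<in>Y n. ew i1 C {v})" if "n < ?N" for n
                by (rule J[OF iJ i1(1) that])
            qed (assumption | (rule sep, assumption+))+
            have "ew i (\<Union> U) R = ew i1 (\<Union> U) R"
              using mat[OF order_refl, of _ R] eq by simp
            then have "\<forall>(A, D)\<in>T2. ew i A D = ew i1 A D" using eq by (auto simp: T2_def S_def)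
            moreover have "\<forall>(A, D)\<in>T2. ew i A D = ew i2 A D" using i by blast
            ultimately show False using False by force
          qed
          then have "?J2 \<subseteq> {i\<in>I. weight i U R > 2 ^ j}" by blast
          with no show ?thesis by (rule solvable_mono) auto
        qed
      qed (use I B in auto)
      then show ?thesis .
    qed
  qed (rule I)
  then show ?thesis
    by (rule solvable_mono) (use design_size_cost[OF j(1)] in auto)
qed

text \<open>The weight is unknown, so the threshold \<open>2 ^ j\<close> is doubled until the check
  succeeds, and the costs form a geometric series. The search starts at \<open>l div 2\<close>,
  where \<open>exists_design\<close> applies, and is abandoned beyond \<open>l + 6\<close>, up to
  which \<open>row_le\<close> bounds the rows.\<close>

lemma solvable_matrix_doubling:
  assumes U: "finite U" "\<And>C. C \<in> U \<Longrightarrow> C \<subseteq> P" "disjoint U" "card U \<le> 2 ^ l" and R: "R \<subseteq> P - \<Union> U"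
    and I: "I \<subseteq> I0" and B: "\<And>i. B i \<ge> 0"
    and yes: "\<And>i0. i0 \<in> I \<Longrightarrow> weight i0 U R \<le> 2 ^ (l + 6) \<Longrightarrow>
      solvable {i\<in>I. \<forall>C\<in>U. \<forall>v\<in>R. ew i C {v} = ew i0 C {v}} B"
    and no: "solvable {i\<in>I. weight i U R > 2 ^ (l + 6)} B"
  shows "solvable I (\<lambda>i. \<kappa> * (2 ^ (l div 2) + 4 * weight i U R) + B i)"
proof -
  \<comment> \<open>The cost to come from threshold \<open>j\<close> on. Subtracting
    \<open>2 ^ j\<close> makes the induction close: after a failure the weight exceeds
    \<open>2 ^ j\<close>, so \<open>2 ^ j + 2 ^ Suc j\<close> is at most four times the weight minus
    \<open>2 ^ j\<close>.\<close>
  let ?c = "\<lambda>j i. if weight i U R \<le> 2 ^ j then 2 ^ j else 4 * weight i U R - 2 ^ j"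
  have \<kappa>: "\<kappa> \<ge> 0" using kappa_ge by simp
  have c0: "?c j i \<ge> 0" for j i using weight_nonneg[of i U R] by auto
  have *: "solvable J (\<lambda>i. \<kappa> * ?c j i + B i)"
    if "l div 2 \<le> j" "j \<le> l + 6" "J \<subseteq> I" "\<And>i0. i0 \<in> J \<Longrightarrow> weight i0 U R \<le> 2 ^ (l + 6) \<Longrightarrow>
      solvable {i\<in>J. \<forall>C\<in>U. \<forall>v\<in>R. ew i C {v} = ew i0 C {v}} B"
      "solvable {i\<in>J. weight i U R > 2 ^ (l + 6)} B" for j J
    using that
  proof (induction "l + 6 - j" arbitrary: j J)
    case 0
    then have j: "j = l + 6" by simp
    have "solvable J (\<lambda>i. \<kappa> * 2 ^ j + B i)"
      by (rule solvable_matrix[OF U R]) (use 0 I B j in auto)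
    then show ?case
    proof (rule solvable_mono)
      fix i
      have "2 ^ j \<le> ?c j i"
      proof (cases "weight i U R \<le> 2 ^ j")
        case False
        then have "2 ^ j < weight i U R" by (simp only: not_le)
        moreover have "(0::real) \<le> 2 ^ j" by simp
        ultimately have "2 ^ j \<le> 4 * weight i U R - 2 ^ j" by linarith
        then show ?thesis using False by simp
      qed simp
      then have "\<kappa> * 2 ^ j \<le> \<kappa> * ?c j i" by (intro mult_left_mono \<kappa>)
      then show "\<kappa> * 2 ^ j + B i \<le> \<kappa> * ?c j i + B i" by simp
    qed simp
  next
    case (Suc n)
    then have j: "j < l + 6" by simp
    let ?B = "\<lambda>i. if weight i U R \<le> 2 ^ j then B i else \<kappa> * ?c (Suc j) i + B i"
    let ?J = "{i\<in>J. weight i U R > 2 ^ j}"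
    have mono: "weight i0 U R \<le> 2 ^ (l + 6)" if "weight i0 U R \<le> 2 ^ j" for i0
      by (rule order_trans[OF that power_increasing]) (use j in auto)
    have "solvable J (\<lambda>i. \<kappa> * 2 ^ j + ?B i)"
    proof (rule solvable_matrix[OF U R])
      fix i0 assume i0: "i0 \<in> J" "weight i0 U R \<le> 2 ^ j"
      show "solvable {i\<in>J. \<forall>C\<in>U. \<forall>v\<in>R. ew i C {v} = ew i0 C {v}} ?B"
      proof (rule solvable_mono[OF Suc.prems(4)[OF i0(1) mono[OF i0(2)]]])
        fix i
        have "0 \<le> \<kappa> * ?c (Suc j) i" using c0 \<kappa> by (rule mult_nonneg_nonneg[rotated])
        then show "B i \<le> ?B i" by simp
      qed simp
    next
      have "solvable ?J (\<lambda>i. \<kappa> * ?c (Suc j) i + B i)"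
      proof (rule Suc.hyps(1))
        show "n = l + 6 - Suc j" using Suc.hyps(2) by simp
        show "solvable {i\<in>?J. \<forall>C\<in>U. \<forall>v\<in>R. ew i C {v} = ew i0 C {v}} B"
          if "i0 \<in> ?J" "weight i0 U R \<le> 2 ^ (l + 6)" for i0
          by (rule solvable_mono[OF Suc.prems(4)[of i0]]) (use that in auto)
        show "solvable {i\<in>?J. weight i U R > 2 ^ (l + 6)} B"
          using Suc.prems(5) by (rule solvable_mono) auto
      qed (use Suc.prems j in auto)
      then show "solvable ?J ?B" by (rule solvable_mono) auto
    next
      show "?B i \<ge> 0" for i using B[of i] mult_nonneg_nonneg[OF \<kappa> c0[where j = "Suc j" and i = i]] by simp
    qed (use Suc.prems I j in auto)
    then show ?case
    proof (rule solvable_mono)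
      fix i
      show "\<kappa> * 2 ^ j + ?B i \<le> \<kappa> * ?c j i + B i"
      proof (cases "weight i U R \<le> 2 ^ j")
        case False
        then have "2 ^ j < weight i U R" by (simp only: not_le)
        then have "2 ^ j + ?c (Suc j) i \<le> ?c j i" by (cases "weight i U R \<le> 2 ^ Suc j") simp_all
        then have "\<kappa> * (2 ^ j + ?c (Suc j) i) \<le> \<kappa> * ?c j i" by (intro mult_left_mono \<kappa>)
        then have "\<kappa> * 2 ^ j + \<kappa> * ?c (Suc j) i \<le> \<kappa> * ?c j i" by (simp only: distrib_left)
        then show ?thesis using False by simp
      qed simp
    qed simp
  qed
  have "solvable I (\<lambda>i. \<kappa> * ?c (l div 2) i + B i)" by (rule *) (use yes no in auto)
  then show ?thesis
  proof (rule solvable_mono)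
    fix i
    have "?c (l div 2) i \<le> 2 ^ (l div 2) + 4 * weight i U R"
      using weight_nonneg[of i U R] by (auto intro: add_increasing)
    then have "\<kappa> * ?c (l div 2) i \<le> \<kappa> * (2 ^ (l div 2) + 4 * weight i U R)" by (intro mult_left_mono \<kappa>)
    then show "\<kappa> * ?c (l div 2) i + B i \<le> \<kappa> * (2 ^ (l div 2) + 4 * weight i U R) + B i" by simp
  qed simp
qed

end

section \<open>Sampling at all densities\<close>

lemma sum_lists_length_Suc:
  assumes "finite A"
  shows "(\<Sum>xs | set xs \<subseteq> A \<and> length xs = Suc n. f xs) = (\<Sum>x\<in>A. \<Sum>xs | set xs \<subseteq> A \<and> length xs = n. f (x # xs))"
proof -
  let ?L = "\<lambda>n. {xs. set xs \<subseteq> A \<and> length xs = n}"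
  have "?L (Suc n) = (\<lambda>(x, xs). x # xs) ` (A \<times> ?L n)"
    by (auto simp: length_Suc_conv image_iff)
  moreover have "inj_on (\<lambda>(x, xs). x # xs) (A \<times> ?L n)" by (auto simp: inj_on_def)
  ultimately have "(\<Sum>xs\<in>?L (Suc n). f xs) = (\<Sum>p\<in>A \<times> ?L n. f (case p of (x, xs) \<Rightarrow> x # xs))"
    by (simp add: sum.reindex)
  then show ?thesis by (simp add: sum.cartesian_product case_prod_beta)
qed

text \<open>The generating function of a binomial distribution: each element of \<open>N\<close>
  lies in a random \<open>C\<close> with probability 1/2 and then contributes a factor x. At x = 0
  it counts the sets that avoid \<open>N\<close>.\<close>

lemma sum_power_card_Int:
  assumes "finite A" "N \<subseteq> A"
  shows "(\<Sum>C\<in>Pow A. x ^ card (N \<inter> C)) = 2 ^ card A * ((1 + x) / 2 :: real) ^ card N"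
proof -
  have "(\<Sum>C\<in>Pow A. x ^ card (N \<inter> C)) = (\<Sum>C\<in>Pow A. (\<Prod>a\<in>C. if a \<in> N then x else 1) * (\<Prod>a\<in>A - C. 1))"
  proof (intro sum.cong refl)
    fix C assume "C \<in> Pow A"
    then have "finite C" using assms finite_subset by blast
    then have "(\<Prod>a\<in>C. if a \<in> N then x else 1) = (\<Prod>a\<in>C \<inter> N. x)" by (subst prod.inter_restrict) auto
    then show "x ^ card (N \<inter> C) = (\<Prod>a\<in>C. if a \<in> N then x else 1) * (\<Prod>a\<in>A - C. 1)"
      by (simp add: Int_commute)
  qed
  also have "\<dots> = (\<Prod>a\<in>A. (if a \<in> N then x else 1) + 1)"
    using assms by (subst prod_add) auto
  also have "\<dots> = (\<Prod>a\<in>A - N. 2) * (\<Prod>a\<in>N. x + 1)"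
    using assms by (subst prod.subset_diff[of N]) auto
  also have "\<dots> = 2 ^ (card A - card N) * (1 + x) ^ card N"
    using assms by (simp add: card_Diff_subset finite_subset add.commute)
  also have "\<dots> = 2 ^ card A * ((1 + x) / 2) ^ card N"
    using card_mono[OF assms] by (simp add: power_diff power_divide)
  finally show ?thesis .
qed

text \<open>Nested random subsets of \<open>R\<close>, the sparsest one first.\<close>

primrec levels :: "'a set \<Rightarrow> 'a set list \<Rightarrow> 'a set list" where
  "levels R [] = [R]"
| "levels R (C # Cs) = levels (R \<inter> C) Cs @ [R]"

lemma length_levels [simp]: "length (levels R Cs) = length Cs + 1"
  by (induction Cs arbitrary: R) auto

lemma Union_levels [simp]: "\<Union> (set (levels R Cs)) = R"
  by (induction Cs arbitrary: R) auto

text \<open>A solution of the recursion for expected weights. The summand 2(1 - 2^-e) is reproduced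
  by one more halving, with the new term for rows without survivors included. The other summand is
  \<open>row_weight e\<close> at n = 0, and each halving halves the excess of its base over
  1.\<close>

definition level_bound :: "nat \<Rightarrow> nat \<Rightarrow> real" where
  "level_bound n e = 2 * (1 - (1/2) ^ e) + 2 * ((1 + (1/2) ^ (n + 1)) ^ e - 1)"

text \<open>For e at most 2^n the power in the second summand is at most exp(1/2). With enough
  levels the expected weight per row is therefore a constant, whatever the number of
  neighbours.\<close>

lemma level_bound_le_4:
  assumes "e \<le> 2 ^ n"
  shows "level_bound n e \<le> 4"
proof -
  have "(1 + (1/2 :: real) ^ (n + 1)) ^ e \<le> exp ((1/2) ^ (n + 1)) ^ e"
    by (intro power_mono) auto
  also have "\<dots> = exp (real e * (1/2) ^ (n + 1))" by (simp only: exp_of_nat_mult)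
  also have "\<dots> \<le> exp (1/2)"
  proof -
    have "real e \<le> 2 ^ n" using of_nat_mono[OF assms, where 'a = real] by simp
    then have "real e * (1/2) ^ (n + 1) \<le> 2 ^ n * (1/2) ^ (n + 1)" by (intro mult_right_mono) auto
    also have "\<dots> = 1/2" by (simp add: power_divide)
    finally show ?thesis by simp
  qed
  also have "exp (1/2 :: real) \<le> 2"
  proof (rule power2_le_imp_le)
    have "(exp (1/2 :: real))\<^sup>2 = exp 1" by (simp flip: exp_of_nat_mult)
    then show "(exp (1/2 :: real))\<^sup>2 \<le> 2\<^sup>2" using exp_le by simp
  qed simp
  finally have "(1 + (1/2 :: real) ^ (n + 1)) ^ e \<le> 2" .
  moreover have "(0::real) \<le> (1/2) ^ e" by simp
  moreover have "2 * (1 - a) + 2 * (b - 1) \<le> 4" if "b \<le> 2" "0 \<le> a" for a b :: real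
    using that by (simp add: algebra_simps)
  ultimately show ?thesis unfolding level_bound_def by blast
qed

text \<open>
  If \<open>E\<close> of \<open>e\<close> elements survive in a random subset, then the expectation of \<open>2 ^ -E\<close> is \<open>(3/4) ^ e\<close>,
  which makes the expected row weights telescope.
\<close>

lemma sum_level_bound:
  assumes "finite A" "N \<subseteq> A"
  shows "(\<Sum>C\<in>Pow A. level_bound n (card (N \<inter> C)) + (if N \<inter> C = {} then row_weight (card N) else 0)) =
    2 ^ card A * level_bound (Suc n) (card N)"
proof -
  let ?e = "card N"
  have fin: "finite N" using assms finite_subset by blast
  have 0: "(if N \<inter> C = {} then row_weight ?e else 0) = row_weight ?e * 0 ^ card (N \<inter> C)" for C
    using fin by (simp add: card_gt_0_iff)
  have "(\<Sum>C\<in>Pow A. level_bound n (card (N \<inter> C)) + (if N \<inter> C = {} then row_weight ?e else 0)) =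
     (\<Sum>C\<in>Pow A. 2 * (1 + (1/2) ^ (n + 1)) ^ card (N \<inter> C) - 2 * (1/2) ^ card (N \<inter> C) + row_weight ?e * 0 ^ card (N \<inter> C))"
    unfolding 0 level_bound_def by (intro sum.cong refl) (simp add: algebra_simps)
  also have "\<dots> = 2 * (\<Sum>C\<in>Pow A. (1 + (1/2) ^ (n + 1)) ^ card (N \<inter> C)) - 2 * (\<Sum>C\<in>Pow A. (1/2) ^ card (N \<inter> C))
      + row_weight ?e * (\<Sum>C\<in>Pow A. 0 ^ card (N \<inter> C))"
    by (simp add: sum.distrib sum_subtractf sum_distrib_left)
  also have "\<dots> = 2 ^ card A * (2 * ((1 + (1 + (1/2) ^ (n + 1))) / 2) ^ ?e - 2 * (3/4) ^ ?e + row_weight ?e * (1/2) ^ ?e)"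
    unfolding sum_power_card_Int[OF assms] by (simp add: algebra_simps)
  also have "row_weight ?e * (1/2) ^ ?e = 2 * (3/4) ^ ?e - 2 * (1/2) ^ ?e"
  proof -
    have "(3/2 :: real) ^ ?e * (1/2) ^ ?e = (3/4) ^ ?e" by (simp flip: power_mult_distrib)
    then show ?thesis by (simp add: row_weight_def algebra_simps)
  qed
  also have "(1 + (1 + (1/2 :: real) ^ (n + 1))) / 2 = 1 + (1/2) ^ (Suc n + 1)" by (simp add: field_simps)
  finally show ?thesis by (simp add: level_bound_def algebra_simps)
qed

section \<open>Sweeping the levels from the sparsest to the densest\<close>

context bounded_cut_round
begin

primrec total_weight :: "'i \<Rightarrow> 'v set set \<Rightarrow> 'v set list \<Rightarrow> real" where
  "total_weight i U [] = 0"
| "total_weight i U (R # Rs) = weight i U R + total_weight i {C \<in> U. nbrs i C \<inter> R = {}} Rs"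

lemma total_weight_nonneg: "total_weight i U Rs \<ge> 0"
  by (induction Rs arbitrary: U) (auto intro: add_nonneg_nonneg weight_nonneg)

lemma total_weight_snoc:
  "total_weight i U (Rs @ [R]) = total_weight i U Rs + weight i {C \<in> U. nbrs i C \<inter> \<Union> (set Rs) = {}} R"
proof (induction Rs arbitrary: U)
  case (Cons R' Rs)
  have "{C \<in> {C \<in> U. nbrs i C \<inter> R' = {}}. nbrs i C \<inter> \<Union> (set Rs) = {}} = {C \<in> U. nbrs i C \<inter> \<Union> (set (R' # Rs)) = {}}"
    by auto
  then show ?case using Cons[of "{C \<in> U. nbrs i C \<inter> R' = {}}"] by simp
qed simp

lemma sum_total_weight_le:
  assumes U: "finite U"
  shows "(\<Sum>Cs | set Cs \<subseteq> Pow P \<and> length Cs = n. total_weight i U (levels R Cs)) \<le>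
    (2 ^ card P) ^ n * (\<Sum>D\<in>U. level_bound n (card (nbrs i D \<inter> R)))"
proof (induction n arbitrary: R)
  case 0
  have "row_weight e \<le> level_bound 0 e" for e
  proof -
    have "(1/2 :: real) ^ e \<le> 1" by (simp add: power_le_one)
    then show ?thesis by (simp add: row_weight_def level_bound_def)
  qed
  then have "weight i U R \<le> (\<Sum>D\<in>U. level_bound 0 (card (nbrs i D \<inter> R)))"
    unfolding weight_def by (intro sum_mono)
  moreover have "{Cs. set Cs \<subseteq> Pow P \<and> length Cs = 0} = {[]}" by auto
  ultimately show ?case by simp
next
  case (Suc n)
  let ?L = "{Cs. set Cs \<subseteq> Pow P \<and> length Cs = n}"
  let ?N = "2 ^ card P :: real"
  have cL: "real (card ?L) = ?N ^ n"
    using card_lists_length_eq[of "Pow P" n] finP by (simp add: card_Pow)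
  have fin: "finite (nbrs i D \<inter> R)" for D by (rule finite_subset_P) (auto simp: nbrs_def)
  \<comment> \<open>The head of the list separates the densest level \<open>R\<close> from the
    others, whose union is \<open>R \<inter> C\<close>; so \<open>R\<close> is charged only for
    parts without neighbours in \<open>R \<inter> C\<close>.\<close>
  have "(\<Sum>Cs | set Cs \<subseteq> Pow P \<and> length Cs = Suc n. total_weight i U (levels R Cs)) =
    (\<Sum>C\<in>Pow P. \<Sum>Cs\<in>?L. total_weight i U (levels (R \<inter> C) Cs) + weight i {D \<in> U. nbrs i D \<inter> (R \<inter> C) = {}} R)"
    using finP by (simp add: sum_lists_length_Suc total_weight_snoc)
  also have "\<dots> = (\<Sum>C\<in>Pow P. (\<Sum>Cs\<in>?L. total_weight i U (levels (R \<inter> C) Cs)) + ?N ^ n * weight i {D \<in> U. nbrs i D \<inter> (R \<inter> C) = {}} R)"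
    by (simp add: sum.distrib cL)
  also have "\<dots> \<le> (\<Sum>C\<in>Pow P. ?N ^ n * (\<Sum>D\<in>U. level_bound n (card (nbrs i D \<inter> (R \<inter> C)))) + ?N ^ n * weight i {D \<in> U. nbrs i D \<inter> (R \<inter> C) = {}} R)"
    by (intro sum_mono add_right_mono Suc.IH)
  also have "\<dots> = (\<Sum>C\<in>Pow P. ?N ^ n * (\<Sum>D\<in>U. level_bound n (card ((nbrs i D \<inter> R) \<inter> C)) +
      (if (nbrs i D \<inter> R) \<inter> C = {} then row_weight (card (nbrs i D \<inter> R)) else 0)))"
    using U by (simp add: weight_def sum.distrib distrib_left Int_assoc sum.inter_filter)
  also have "\<dots> = ?N ^ n * (\<Sum>D\<in>U. \<Sum>C\<in>Pow P. level_bound n (card ((nbrs i D \<inter> R) \<inter> C)) +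
      (if (nbrs i D \<inter> R) \<inter> C = {} then row_weight (card (nbrs i D \<inter> R)) else 0))"
    by (subst sum.swap) (simp add: sum_distrib_left)
  also have "\<dots> = ?N ^ n * (\<Sum>D\<in>U. ?N * level_bound (Suc n) (card (nbrs i D \<inter> R)))"
    by (intro arg_cong[where f = "\<lambda>x. ?N ^ n * x"] sum.cong refl sum_level_bound finP) (auto simp: nbrs_def)
  also have "\<dots> = ?N ^ Suc n * (\<Sum>D\<in>U. level_bound (Suc n) (card (nbrs i D \<inter> R)))"
    by (simp add: sum_distrib_left mult.assoc) (simp add: mult.left_commute)
  finally show ?case .
qed

text \<open>\<open>found\<close> is the end of the sweep: the parts in \<open>S\<close> have a known
  neighbour and the others have none in any level. \<open>fail\<close> is the abort: one matrix that
  is too heavy makes the total too heavy as well.\<close>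

lemma solvable_peel:
  assumes U: "finite U" "\<And>C. C \<in> U \<Longrightarrow> C \<subseteq> P" "disjoint U" "card U \<le> 2 ^ l"
    and R: "\<And>R. R \<in> set Rs \<Longrightarrow> R \<subseteq> P - \<Union> U"
    and I: "I \<subseteq> I0" and B: "\<And>i. B i \<ge> 0"
    and found: "\<And>J S s. J \<subseteq> I \<Longrightarrow> S \<subseteq> U \<Longrightarrow> (\<And>C. C \<in> S \<Longrightarrow> s C \<in> \<Union> (set Rs)) \<Longrightarrow>
      (\<And>C i. C \<in> S \<Longrightarrow> i \<in> J \<Longrightarrow> s C \<in> nbrs i C) \<Longrightarrow>
      (\<And>C i. C \<in> U - S \<Longrightarrow> i \<in> J \<Longrightarrow> nbrs i C \<inter> \<Union> (set Rs) = {}) \<Longrightarrow> solvable J B"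
    and fail: "\<And>J. J \<subseteq> I \<Longrightarrow> (\<And>i. i \<in> J \<Longrightarrow> total_weight i U Rs > 2 ^ (l + 6)) \<Longrightarrow> solvable J B"
  shows "solvable I (\<lambda>i. \<kappa> * (real (length Rs) * 2 ^ (l div 2) + 4 * total_weight i U Rs) + B i)"
  using assms
proof (induction Rs arbitrary: I U)
  case Nil
  have "solvable I B" by (rule Nil.prems(8)[of I "{}"]) auto
  then show ?case by simp
next
  case (Cons R Rs)
  have \<kappa>: "\<kappa> \<ge> 0" using kappa_ge by simp
  let ?U = "\<lambda>i. {C \<in> U. nbrs i C \<inter> R = {}}"
  let ?B = "\<lambda>i. \<kappa> * (real (length Rs) * 2 ^ (l div 2) + 4 * total_weight i (?U i) Rs) + B i"
  have B': "?B i \<ge> 0" and BB: "B i \<le> ?B i" for i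
    using Cons.prems(7)[of i] total_weight_nonneg[of i "?U i" Rs] \<kappa> by simp_all
  have RP: "R \<subseteq> P - \<Union> U" using Cons.prems(5) by simp
  have "solvable I (\<lambda>i. \<kappa> * (2 ^ (l div 2) + 4 * weight i U R) + ?B i)"
  proof (rule solvable_matrix_doubling[OF Cons.prems(1-4) RP Cons.prems(6) B'])
    have "solvable {i\<in>I. weight i U R > 2 ^ (l + 6)} B"
    proof (rule Cons.prems(9))
      fix i assume "i \<in> {i\<in>I. weight i U R > 2 ^ (l + 6)}"
      then show "total_weight i U (R # Rs) > 2 ^ (l + 6)"
        using total_weight_nonneg[of i "?U i" Rs] by simp
    qed auto
    then show "solvable {i\<in>I. weight i U R > 2 ^ (l + 6)} ?B" by (rule solvable_mono) (use BB in auto)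
  next
    fix i0 assume i0: "i0 \<in> I"
    let ?J = "{i\<in>I. \<forall>C\<in>U. \<forall>v\<in>R. ew i C {v} = ew i0 C {v}}"
    have nb: "nbrs i C \<inter> R = nbrs i0 C \<inter> R" if "i \<in> ?J" "C \<in> U" for i C
      using that by (auto simp: nbrs_def)
    have UU: "?U i = ?U i0" if "i \<in> ?J" for i using nb[OF that] by auto
    have "solvable ?J (\<lambda>i. \<kappa> * (real (length Rs) * 2 ^ (l div 2) + 4 * total_weight i (?U i0) Rs) + B i)"
    proof (rule Cons.IH)
      show "card (?U i0) \<le> 2 ^ l" using Cons.prems(1,4) card_mono[of U "?U i0"] by simp
      show "disjoint (?U i0)" using Cons.prems(3) by (auto simp: disjoint_def)
      show "R' \<subseteq> P - \<Union> (?U i0)" if "R' \<in> set Rs" for R' using Cons.prems(5)[of R'] that by auto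
      show "solvable J B" if J: "J \<subseteq> ?J" and tot: "\<And>i. i \<in> J \<Longrightarrow> 2 ^ (l + 6) < total_weight i (?U i0) Rs" for J
      proof (rule Cons.prems(9))
        fix i assume i: "i \<in> J"
        then have "?U i = ?U i0" using UU J by blast
        then show "2 ^ (l + 6) < total_weight i U (R # Rs)"
          using tot[OF i] weight_nonneg[of i U R] by simp
      qed (use J in auto)
      show "solvable J B" if J: "J \<subseteq> ?J" and S: "S \<subseteq> ?U i0" and s: "\<And>C. C \<in> S \<Longrightarrow> s C \<in> \<Union> (set Rs)"
        "\<And>C i. C \<in> S \<Longrightarrow> i \<in> J \<Longrightarrow> s C \<in> nbrs i C"
        and rest: "\<And>C i. C \<in> ?U i0 - S \<Longrightarrow> i \<in> J \<Longrightarrow> nbrs i C \<inter> \<Union> (set Rs) = {}" for J S s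
      proof -
        \<comment> \<open>A neighbour picked from the matrix of \<open>i0\<close> serves every input
          of \<open>?J\<close>, since they all share that matrix.\<close>
        define s' where "s' = (\<lambda>C. if C \<in> S then s C else (SOME v. v \<in> nbrs i0 C \<inter> R))"
        have new: "s' C \<in> nbrs i0 C \<inter> R" if "C \<in> U - ?U i0" for C
          using that S some_in_eq[of "nbrs i0 C \<inter> R"] by (auto simp: s'_def)
        show ?thesis
        proof (rule Cons.prems(8)[of J "S \<union> (U - ?U i0)" s'])
          fix C assume C: "C \<in> S \<union> (U - ?U i0)"
          show "s' C \<in> \<Union> (set (R # Rs))"
          proof (cases "C \<in> S")
            case True then show ?thesis using s(1) by (auto simp: s'_def)
          next
            case False then show ?thesis using new[of C] C by auto
          qed
          fix i assume i: "i \<in> J"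
          show "s' C \<in> nbrs i C"
          proof (cases "C \<in> S")
            case True then show ?thesis using s(2) i by (auto simp: s'_def)
          next
            case False
            then have "C \<in> U - ?U i0" using C by blast
            moreover from this have "nbrs i C \<inter> R = nbrs i0 C \<inter> R" using nb[of i C] i J by blast
            ultimately show ?thesis using new[of C] by blast
          qed
        next
          fix C i assume C: "C \<in> U - (S \<union> (U - ?U i0))" and i: "i \<in> J"
          then have "nbrs i C \<inter> \<Union> (set Rs) = {}" using rest[of C i] by blast
          moreover have "nbrs i C \<inter> R = {}" using nb[of i C] i J C by blast
          ultimately show "nbrs i C \<inter> \<Union> (set (R # Rs)) = {}" by auto
        qed (use J S in auto)
      qed
    qed (use Cons.prems in auto)
    then show "solvable ?J ?B"
    proof (rule solvable_mono)
      fix i assume "i \<in> ?J"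
      then have "?U i = ?U i0" by (rule UU)
      then show "\<kappa> * (real (length Rs) * 2 ^ (l div 2) + 4 * total_weight i (?U i0) Rs) + B i \<le> ?B i"
        by simp
    qed simp
  qed
  then show ?case by (rule solvable_mono) (auto simp: algebra_simps)
qed

end

section \<open>Expected progress of a phase\<close>

lemma card_subsets_containing_avoiding:
  assumes "finite U" "C \<in> U" "D \<in> U" "C \<noteq> D"
  shows "4 * card {L \<in> Pow U. C \<in> L \<and> D \<notin> L} = 2 ^ card U"
proof -
  have "{L \<in> Pow U. C \<in> L \<and> D \<notin> L} = insert C ` Pow (U - {C, D})"
  proof (intro set_eqI iffI)
    fix L assume "L \<in> {L \<in> Pow U. C \<in> L \<and> D \<notin> L}"
    then have "L = insert C (L - {C})" "L - {C} \<in> Pow (U - {C, D})" by auto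
    then show "L \<in> insert C ` Pow (U - {C, D})" by blast
  qed (use assms in auto)
  moreover have "inj_on (insert C) (Pow (U - {C, D}))" by (auto simp: inj_on_def)
  ultimately have "card {L \<in> Pow U. C \<in> L \<and> D \<notin> L} = 2 ^ card (U - {C, D})"
    using assms by (simp add: card_image card_Pow)
  moreover have "card U = card (U - {C, D}) + 2"
  proof -
    have "card (U - {C, D}) = card U - 2" using assms by (subst card_Diff_subset) auto
    moreover have "card U \<ge> 2" using assms card_mono[of U "{C, D}"] by auto
    ultimately show ?thesis by simp
  qed
  ultimately show ?thesis by simp
qed

lemma log2_le: "log 2 x \<le> 2 * x" if "x > 0"
proof (cases "log 2 x \<le> 0")
  case True
  then show ?thesis using that by linarith
next
  case False
  then have "log 2 x * (1/2) \<le> log 2 x * ln 2"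
    using ln2_ge_two_thirds by (intro mult_left_mono) auto
  moreover have "log 2 x * ln 2 = ln x" by (simp add: log_def)
  moreover have "ln x \<le> x" using ln_bound[OF that] .
  ultimately show ?thesis by linarith
qed

text \<open>This replaces the logarithm by a linear bound with parameter \<mu>, as log n = log
  (n/\<mu>) + log \<mu>. Summed over parts of total size at most \<open>2 ^ l\<close>, it yields
  multiples of \<open>\<mu> * card U\<close> and \<open>2 ^ l / \<mu>\<close>, the two terms of the
  potential.\<close>

lemma exists_power_bound:
  fixes \<mu> :: real and n :: nat
  assumes "\<mu> \<ge> 1"
  shows "\<exists>k. n \<le> 2 ^ k \<and> real k \<le> 1 + 2 * \<mu> + 2 * (n / \<mu>)"
proof (cases "n = 0")
  case True
  then show ?thesis using assms by (intro exI[of _ 0]) simp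
next
  case False
  let ?k = "nat \<lceil>log 2 n\<rceil>"
  have l0: "log 2 n \<ge> 0" using False by simp
  have "real n = 2 powr (log 2 n)" using False by simp
  also have "\<dots> \<le> 2 powr (real ?k)" by (intro powr_mono) (auto intro: real_nat_ceiling_ge)
  also have "\<dots> = real (2 ^ ?k)" by (simp add: powr_realpow)
  finally have "n \<le> 2 ^ ?k" by (simp only: of_nat_le_iff)
  moreover have "real ?k \<le> log 2 n + 1" using l0 by linarith
  moreover have "log 2 n = log 2 (n / \<mu>) + log 2 \<mu>" using False assms by (simp add: log_divide)
  moreover have "log 2 (n / \<mu>) \<le> 2 * (n / \<mu>)" using False assms by (intro log2_le) simp
  moreover have "log 2 \<mu> \<le> 2 * \<mu>" using assms by (intro log2_le) simp
  ultimately show ?thesis by (intro exI[of _ ?k]) linarith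
qed

context bounded_cut_round
begin

definition num_found :: "'i \<Rightarrow> 'v set set \<Rightarrow> nat" where
  "num_found i L = card {C \<in> L. nbrs i C \<inter> (P - \<Union> L) \<noteq> {}}"

text \<open>An edge leaving an active part ends in another active part \<open>D\<close>, since
  finished parts have no outgoing edges. With probability 1/4 the part is on the left and
  \<open>D\<close> is not.\<close>

lemma sum_num_found_ge:
  assumes st: "state I \<C> F U" and i: "i \<in> I" and active: "\<And>C. C \<in> U \<Longrightarrow> ew i C (P - C) > 0"
  shows "(\<Sum>L\<in>Pow U. real (num_found i L)) \<ge> 2 ^ card U * (card U / 4)"
proof -
  note fin = state_finite[OF st]
  have p: "partition_on P \<C>" and UC: "U \<subseteq> \<C>" and i0: "i \<in> I0" using st i by (auto simp: state_def)
  have disj: "A \<inter> A' = {}" if "A \<in> \<C>" "A' \<in> \<C>" "A \<noteq> A'" for A A'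
    using p that by (auto simp: partition_on_def disjoint_def)
  have quarter: "2 ^ card U \<le> 4 * card {L \<in> Pow U. C \<in> L \<and> nbrs i C \<inter> (P - \<Union> L) \<noteq> {}}" if C: "C \<in> U" for C
  proof -
    have CP: "C \<subseteq> P" using C UC fin(3) by blast
    obtain x y where xy: "x \<in> C" "y \<in> P - C" "w i x y > 0"
      using active[OF C] ew_pos_iff[of C "P - C" i] CP by auto
    obtain D where D: "D \<in> \<C>" "y \<in> D" using p xy by (auto simp: partition_on_def)
    have DU: "D \<in> U"
    proof (rule ccontr)
      assume "D \<notin> U"
      then have "ew i D (P - D) = 0" using st D i by (auto simp: state_def)
      moreover have "x \<in> P - D" using disj[of C D] xy D C UC CP by blast
      moreover have "w i y x > 0" using xy w_sym[OF i0] by simp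
      ultimately show False using ew_pos_iff[of D "P - D" i] D fin(3)[OF D(1)] by auto
    qed
    have "y \<in> nbrs i C" using xy ew_pos_iff[of C "{y}" i] CP by (auto simp: nbrs_def)
    moreover have "y \<notin> \<Union> L" if "L \<subseteq> U" "D \<notin> L" for L
    proof
      assume "y \<in> \<Union> L"
      then obtain A where "A \<in> L" "y \<in> A" by blast
      then show False using disj[of A D] that UC D by blast
    qed
    ultimately have "{L \<in> Pow U. C \<in> L \<and> D \<notin> L} \<subseteq> {L \<in> Pow U. C \<in> L \<and> nbrs i C \<inter> (P - \<Union> L) \<noteq> {}}"
      using xy by auto
    then have "card {L \<in> Pow U. C \<in> L \<and> D \<notin> L} \<le> card {L \<in> Pow U. C \<in> L \<and> nbrs i C \<inter> (P - \<Union> L) \<noteq> {}}"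
      using fin(2) by (intro card_mono) auto
    moreover have "C \<noteq> D" using xy D by auto
    ultimately show ?thesis using card_subsets_containing_avoiding[OF fin(2) C DU] by linarith
  qed
  have "2 ^ card U * (card U / 4) = (\<Sum>C\<in>U. 2 ^ card U / (4 :: real))" by simp
  also have "\<dots> \<le> (\<Sum>C\<in>U. real (card {L \<in> Pow U. C \<in> L \<and> nbrs i C \<inter> (P - \<Union> L) \<noteq> {}}))"
  proof (intro sum_mono)
    fix C assume "C \<in> U"
    from of_nat_mono[OF quarter[OF this], where 'a = real]
    show "2 ^ card U / (4 :: real) \<le> real (card {L \<in> Pow U. C \<in> L \<and> nbrs i C \<inter> (P - \<Union> L) \<noteq> {}})" by simp
  qed
  also have "\<dots> = (\<Sum>C\<in>U. \<Sum>L\<in>{L\<in>Pow U. C \<in> L \<and> nbrs i C \<inter> (P - \<Union> L) \<noteq> {}}. 1)" by simp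
  also have "\<dots> = (\<Sum>L\<in>Pow U. \<Sum>C\<in>{C\<in>U. C \<in> L \<and> nbrs i C \<inter> (P - \<Union> L) \<noteq> {}}. 1)"
    using fin(2) by (intro sum.swap_restrict) auto
  also have "\<dots> = (\<Sum>L\<in>Pow U. real (num_found i L))"
  proof (intro sum.cong refl)
    fix L assume "L \<in> Pow U"
    then have "{C\<in>U. C \<in> L \<and> nbrs i C \<inter> (P - \<Union> L) \<noteq> {}} = {C \<in> L. nbrs i C \<inter> (P - \<Union> L) \<noteq> {}}" by blast
    then show "(\<Sum>C\<in>{C\<in>U. C \<in> L \<and> nbrs i C \<inter> (P - \<Union> L) \<noteq> {}}. 1) = real (num_found i L)"
      by (simp add: num_found_def)
  qed
  finally show ?thesis .
qed

text \<open>The factor 13/16 is 1 - 1/4 + 1/16. On average at least a quarter of the active parts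
  find a neighbour. The expected total weight is at most 4 per active part, so by Markov's
  inequality the abort beyond \<open>2 ^ (l + 6)\<close> has probability at most 1/16. The same 4,
  times the factor 4 of the doubling search, gives 16.\<close>

lemma solvable_phase:
  fixes t1 t0 :: real
  assumes st: "state I \<C> F U" and active: "\<And>C i. C \<in> U \<Longrightarrow> i \<in> I \<Longrightarrow> ew i C (P - C) > 0"
    and k: "\<And>C. C \<in> U \<Longrightarrow> card C \<le> 2 ^ k C"
    and t: "t1 \<ge> 0" "t0 \<ge> 0" and B: "\<And>i. B i \<ge> 0"
    and cont: "\<And>J \<C>' F' U'. J \<subseteq> I \<Longrightarrow> state J \<C>' F' U' \<Longrightarrow> solvable J (\<lambda>i. t1 * real (card U') + t0 + B i)"
  shows "solvable I (\<lambda>i. \<kappa> * (real (l + 1) * 2 ^ (l div 2) + 16 * real (card U)) +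
    (\<Sum>C\<in>U. 3 * real (k C)) + t1 * (13 / 16 * real (card U)) + t0 + B i)"
proof -
  note fin = state_finite[OF st]
  have p: "partition_on P \<C>" and UC: "U \<subseteq> \<C>" and IO: "I \<subseteq> I0" using st by (auto simp: state_def)
  have \<kappa>: "\<kappa> \<ge> 0" using kappa_ge by simp
  let ?c = "real (card U)" and ?K = "\<Sum>C\<in>U. 3 * real (k C)"
  let ?O = "{Cs. set Cs \<subseteq> Pow P \<and> length Cs = l}"
  define tot where "tot i L Cs = total_weight i L (levels (P - \<Union> L) Cs)" for i L Cs
  have tot0: "tot i L Cs \<ge> 0" for i L Cs unfolding tot_def by (rule total_weight_nonneg)
  have cU: "?c \<le> 2 ^ l"
  proof -
    have "card U \<le> 2 ^ l" using card_mono[OF fin(1) UC] fin(4) card_P by linarith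
    from of_nat_mono[OF this, where 'a = real] show ?thesis by simp
  qed
  have found_le: "real (num_found i L) \<le> ?c" if "L \<in> Pow U" for i L
  proof -
    have "num_found i L \<le> card U" unfolding num_found_def
      using that fin(2) by (intro card_mono) auto
    then show ?thesis by simp
  qed
  have K0: "?K \<ge> 0" by (intro sum_nonneg) auto
  \<comment> \<open>The term with \<open>tot\<close> pays for an abort, which leaves all parts
    active: the quotient by \<open>2 ^ (l + 6)\<close> is above 1 in that case and never negative,
    and being linear in \<open>tot\<close> it can be averaged.\<close>
  define B1 where "B1 L Cs i = ?K + (t1 * (?c - num_found i L + ?c * tot i L Cs / 2 ^ (l + 6)) + t0 + B i)" for L Cs i
  have B1: "B1 L Cs i \<ge> 0" if "L \<in> Pow U" for L Cs i
    unfolding B1_def using K0 t B found_le[OF that] tot0 by (intro add_nonneg_nonneg mult_nonneg_nonneg) auto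
  define B2 where "B2 L Cs i = \<kappa> * (real (l + 1) * 2 ^ (l div 2) + 4 * tot i L Cs) + B1 L Cs i" for L Cs i
  have B2: "B2 L Cs i \<ge> 0" if "L \<in> Pow U" for L Cs i
    unfolding B2_def using B1[OF that] \<kappa> tot0 by (intro add_nonneg_nonneg mult_nonneg_nonneg) auto
  have inner: "solvable I (B2 L Cs)" if L: "L \<in> Pow U" and Cs: "Cs \<in> ?O" for L Cs
  proof -
    let ?Rs = "levels (P - \<Union> L) Cs"
    have LU: "L \<subseteq> U" using L by simp
    have "solvable I (\<lambda>i. \<kappa> * (real (length ?Rs) * 2 ^ (l div 2) + 4 * total_weight i L ?Rs) + max 0 (B1 L Cs i))"
    proof (rule solvable_peel)
      show "finite L" using LU fin(2) finite_subset by blast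
      show "C \<subseteq> P" if "C \<in> L" for C using that LU UC fin(3) by blast
      show "disjoint L" using p LU UC by (auto simp: partition_on_def intro: pairwise_subset)
      have "real (card L) \<le> 2 ^ l" using cU card_mono[OF fin(2) LU] by linarith
      then show "card L \<le> 2 ^ l" using of_nat_le_iff[of "card L" "2 ^ l", where 'a = real] by simp
      show "R \<subseteq> P - \<Union> L" if "R \<in> set ?Rs" for R
        using that Union_levels[of "P - \<Union> L" Cs] by blast
    next
      fix J S s assume J: "J \<subseteq> I" and S: "S \<subseteq> L" and s: "\<And>C. C \<in> S \<Longrightarrow> s C \<in> \<Union> (set ?Rs)"
        "\<And>C i. C \<in> S \<Longrightarrow> i \<in> J \<Longrightarrow> s C \<in> nbrs i C"
        and rest: "\<And>C i. C \<in> L - S \<Longrightarrow> i \<in> J \<Longrightarrow> nbrs i C \<inter> \<Union> (set ?Rs) = {}"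
      have sP: "s C \<in> P - \<Union> L" if "C \<in> S" for C using s(1)[OF that] by simp
      have found: "num_found i L = card S" if "i \<in> J" for i
      proof -
        have "{C \<in> L. nbrs i C \<inter> (P - \<Union> L) \<noteq> {}} = S"
        proof (intro set_eqI iffI)
          fix C assume C: "C \<in> {C \<in> L. nbrs i C \<inter> (P - \<Union> L) \<noteq> {}}"
          show "C \<in> S"
          proof (rule ccontr)
            assume "C \<notin> S"
            then have "nbrs i C \<inter> \<Union> (set ?Rs) = {}" using rest[of C i] C that by blast
            with C show False by simp
          qed
        next
          fix C assume C: "C \<in> S"
          then have "s C \<in> nbrs i C \<inter> (P - \<Union> L)" using s(2)[OF C that] sP[OF C] by blast
          with C S show "C \<in> {C \<in> L. nbrs i C \<inter> (P - \<Union> L) \<noteq> {}}" by blast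
        qed
        then show ?thesis by (simp add: num_found_def)
      qed
      have SU: "S \<subseteq> U" using S LU by blast
      have "solvable J (\<lambda>i. (\<Sum>C\<in>S. 3 * real (k C)) + (t1 * (?c - card S) + t0 + B i))"
      proof (rule solvable_merges[where s = s, OF state_subset[OF st J] SU])
        show "s C \<in> P - \<Union> S" if "C \<in> S" for C using sP[OF that] S by blast
        show "ew i C {s C} > 0" if "C \<in> S" "i \<in> J" for C i using s(2)[OF that] by (simp add: nbrs_def)
        have "real (card S) \<le> ?c" using card_mono[OF fin(2) SU] by simp
        then show "t1 * (?c - card S) + t0 + B i \<ge> 0" for i
          using t B[of i] by (intro add_nonneg_nonneg mult_nonneg_nonneg) auto
        fix J' \<C>' F' U' assume J': "J' \<subseteq> J" "state J' \<C>' F' U'" "card U' + card S \<le> card U"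
        have "J' \<subseteq> I" using J' J by blast
        from cont[OF this J'(2)] show "solvable J' (\<lambda>i. t1 * (?c - card S) + t0 + B i)"
        proof (rule solvable_mono)
          fix i
          have "real (card U') \<le> ?c - card S" using J'(3) by linarith
          then have "t1 * real (card U') \<le> t1 * (?c - card S)" by (intro mult_left_mono t)
          then show "t1 * real (card U') + t0 + B i \<le> t1 * (?c - card S) + t0 + B i" by simp
        qed simp
      qed (use k SU in auto)
      then show "solvable J (\<lambda>i. max 0 (B1 L Cs i))"
      proof (rule solvable_mono)
        fix i assume i: "i \<in> J"
        have "(\<Sum>C\<in>S. 3 * real (k C)) \<le> ?K" using SU fin(2) by (intro sum_mono2) auto
        moreover have "t1 * (?c - card S) \<le> t1 * (?c - num_found i L + ?c * tot i L Cs / 2 ^ (l + 6))"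
          using found[OF i] tot0[of i L Cs] by (intro mult_left_mono t) auto
        ultimately show "(\<Sum>C\<in>S. 3 * real (k C)) + (t1 * (?c - card S) + t0 + B i) \<le> max 0 (B1 L Cs i)"
          unfolding B1_def by linarith
      qed simp
    next
      fix J assume J: "J \<subseteq> I" and big: "\<And>i. i \<in> J \<Longrightarrow> total_weight i L ?Rs > 2 ^ (l + 6)"
      from cont[OF J state_subset[OF st J]] show "solvable J (\<lambda>i. max 0 (B1 L Cs i))"
      proof (rule solvable_mono)
        fix i assume i: "i \<in> J"
        have "2 ^ (l + 6) \<le> tot i L Cs" using big[OF i] by (simp add: tot_def)
        then have "?c * 2 ^ (l + 6) \<le> ?c * tot i L Cs" by (intro mult_left_mono) auto
        then have "?c \<le> ?c * tot i L Cs / 2 ^ (l + 6)" by (simp add: pos_le_divide_eq)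
        then have "t1 * ?c \<le> t1 * (?c - num_found i L + ?c * tot i L Cs / 2 ^ (l + 6))"
          using found_le[OF L, of i] by (intro mult_left_mono t) linarith
        then show "t1 * ?c + t0 + B i \<le> max 0 (B1 L Cs i)" using K0 unfolding B1_def by linarith
      qed simp
    qed (use IO in auto)
    then show ?thesis
      by (rule solvable_mono) (use Cs B1[OF L, of Cs] in \<open>auto simp: B2_def tot_def max_absorb2\<close>)
  qed
  have cO: "real (card ?O) = (2 ^ card P) ^ l"
    using card_lists_length_eq[of "Pow P" l] finP by (simp add: card_Pow)
  define B3 where "B3 L i = \<kappa> * (real (l + 1) * 2 ^ (l div 2) + 16 * ?c) + ?K + (t1 * (?c - num_found i L + ?c / 16) + t0 + B i)" for L i
  have B3: "B3 L i \<ge> 0" if "L \<in> Pow U" for L i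
    unfolding B3_def using K0 t B found_le[OF that] \<kappa> by (intro add_nonneg_nonneg mult_nonneg_nonneg) auto
  have mid: "solvable I (B3 L)" if L: "L \<in> Pow U" for L
  proof -
    have LU: "L \<subseteq> U" using L by simp
    have finO: "finite ?O" using finite_lists_length_eq[of "Pow P" l] finP by simp
    have "replicate l {} \<in> ?O" by auto
    then have neO: "?O \<noteq> {}" by blast
    have "solvable I (\<lambda>i. (\<Sum>Cs\<in>?O. B2 L Cs i) / card ?O)"
      by (rule solvable_sample[OF finO neO]) (use B2 inner L in auto)
    then show ?thesis
    proof (rule solvable_mono)
      fix i
      let ?T = "\<Sum>Cs\<in>?O. tot i L Cs" and ?n = "real (card ?O)"
      have n0: "?n > 0" using finO neO by (simp add: card_gt_0_iff)
      have "?T \<le> ?n * (\<Sum>D\<in>L. level_bound l (card (nbrs i D \<inter> (P - \<Union> L))))"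
        unfolding tot_def cO by (rule sum_total_weight_le) (use LU fin(2) finite_subset in blast)
      also have "\<dots> \<le> ?n * (\<Sum>D\<in>L. 4)"
      proof (intro mult_left_mono sum_mono level_bound_le_4)
        fix D
        have "card (nbrs i D \<inter> (P - \<Union> L)) \<le> card P" by (rule card_mono[OF finP]) auto
        then show "card (nbrs i D \<inter> (P - \<Union> L)) \<le> 2 ^ l" using card_P by linarith
      qed auto
      also have "\<dots> \<le> ?n * (4 * ?c)" using card_mono[OF fin(2) LU] by (intro mult_left_mono) auto
      finally have T: "?T / ?n \<le> 4 * ?c" using n0 by (simp add: pos_divide_le_eq mult.commute)
      define a where "a = 4 * \<kappa> + t1 * ?c / 2 ^ (l + 6)"
      define d where "d = \<kappa> * (real (l + 1) * 2 ^ (l div 2)) + ?K + t1 * (?c - num_found i L) + t0 + B i"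
      have a0: "a \<ge> 0" unfolding a_def using \<kappa> t by simp
      have "B2 L Cs i = a * tot i L Cs + d" for Cs
        unfolding B2_def B1_def a_def d_def by (simp add: algebra_simps)
      then have "(\<Sum>Cs\<in>?O. B2 L Cs i) / ?n = a * (?T / ?n) + d"
        using n0 by (simp add: sum.distrib sum_distrib_left add_divide_distrib)
      also have "\<dots> \<le> a * (4 * ?c) + d" using T a0 by (intro add_right_mono mult_left_mono)
      also have "\<dots> = 16 * \<kappa> * ?c + t1 * (4 * ?c * ?c / 2 ^ (l + 6)) + d"
        by (simp add: a_def algebra_simps)
      also have "t1 * (4 * ?c * ?c / 2 ^ (l + 6)) \<le> t1 * (?c / 16)"
      proof (intro mult_left_mono t)
        have "?c * ?c \<le> ?c * 2 ^ l" using cU by (intro mult_left_mono) auto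
        then show "4 * ?c * ?c / 2 ^ (l + 6) \<le> ?c / 16" by (simp add: power_add field_simps)
      qed
      finally show "(\<Sum>Cs\<in>?O. B2 L Cs i) / ?n \<le> B3 L i"
        unfolding B3_def d_def by (simp add: algebra_simps)
    qed simp
  qed
  have "solvable I (\<lambda>i. (\<Sum>L\<in>Pow U. B3 L i) / card (Pow U))"
    by (rule solvable_sample) (use fin(2) B3 mid in auto)
  then show ?thesis
  proof (rule solvable_mono)
    fix i assume i: "i \<in> I"
    let ?n = "2 ^ card U :: real" and ?T = "\<Sum>L\<in>Pow U. real (num_found i L)"
    define d where "d = \<kappa> * (real (l + 1) * 2 ^ (l div 2) + 16 * ?c) + ?K + t1 * (17 / 16 * ?c) + t0 + B i"
    have "B3 L i = d - t1 * num_found i L" for L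
      unfolding B3_def d_def by (simp add: algebra_simps)
    then have "(\<Sum>L\<in>Pow U. B3 L i) / card (Pow U) = d - t1 * (?T / ?n)"
      using fin(2) by (simp add: sum_subtractf sum_distrib_left card_Pow diff_divide_distrib)
    also have "?T / ?n \<ge> ?c / 4"
      using sum_num_found_ge[OF st i active[OF _ i]] by (simp add: pos_le_divide_eq mult.commute)
    then have "d - t1 * (?T / ?n) \<le> d - t1 * (?c / 4)"
      using t by (intro diff_left_mono mult_left_mono) auto
    also have "\<dots> = \<kappa> * (real (l + 1) * 2 ^ (l div 2) + 16 * ?c) + ?K + t1 * (13 / 16 * ?c) + t0 + B i"
      unfolding d_def by (simp add: algebra_simps)
    finally show "(\<Sum>L\<in>Pow U. B3 L i) / card (Pow U) \<le>
      \<kappa> * (real (l + 1) * 2 ^ (l div 2) + 16 * ?c) + ?K + t1 * (13 / 16 * ?c) + t0 + B i" .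
  qed simp
qed

end

section \<open>The cost of a spanning forest\<close>

context bounded_cut_round
begin

text \<open>Each of the \<open>l + 1\<close> levels pays for its smallest threshold
  \<open>2 ^ (l div 2)\<close> even if its matrix is empty. As long as \<mu> is at most
  \<open>l\<close>, this is absorbed by the second term of the potential.\<close>

lemma level_overhead:
  assumes "0 < \<mu>" "\<mu> \<le> real l"
  shows "real (l + 1) * 2 ^ (l div 2) \<le> 2 ^ l / \<mu>"
proof -
  have "(l + 1) * l \<le> 2 * l\<^sup>2 * 1" using l by (simp add: power2_eq_square)
  also have "\<dots> \<le> 2 * l\<^sup>2 * 2 ^ (l div 8)" by (intro mult_left_mono) auto
  also have "\<dots> \<le> 2 ^ (l div 2)" by (rule square_times_power_le[OF l])
  finally have "(l + 1) * l * 2 ^ (l div 2) \<le> 2 ^ (l div 2) * 2 ^ (l div 2)" by (rule mult_right_mono) simp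
  also have "\<dots> = 2 ^ (l div 2 + l div 2)" by (simp only: power_add)
  also have "\<dots> \<le> 2 ^ l" by (intro power_increasing) auto
  finally have "real ((l + 1) * l * 2 ^ (l div 2)) \<le> real (2 ^ l)" by (rule of_nat_mono)
  then have "real (l + 1) * 2 ^ (l div 2) * real l \<le> 2 ^ l" by (simp add: algebra_simps)
  moreover have "real (l + 1) * 2 ^ (l div 2) * \<mu> \<le> real (l + 1) * 2 ^ (l div 2) * real l"
    using assms by (intro mult_left_mono) auto
  ultimately have "real (l + 1) * 2 ^ (l div 2) * \<mu> \<le> 2 ^ l" by linarith
  then show ?thesis by (subst pos_le_divide_eq[OF assms(1)])
qed

lemma sum_card_parts_le:
  assumes "state I \<C> F U"
  shows "(\<Sum>C\<in>U. card C) \<le> card P"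
proof -
  have p: "partition_on P \<C>" and UC: "U \<subseteq> \<C>" using assms by (auto simp: state_def)
  have "card (\<Union> U) = (\<Sum>C\<in>U. card C)"
  proof (rule card_Union_disjoint)
    show "pairwise disjnt U" using p UC by (auto simp: partition_on_def intro: pairwise_subset)
    show "finite C" if "C \<in> U" for C using that UC state_finite(3)[OF assms] finite_subset_P by blast
  qed
  moreover have "card (\<Union> U) \<le> card P"
    using UC state_finite(3)[OF assms] by (intro card_mono[OF finP]) auto
  ultimately show ?thesis by simp
qed

text \<open>Once \<mu> reaches \<open>l\<close>, the cost 3 + 6l of plain binary search is at most
  9\<mu> per active part and fits into the potential.\<close>

lemma solvable_boruvka_last:
  assumes B: "\<And>i. B i \<ge> 0"
    and final: "\<And>J F. J \<subseteq> I0 \<Longrightarrow> (\<And>i. i \<in> J \<Longrightarrow> spanning i F) \<Longrightarrow> solvable J B"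
    and st: "state I \<C> F U" and mu: "1 \<le> \<mu>" "real l \<le> \<mu>"
  shows "solvable I (\<lambda>i. 256 * \<kappa> * (\<mu> * real (card U) + 2 ^ l / \<mu>) + B i)"
  using solvable_fallback[OF card_P B final st]
proof (rule solvable_mono)
  fix i
  have "real (card U) * (3 + 6 * real l) \<le> real (card U) * (9 * \<mu>)"
    using mu by (intro mult_left_mono) auto
  also have "\<dots> = 9 * (\<mu> * real (card U) + 0)" by simp
  also have "\<dots> \<le> 256 * \<kappa> * (\<mu> * real (card U) + 2 ^ l / \<mu>)"
    using kappa_ge mu by (intro mult_mono add_left_mono) auto
  finally show "real (card U) * (3 + 6 * real l) + B i \<le> 256 * \<kappa> * (\<mu> * real (card U) + 2 ^ l / \<mu>) + B i"
    by simp
qed simp_all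

text \<open>
  The factor \<open>\<mu>\<close> grows geometrically, but more slowly than the number of active parts decreases,
  so that both terms of the potential shrink from phase to phase.
\<close>

lemma solvable_boruvka:
  assumes B: "\<And>i. B i \<ge> 0"
    and final: "\<And>J F. J \<subseteq> I0 \<Longrightarrow> (\<And>i. i \<in> J \<Longrightarrow> spanning i F) \<Longrightarrow> solvable J B"
    and "state I \<C> F U" "1 \<le> \<mu>" "real l \<le> \<mu> * (16/15) ^ n"
  shows "solvable I (\<lambda>i. 256 * \<kappa> * (\<mu> * real (card U) + 2 ^ l / \<mu>) + B i)"
  using assms(3-5)
proof (induction n arbitrary: \<mu> I \<C> F U)
  case (0 \<mu> I \<C> F U)
  then have "real l \<le> \<mu>" by simp
  with 0 show ?case by (intro solvable_boruvka_last[OF B final]) auto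
next
  case (Suc n \<mu> I \<C> F U)
  note st = Suc.prems(1) and fin = state_finite[OF Suc.prems(1)] and mu1 = Suc.prems(2)
  show ?case
  proof (cases "real l \<le> \<mu>")
    case True
    with Suc.prems show ?thesis by (intro solvable_boruvka_last[OF B final]) auto
  next
    case False
    have IO: "I \<subseteq> I0" and UC: "U \<subseteq> \<C>" using st by (auto simp: state_def)
    have UP: "C \<subseteq> P" if "C \<in> U" for C using that UC fin(3) by blast
    have \<kappa>: "\<kappa> \<ge> 40000" by (rule kappa_ge)
    let ?c = "real (card U)" and ?Y = "2 ^ l / \<mu>" and ?m = "\<mu> * (16/15)"
    let ?t1 = "256 * \<kappa> * ?m" and ?t0 = "256 * \<kappa> * (2 ^ l / ?m)"
    define D where "D = \<kappa> * (?Y + 16 * ?c) + (9 * (\<mu> * ?c) + 6 * ?Y) + ?t1 * (13/16 * ?c) + ?t0"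
    have Y0: "?Y \<ge> 0" and t10: "?t1 \<ge> 0" and t00: "?t0 \<ge> 0" using mu1 \<kappa> by auto
    have D0: "D \<ge> 0" unfolding D_def using Y0 t10 t00 \<kappa> mu1 by (intro add_nonneg_nonneg mult_nonneg_nonneg) auto
    have "\<forall>C :: 'v set. \<exists>k. card C \<le> 2 ^ k \<and> real k \<le> 1 + 2 * \<mu> + 2 * (card C / \<mu>)"
      by (rule allI) (rule exists_power_bound[OF mu1])
    from choice[OF this] obtain k :: "'v set \<Rightarrow> nat"
      where "\<forall>C. card C \<le> 2 ^ k C \<and> real (k C) \<le> 1 + 2 * \<mu> + 2 * (card C / \<mu>)" ..
    then have k: "card C \<le> 2 ^ k C" "real (k C) \<le> 1 + 2 * \<mu> + 2 * (card C / \<mu>)" for C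
      by simp_all
    \<comment> \<open>Parts without outgoing edges are sorted out at three queries each, because
      \<open>solvable_phase\<close> counts progress among parts that do have a neighbour.\<close>
    have "solvable I (\<lambda>i. 3 * real (card U) + (D + B i))"
    proof (rule solvable_ews[where T = "(\<lambda>C. (C, P - C)) ` U"])
      show "finite ((\<lambda>C. (C, P - C)) ` U)" using fin(2) by simp
      show "card ((\<lambda>C. (C, P - C)) ` U) \<le> card U" by (rule card_image_le[OF fin(2)])
      show "X \<subseteq> P \<and> Y \<subseteq> P \<and> X \<inter> Y = {}" if "(X, Y) \<in> (\<lambda>C. (C, P - C)) ` U" for X Y
        using that UP by auto
      show "D + B i \<ge> 0" for i using D0 B[of i] by simp
    next
      fix i0 assume "i0 \<in> I"
      let ?J = "{i\<in>I. \<forall>(X, Y)\<in>(\<lambda>C. (C, P - C)) ` U. ew i X Y = ew i0 X Y}"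
      let ?U = "{C\<in>U. ew i0 C (P - C) > 0}"
      have same: "ew i C (P - C) = ew i0 C (P - C)" if "i \<in> ?J" "C \<in> U" for i C
        using that by auto
      have "state ?J \<C> F U" using st by (rule state_subset) auto
      then have stU: "state ?J \<C> F ?U"
      proof (rule state_remove)
        fix i C assume i: "i \<in> ?J" and C: "C \<in> U - ?U"
        then have "ew i0 C (P - C) = 0" by simp
        with same[OF i, of C] C show "ew i C (P - C) = 0" by simp
      qed blast
      have cU: "real (card ?U) \<le> ?c" using fin(2) by (simp add: card_mono)
      have "solvable ?J (\<lambda>i. \<kappa> * (real (l + 1) * 2 ^ (l div 2) + 16 * real (card ?U)) +
        (\<Sum>C\<in>?U. 3 * real (k C)) + ?t1 * (13 / 16 * real (card ?U)) + ?t0 + B i)"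
      proof (rule solvable_phase[OF stU])
        show "ew i C (P - C) > 0" if "C \<in> ?U" "i \<in> ?J" for C i using same[OF that(2), of C] that by simp
        fix J \<C>' F' U' assume J: "J \<subseteq> ?J" "state J \<C>' F' U'"
        have "solvable J (\<lambda>i. 256 * \<kappa> * (?m * real (card U') + 2 ^ l / ?m) + B i)"
          by (rule Suc.IH[OF J(2)]) (use mu1 Suc.prems(3) in \<open>auto simp: mult.assoc\<close>)
        then show "solvable J (\<lambda>i. ?t1 * real (card U') + ?t0 + B i)"
          by (simp only: distrib_left mult.assoc)
      qed (use k(1) t10 t00 B in auto)
      then show "solvable ?J (\<lambda>i. D + B i)"
      proof (rule solvable_mono)
        fix i
        have 1: "real (l + 1) * 2 ^ (l div 2) \<le> ?Y" using False mu1 by (intro level_overhead) auto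
        have a: "\<kappa> * (real (l + 1) * 2 ^ (l div 2) + 16 * real (card ?U)) \<le> \<kappa> * (?Y + 16 * ?c)"
          using \<kappa> 1 cU by (intro mult_left_mono add_mono) auto
        have "(\<Sum>C\<in>?U. 3 * real (k C)) \<le> (\<Sum>C\<in>U. 3 * real (k C))" using fin(2) by (intro sum_mono2) auto
        also have "\<dots> \<le> (\<Sum>C\<in>U. 3 * (1 + 2 * \<mu> + 2 * (card C / \<mu>)))"
          using k(2) by (intro sum_mono mult_left_mono) auto
        also have "\<dots> = (\<Sum>C\<in>U. 3 * (1 + 2 * \<mu>) + 6 / \<mu> * real (card C))"
          by (intro sum.cong refl) (simp add: algebra_simps)
        also have "\<dots> = 3 * (1 + 2 * \<mu>) * ?c + 6 * (real (\<Sum>C\<in>U. card C) / \<mu>)"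
          unfolding sum.distrib sum_distrib_left[symmetric] by (simp add: algebra_simps)
        also have "\<dots> \<le> 9 * (\<mu> * ?c) + 6 * ?Y"
        proof (rule add_mono)
          have "3 * (1 + 2 * \<mu>) * ?c \<le> (9 * \<mu>) * ?c" using mu1 by (intro mult_right_mono) auto
          then show "3 * (1 + 2 * \<mu>) * ?c \<le> 9 * (\<mu> * ?c)" by simp
          have "(\<Sum>C\<in>U. card C) \<le> 2 ^ l" using sum_card_parts_le[OF st] card_P by linarith
          from of_nat_mono[OF this, where 'a = real]
          show "6 * (real (\<Sum>C\<in>U. card C) / \<mu>) \<le> 6 * ?Y"
            using mu1 by (intro mult_left_mono divide_right_mono) auto
        qed
        finally have b: "(\<Sum>C\<in>?U. 3 * real (k C)) \<le> 9 * (\<mu> * ?c) + 6 * ?Y" .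
        have c: "?t1 * (13 / 16 * real (card ?U)) \<le> ?t1 * (13 / 16 * ?c)"
          using cU t10 by (intro mult_left_mono) auto
        show "\<kappa> * (real (l + 1) * 2 ^ (l div 2) + 16 * real (card ?U)) +
          (\<Sum>C\<in>?U. 3 * real (k C)) + ?t1 * (13 / 16 * real (card ?U)) + ?t0 + B i \<le> D + B i"
          unfolding D_def using a b c by linarith
      qed simp
    qed (rule IO)
    then show ?thesis
    proof (rule solvable_mono)
      fix i
      define X where "X = \<mu> * ?c"
      have cX: "?c \<le> X" unfolding X_def using mult_right_mono[OF mu1, of ?c] by simp
      have X0: "X \<ge> 0" using cX by linarith
      have "?t1 * (13/16 * ?c) = 256 * (13/15) * (\<kappa> * X)" by (simp add: X_def)
      moreover have "?t0 = 240 * (\<kappa> * ?Y)" using mu1 by (simp add: field_simps)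
      moreover have "\<kappa> * (?Y + 16 * ?c) = \<kappa> * ?Y + 16 * (\<kappa> * ?c)" by (simp add: algebra_simps)
      ultimately have D: "D = (\<kappa> * ?Y + 16 * (\<kappa> * ?c)) + (9 * X + 6 * ?Y) + 256 * (13/15) * (\<kappa> * X) + 240 * (\<kappa> * ?Y)"
        unfolding D_def X_def by (simp only:)
      have rhs: "256 * \<kappa> * (X + ?Y) = 256 * (\<kappa> * X) + 256 * (\<kappa> * ?Y)"
        by (simp add: algebra_simps)
      \<comment> \<open>The new coefficients are 256 * (16/15) * (13/16) = 256 * 13/15 and 256 *
        15/16 = 240. The slack in the first exceeds 34 and pays for the 16 of the phase and the
        terms without \<kappa>; the slack of 16 in the second is ample.\<close>
      have arith: "3 * c + ((KY + 16 * Kc) + (9 * X + 6 * Y) + 256 * (13/15) * KX + 240 * KY + z) \<le> 256 * KX + 256 * KY + z"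
        if "c \<le> X" "0 \<le> X" "0 \<le> Y" "Kc \<le> KX" "40000 * X \<le> KX" "40000 * Y \<le> KY" for c X Y KX KY Kc z :: real
        using that by linarith
      show "3 * real (card U) + (D + B i) \<le> 256 * \<kappa> * (\<mu> * ?c + ?Y) + B i"
        unfolding X_def[symmetric] rhs unfolding D
      proof (rule arith[OF cX X0 Y0])
        show "\<kappa> * ?c \<le> \<kappa> * X" using cX \<kappa> by (intro mult_left_mono) auto
        show "40000 * X \<le> \<kappa> * X" using \<kappa> X0 by (rule mult_right_mono)
        show "40000 * ?Y \<le> \<kappa> * ?Y" using \<kappa> Y0 by (rule mult_right_mono)
      qed
    qed simp
  qed
qed

text \<open>The potential starts at \<mu> = 1 with both terms at most \<open>2 ^ l\<close>, which
  turns 256 into 512.\<close>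

theorem solvable_spanning:
  assumes B: "\<And>i. B i \<ge> 0"
    and final: "\<And>J F. J \<subseteq> I0 \<Longrightarrow> (\<And>i. i \<in> J \<Longrightarrow> spanning i F) \<Longrightarrow> solvable J B"
  shows "solvable I0 (\<lambda>i. 512 * \<kappa> * 2 ^ l + B i)"
proof -
  obtain n where n: "real l < (16/15) ^ n" using real_arch_pow[of "16/15" "real l"] by auto
  have "solvable I0 (\<lambda>i. 256 * \<kappa> * (1 * real (card ((\<lambda>x. {x}) ` P)) + 2 ^ l / 1) + B i)"
    by (rule solvable_boruvka[OF B final state_initial[OF order_refl], where n = n]) (use n in auto)
  then show ?thesis
  proof (rule solvable_mono)
    fix i
    have "card ((\<lambda>x. {x}) ` P) \<le> 2 ^ l" using card_image_le[OF finP, of "\<lambda>x. {x}"] card_P by linarith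
    from of_nat_mono[OF this, where 'a = real]
    have "1 * real (card ((\<lambda>x. {x}) ` P)) + 2 ^ l / 1 \<le> 2 * 2 ^ l" by simp
    then have "256 * \<kappa> * (1 * real (card ((\<lambda>x. {x}) ` P)) + 2 ^ l / 1) \<le> 256 * \<kappa> * (2 * 2 ^ l)"
      using kappa_ge by (intro mult_left_mono) auto
    then show "256 * \<kappa> * (1 * real (card ((\<lambda>x. {x}) ` P)) + 2 ^ l / 1) + B i \<le> 512 * \<kappa> * 2 ^ l + B i"
      by (simp only: mult.assoc)
  qed simp
qed

end

section \<open>Contractions and certificates\<close>

lemma sum_count_pairs:
  assumes "finite X" "finite Y" "X \<inter> Y = {}"
  shows "(\<Sum>x\<in>X. \<Sum>y\<in>Y. count N {x, y}) = size (filter_mset (\<lambda>e. \<exists>x\<in>X. \<exists>y\<in>Y. e = {x, y}) N)"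
proof (induction N)
  case (add e N)
  have "(\<Sum>x\<in>X. \<Sum>y\<in>Y. if e = {x, y} then 1 else 0 :: nat) = (if \<exists>x\<in>X. \<exists>y\<in>Y. e = {x, y} then 1 else 0)"
  proof (cases "\<exists>x\<in>X. \<exists>y\<in>Y. e = {x, y}")
    case True
    then obtain a b where ab: "a \<in> X" "b \<in> Y" "e = {a, b}" by blast
    have "(if e = {x, y} then 1 else 0 :: nat) = (if x = a then if y = b then 1 else 0 else 0)"
      if "x \<in> X" "y \<in> Y" for x y
      using that ab assms(3) by (auto simp: doubleton_eq_iff)
    then have "(\<Sum>x\<in>X. \<Sum>y\<in>Y. if e = {x, y} then 1 else 0 :: nat) =
       (\<Sum>x\<in>X. \<Sum>y\<in>Y. if x = a then if y = b then 1 else 0 else 0)"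
      by (intro sum.cong refl) auto
    also have "\<dots> = (\<Sum>x\<in>X. if x = a then \<Sum>y\<in>Y. if y = b then 1 else 0 else 0)"
      by (intro sum.cong refl) auto
    also have "\<dots> = 1" using ab assms by simp
    finally show ?thesis using True by simp
  qed auto
  moreover have "(\<Sum>x\<in>X. \<Sum>y\<in>Y. count (add_mset e N) {x, y}) =
    (\<Sum>x\<in>X. \<Sum>y\<in>Y. if e = {x, y} then 1 else 0) + (\<Sum>x\<in>X. \<Sum>y\<in>Y. count N {x, y})"
    unfolding sum.distrib[symmetric] by (intro sum.cong refl) auto
  ultimately show ?case using add.IH by simp
qed simp

lemma sum_count_cut:
  assumes P: "finite P" and N: "\<And>e. e \<in># N \<Longrightarrow> e \<subseteq> P \<and> card e = 2" and X: "X \<subseteq> P"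
  shows "(\<Sum>x\<in>X. \<Sum>y\<in>P - X. count N {x, y}) = size (mcut N X)"
proof -
  have "(\<Sum>x\<in>X. \<Sum>y\<in>P - X. count N {x, y}) = size (filter_mset (\<lambda>e. \<exists>x\<in>X. \<exists>y\<in>P - X. e = {x, y}) N)"
    using P X finite_subset by (intro sum_count_pairs) auto
  also have "filter_mset (\<lambda>e. \<exists>x\<in>X. \<exists>y\<in>P - X. e = {x, y}) N = mcut N X"
    unfolding mcut_def
  proof (rule filter_mset_cong[OF refl])
    fix e assume "e \<in># N"
    then have "e \<subseteq> P" "card e = 2" using N by auto
    then obtain a b where ab: "e = {a, b}" "a \<noteq> b" "a \<in> P" "b \<in> P" by (auto simp: card_2_iff)
    then have "card (e \<inter> X) = 1 \<longleftrightarrow> (a \<in> X \<longleftrightarrow> b \<notin> X)"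
      by (cases "a \<in> X"; cases "b \<in> X") (auto simp: Int_insert_left)
    then show "(\<exists>x\<in>X. \<exists>y\<in>P - X. e = {x, y}) \<longleftrightarrow> card (e \<inter> X) = 1"
      using ab by (auto simp: doubleton_eq_iff)
  qed
  finally show ?thesis .
qed

lemma contract_edge:
  assumes "e \<in># contract P E"
  shows "e \<subseteq> P \<and> card e = 2"
proof -
  obtain x where x: "x \<in># mset_set {e \<in> E. card (parts_met P e) = 2}" and e: "e = parts_met P x"
    using assms by (auto simp: contract_def)
  have "x \<in> {e \<in> E. card (parts_met P e) = 2}"
    using x by (cases "finite {e \<in> E. card (parts_met P e) = 2}") simp_all
  with e show ?thesis by (auto simp: parts_met_def)
qed

lemma size_contract_le: "finite E \<Longrightarrow> size (contract P E) \<le> card E"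
  by (simp add: contract_def card_mono)

text \<open>An edge has exactly one end in the union of \<open>X\<close> if and only if it joins a
  part in \<open>X\<close> to a part outside; edges inside a part cross neither cut.\<close>

lemma size_mcut_contract:
  assumes G: "simple_graph V E" and P: "partition_on V P" and X: "X \<subseteq> P"
  shows "size (mcut (contract P E) X) = card (cut E (\<Union> X))"
proof -
  have disj: "A = B" if "A \<in> P" "B \<in> P" "x \<in> A" "x \<in> B" for A B x
    using P that by (auto simp: partition_on_def disjoint_def)
  have iff: "(card (parts_met P e) = 2 \<and> card (parts_met P e \<inter> X) = 1) \<longleftrightarrow> card (e \<inter> \<Union> X) = 1"
    if e: "e \<in> E" for e
  proof -
    have "e \<subseteq> V" "card e = 2" using G e by (auto simp: simple_graph_def)
    then obtain u v where uv: "e = {u, v}" "u \<noteq> v" "u \<in> V" "v \<in> V" by (auto simp: card_2_iff)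
    then obtain A B where AB: "A \<in> P" "u \<in> A" "B \<in> P" "v \<in> B"
      using P by (auto simp: partition_on_def)
    have met: "parts_met P e = {A, B}"
      unfolding parts_met_def using AB uv disj by blast
    have u: "u \<in> \<Union> X \<longleftrightarrow> A \<in> X" and v: "v \<in> \<Union> X \<longleftrightarrow> B \<in> X"
      using AB X disj by blast+
    show ?thesis
    proof (cases "A = B")
      case True
      then show ?thesis using met uv u v
        by (cases "A \<in> X") (auto simp: Int_insert_left)
    next
      case False
      then show ?thesis using met uv u v
        by (cases "A \<in> X"; cases "B \<in> X") (auto simp: Int_insert_left)
    qed
  qed
  have fin: "finite E" by (rule finite_simple_graph[OF G])
  have "size (mcut (contract P E) X) = card {e \<in> {e \<in> E. card (parts_met P e) = 2}. card (parts_met P e \<inter> X) = 1}"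
    unfolding mcut_def contract_def using fin by (simp add: filter_mset_image_mset filter_mset_mset_set)
  also have "{e \<in> {e \<in> E. card (parts_met P e) = 2}. card (parts_met P e \<inter> X) = 1} = cut E (\<Union> X)"
    unfolding cut_def using iff by blast
  finally show ?thesis .
qed

lemma card_edges_le:
  assumes "simple_graph V E"
  shows "card E \<le> (card V)\<^sup>2"
proof -
  have fin: "finite V" using assms by (simp add: simple_graph_def)
  have "E \<subseteq> (\<lambda>(u, v). {u, v}) ` (V \<times> V)"
  proof
    fix e assume "e \<in> E"
    then have "e \<subseteq> V" "card e = 2" using assms by (auto simp: simple_graph_def)
    then obtain u v where "e = {u, v}" "u \<in> V" "v \<in> V" by (auto simp: card_2_iff)
    then show "e \<in> (\<lambda>(u, v). {u, v}) ` (V \<times> V)" by auto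
  qed
  then have "card E \<le> card ((\<lambda>(u, v). {u, v}) ` (V \<times> V))" using fin by (intro card_mono) auto
  also have "\<dots> \<le> card (V \<times> V)" using fin by (intro card_image_le) auto
  finally show ?thesis by (simp add: card_cartesian_product power2_eq_square)
qed

lemma size_mcut_mono: "A \<subseteq># B \<Longrightarrow> size (mcut A S) \<le> size (mcut B S)"
  unfolding mcut_def by (intro size_mset_mono multiset_filter_mono)

section \<open>Rounds of spanning forests and their total cost\<close>

definition round_cost :: "nat \<Rightarrow> nat \<Rightarrow> nat \<Rightarrow> real" where
  "round_cost l b q = (if l \<ge> 64 then 512 * (40000 * real b / real l) * 2 ^ l else real q * (3 + 6 * real l))"

lemma round_cost_nonneg: "round_cost l b q \<ge> 0"
  by (simp add: round_cost_def)

text \<open>For \<open>l\<close> below 64 the factor 3 + 6l of plain binary search is itself bounded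
  by a constant; the matrix designs come in beyond that.\<close>

lemma (in cut_round) solvable_round:
  assumes l: "card P \<le> 2 ^ l" "l \<le> b" and W: "2 * W + 1 \<le> 2 ^ (4 * b)"
    and ew_le: "\<And>i X Y. i \<in> I0 \<Longrightarrow> X \<subseteq> P \<Longrightarrow> Y \<subseteq> P \<Longrightarrow> X \<inter> Y = {} \<Longrightarrow> ew i X Y \<le> W"
    and B: "\<And>i. B i \<ge> 0"
    and final: "\<And>J F. J \<subseteq> I0 \<Longrightarrow> (\<And>i. i \<in> J \<Longrightarrow> spanning i F) \<Longrightarrow> solvable J B"
  shows "solvable I0 (\<lambda>i. round_cost l b (card P) + B i)"
proof (cases "l \<ge> 64")
  case True
  interpret bounded_cut_round orc ok I0 P Q w W l b
    by unfold_locales (use True assms in auto)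
  have "solvable I0 (\<lambda>i. 512 * \<kappa> * 2 ^ l + B i)" by (rule solvable_spanning[OF B final])
  then show ?thesis using True by (simp add: round_cost_def \<kappa>_def)
next
  case False
  have "solvable I0 (\<lambda>i. real (card ((\<lambda>x. {x}) ` P)) * (3 + 6 * real l) + B i)"
    by (rule solvable_fallback[OF l(1) B final state_initial[OF order_refl]])
  then show ?thesis
  proof (rule solvable_mono)
    fix i
    have "real (card ((\<lambda>x. {x}) ` P)) * (3 + 6 * real l) \<le> real (card P) * (3 + 6 * real l)"
      using card_image_le[OF finP] by (intro mult_right_mono) auto
    then show "real (card ((\<lambda>x. {x}) ` P)) * (3 + 6 * real l) + B i \<le> round_cost l b (card P) + B i"
      using False by (simp add: round_cost_def)
  qed simp
qed

text \<open>The situation after j rounds. Only the lower bound on the cuts is recorded, as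
  \<open>G \<subseteq># M\<close> gives the other direction.\<close>

definition partial_certificate :: "nat \<Rightarrow> 'a set set \<Rightarrow> 'a set set multiset \<Rightarrow> 'a set set multiset \<Rightarrow> bool" where
  "partial_certificate j P M G \<longleftrightarrow> G \<subseteq># M \<and> size G \<le> j * card P \<and>
    (\<forall>S\<subseteq>P. min j (size (mcut M S)) \<le> size (mcut G S))"

lemma partial_certificate_imp_sparse:
  assumes "partial_certificate r P M G"
  shows "sparse_certificate r P M G"
  unfolding sparse_certificate_def
proof (intro conjI allI impI)
  show "G \<subseteq># M" "size G \<le> r * card P" using assms by (auto simp: partial_certificate_def)
  fix S assume "S \<subseteq> P"
  then have "min r (size (mcut M S)) \<le> size (mcut G S)" using assms by (auto simp: partial_certificate_def)
  moreover have "size (mcut G S) \<le> size (mcut M S)" using \<open>G \<subseteq># M\<close> by (rule size_mcut_mono)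
  ultimately show "min r (size (mcut G S)) = min r (size (mcut M S))" by linarith
qed

text \<open>A cut either still has an edge in \<open>M - G\<close>, and then \<open>F\<close>
  contributes one, or it lies in \<open>G\<close> entirely.\<close>

lemma partial_certificate_step:
  assumes G: "partial_certificate j P M G"
    and F: "finite F" "card F \<le> card P" "\<And>e. e \<in> F \<Longrightarrow> e \<in># M - G"
    and hit: "\<And>S. S \<subseteq> P \<Longrightarrow> size (mcut (M - G) S) > 0 \<Longrightarrow> \<exists>e\<in>F. card (e \<inter> S) = 1"
  shows "partial_certificate (Suc j) P M (G + mset_set F)"
  unfolding partial_certificate_def
proof (intro conjI allI impI)
  have GM: "G \<subseteq># M" using G by (simp add: partial_certificate_def)
  have FM: "mset_set F \<subseteq># M - G"
  proof (rule mset_subset_eqI)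
    fix e
    show "count (mset_set F) e \<le> count (M - G) e"
    proof (cases "e \<in> F")
      case True
      then have "count (M - G) e > 0" using F(3)[OF True] by (simp only: count_greater_zero_iff)
      then show ?thesis using True F(1) by simp
    qed simp
  qed
  then show "G + mset_set F \<subseteq># M" using GM
    by (simp add: subset_eq_diff_conv subset_mset.le_diff_conv2 add.commute)
  show "size (G + mset_set F) \<le> Suc j * card P" using G F by (simp add: partial_certificate_def)
  fix S assume S: "S \<subseteq> P"
  have m: "min j (size (mcut M S)) \<le> size (mcut G S)" using G S by (simp add: partial_certificate_def)
  have split: "size (mcut (G + mset_set F) S) = size (mcut G S) + size (mcut (mset_set F) S)"
    by (simp add: mcut_def)
  have diff: "size (mcut M S) = size (mcut G S) + size (mcut (M - G) S)"
    unfolding mcut_def using GM by (metis filter_union_mset size_union subset_mset.add_diff_inverse)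
  show "min (Suc j) (size (mcut M S)) \<le> size (mcut (G + mset_set F) S)"
  proof (cases "size (mcut (M - G) S) > 0")
    case True
    then obtain e where e: "e \<in> F" "card (e \<inter> S) = 1" using hit[OF S] by blast
    then have "e \<in># mcut (mset_set F) S" using F(1) by (simp add: mcut_def)
    then have "size (mcut (mset_set F) S) > 0" by (auto simp: nonempty_has_size[symmetric])
    then show ?thesis using m split by linarith
  next
    case False
    then show ?thesis using split diff by linarith
  qed
qed

lemma solvable_certificate:
  fixes V :: "nat set" and ok
  defines "orc \<equiv> \<lambda>E S. card (cut E S)"
  assumes V: "finite V" and P: "partition_on V P"
    and l: "card P \<le> 2 ^ l" "l \<le> b" and b: "card V \<le> 2 ^ b" "b \<ge> 1"
    and ok: "\<And>E F. simple_graph V E \<Longrightarrow> sparse_certificate r P (contract P E) F \<Longrightarrow> ok E F"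
    and jr: "j \<le> r" and I: "\<And>E. E \<in> I \<Longrightarrow> simple_graph V E \<and> partial_certificate j P (contract P E) G"
  shows "query_problem.solvable orc ok I (\<lambda>_. real (r - j) * round_cost l b (card P))"
  using jr I
proof (induction "r - j" arbitrary: j G I)
  case 0
  then have "ok E G" if "E \<in> I" for E
    using that 0 by (intro ok partial_certificate_imp_sparse) auto
  then have "query_problem.solvable orc ok I (\<lambda>_. 0)"
    by (rule query_problem.solvable_output)
  then show ?case using 0 by simp
next
  case (Suc n)
  let ?w = "\<lambda>E x y. count (contract P E - G) {x, y}"
  have finP: "finite P" using finite_elements[OF V P] .
  have edge: "e \<subseteq> P \<and> card e = 2" if "e \<in># contract P E - G" for e E
    using in_diffD[OF that] by (rule contract_edge)
  have cutw: "(\<Sum>x\<in>X. \<Sum>y\<in>P - X. ?w E x y) = size (mcut (contract P E - G) X)" if "X \<subseteq> P" for E X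
    using sum_count_cut[OF finP edge that] .
  \<comment> \<open>The cut of \<open>G\<close> is known, so the answer to the query determines the
    remaining cut; this yields the locale assumption \<open>cut_determined\<close>.\<close>
  have cutd: "size (mcut (contract P E - G) X) = orc E (\<Union> X) - size (mcut G X)" if E: "E \<in> I" and X: "X \<subseteq> P" for E X
  proof -
    have "simple_graph V E" "G \<subseteq># contract P E"
      using Suc.prems(2)[OF E] by (auto simp: partial_certificate_def)
    then show ?thesis
      using size_mcut_contract[OF _ P X, of E]
      by (simp add: orc_def mcut_def filter_diff_mset size_Diff_submset multiset_filter_mono)
  qed
  interpret cut_round orc ok I P Union ?w
  proof unfold_locales
    show "finite P" by (rule finP)
    show "?w E x y = ?w E y x" for E x y by (simp add: insert_commute)
    show "(\<Sum>x\<in>X. \<Sum>y\<in>P - X. ?w E x y) = (\<Sum>x\<in>X. \<Sum>y\<in>P - X. ?w E' x y)"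
      if "X \<subseteq> P" "E \<in> I" "E' \<in> I" "orc E (\<Union> X) = orc E' (\<Union> X)" for X E E'
      using that(4) unfolding cutw[OF that(1)] cutd[OF that(2,1)] cutd[OF that(3,1)] by simp
  qed
  have "solvable I (\<lambda>i. round_cost l b (card P) + real n * round_cost l b (card P))"
  proof (rule solvable_round[OF l])
    \<comment> \<open>Weights are numbers of edges and hence at most n^2, which is where the
      exponent \<open>4 * b\<close> comes from.\<close>
    show "2 * (card V)\<^sup>2 + 1 \<le> 2 ^ (4 * b)"
    proof -
      have "(card V)\<^sup>2 \<le> (2 ^ b)\<^sup>2" using b by (intro power_mono) auto
      also have "(2 ^ b)\<^sup>2 = (4::nat) ^ b" by (simp add: power2_eq_square flip: power_mult_distrib)
      finally have 1: "(card V)\<^sup>2 \<le> 4 ^ b" .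
      have "(4::nat) ^ 1 \<le> 4 ^ b" using b by (intro power_increasing) auto
      then have 4: "(4::nat) \<le> 4 ^ b" by simp
      then have "4 * 4 ^ b \<le> 4 ^ b * (4::nat) ^ b" by (intro mult_right_mono) auto
      also have "4 ^ b * (4::nat) ^ b = 2 ^ (4 * b)" by (simp add: power_mult flip: power_mult_distrib)
      finally show ?thesis using 1 4 by linarith
    qed
    show "ew E X Y \<le> (card V)\<^sup>2" if E: "E \<in> I" and XY: "X \<subseteq> P" "Y \<subseteq> P" "X \<inter> Y = {}" for E X Y
    proof -
      have sg: "simple_graph V E" using Suc.prems(2)[OF E] by simp
      have "ew E X Y = size (filter_mset (\<lambda>e. \<exists>x\<in>X. \<exists>y\<in>Y. e = {x, y}) (contract P E - G))"
        unfolding ew_def using XY finP finite_subset by (intro sum_count_pairs) auto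
      also have "\<dots> \<le> size (contract P E)"
        by (intro order_trans[OF size_filter_mset_lesseq] size_mset_mono) simp
      also have "\<dots> \<le> card E" by (rule size_contract_le[OF finite_simple_graph[OF sg]])
      also have "\<dots> \<le> (card V)\<^sup>2" by (rule card_edges_le[OF sg])
      finally show ?thesis .
    qed
    show "real n * round_cost l b (card P) \<ge> 0" by (simp add: round_cost_nonneg)
    fix J F assume J: "J \<subseteq> I" and sp: "\<And>E. E \<in> J \<Longrightarrow> spanning E F"
    have n: "n = r - Suc j" and jr: "Suc j \<le> r" using Suc.hyps(2) by auto
    have "solvable J (\<lambda>_. real (r - Suc j) * round_cost l b (card P))"
    proof (rule Suc.hyps(1)[OF n jr, of J "G + mset_set F"])
      fix E assume E: "E \<in> J"
      then have EI: "E \<in> I" using J by blast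
      note s = sp[OF E, unfolded spanning_def]
      have "partial_certificate (Suc j) P (contract P E) (G + mset_set F)"
      proof (rule partial_certificate_step)
        show "e \<in># contract P E - G" if "e \<in> F" for e
          using s that unfolding present_def by (metis count_greater_zero_iff)
        show "\<exists>e\<in>F. card (e \<inter> S) = 1" if "S \<subseteq> P" "size (mcut (contract P E - G) S) > 0" for S
        proof -
          have "ew E S (P - S) > 0" unfolding ew_def cutw[OF that(1)] by (rule that(2))
          with s that(1) show ?thesis by blast
        qed
      qed (use s Suc.prems(2)[OF EI] in auto)
      then show "simple_graph V E \<and> partial_certificate (Suc j) P (contract P E) (G + mset_set F)"
        using Suc.prems(2)[OF EI] by simp
    qed
    then show "solvable J (\<lambda>_. real n * round_cost l b (card P))" by (simp only: n)
  qed
  moreover have "round_cost l b (card P) + real n * round_cost l b (card P) = real (r - j) * round_cost l b (card P)"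
    unfolding Suc.hyps(2)[symmetric] by (simp add: algebra_simps)
  ultimately show ?case by simp
qed

lemma round_cost_le:
  assumes q: "2 \<le> q" "q \<le> n"
  shows "\<exists>l b. q \<le> 2 ^ l \<and> l \<le> b \<and> n \<le> 2 ^ b \<and> 1 \<le> b \<and>
    round_cost l b q \<le> 10 ^ 8 * (real q * log 2 n / log 2 q)"
proof -
  define l where "l = nat \<lceil>log 2 q\<rceil>"
  define b where "b = nat \<lceil>log 2 n\<rceil>"
  have up: "m \<le> 2 ^ nat \<lceil>log 2 m\<rceil>" "log 2 m \<le> nat \<lceil>log 2 m\<rceil>" "nat \<lceil>log 2 m\<rceil> \<le> log 2 m + 1" if "m \<ge> 2" for m :: nat
  proof -
    have l0: "log 2 m \<ge> 0" using that by simp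
    show k: "log 2 m \<le> nat \<lceil>log 2 m\<rceil>" by (rule real_nat_ceiling_ge)
    show "nat \<lceil>log 2 m\<rceil> \<le> log 2 m + 1" using l0 by linarith
    have "real m = 2 powr (log 2 m)" using that by simp
    also have "\<dots> \<le> 2 powr (real (nat \<lceil>log 2 m\<rceil>))" using k by (intro powr_mono) auto
    also have "\<dots> = real (2 ^ nat \<lceil>log 2 m\<rceil>)" by (simp add: powr_realpow)
    finally show "m \<le> 2 ^ nat \<lceil>log 2 m\<rceil>" by (simp only: of_nat_le_iff)
  qed
  have n2: "2 \<le> n" using q by simp
  have lq: "log 2 q \<ge> 1" using q by simp
  have lqn: "log 2 q \<le> log 2 n" using q by simp
  have lb: "l \<le> b" unfolding l_def b_def using lqn by (intro nat_mono ceiling_mono)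
  have l1: "real l \<ge> log 2 q" using up(2)[OF q(1)] by (simp add: l_def)
  have b2: "real b \<le> 2 * log 2 n" using up(3)[OF n2] lq lqn unfolding b_def by linarith
  have b1: "1 \<le> b"
  proof -
    have "real b \<ge> 1" using l1 lq lb by linarith
    then show ?thesis by simp
  qed
  have pl: "(2::real) ^ l \<le> 2 * q"
  proof -
    have "(2::real) ^ l = 2 powr l" by (simp add: powr_realpow)
    also have "\<dots> \<le> 2 powr (log 2 q + 1)" using up(3)[OF q(1)] by (intro powr_mono) (auto simp: l_def)
    also have "\<dots> = 2 * q" using q by (simp add: powr_add)
    finally show ?thesis .
  qed
  let ?\<rho> = "log 2 n / log 2 q"
  have \<rho>1: "1 \<le> ?\<rho>" using lq lqn by simp
  have q\<rho>: "0 \<le> real q * ?\<rho>" by (rule mult_nonneg_nonneg) (use \<rho>1 in linarith)+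
  have "round_cost l b q \<le> 10 ^ 8 * (real q * ?\<rho>)"
  proof (cases "l \<ge> 64")
    case True
    have "real b / real l \<le> 2 * log 2 n / log 2 q"
      using b2 l1 lq by (intro frac_le) auto
    \<comment> \<open>Rounding up costs a factor 2 in \<open>b\<close> and another one in
      \<open>2 ^ l\<close>, and 512 * 40000 * 4 = 81920000.\<close>
    then have "512 * (40000 * (real b / real l)) * 2 ^ l \<le> 512 * (40000 * (2 * ?\<rho>)) * (2 * q)"
      using pl \<rho>1 by (intro mult_mono) auto
    also have "\<dots> = 81920000 * (q * ?\<rho>)" by simp
    also have "\<dots> \<le> 10 ^ 8 * (q * ?\<rho>)" by (rule mult_right_mono[OF _ q\<rho>]) simp
    finally show ?thesis using True by (simp add: round_cost_def)
  next
    case False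
    then have "3 + 6 * real l \<le> 400" by simp
    then have "real q * (3 + 6 * real l) \<le> real q * 400" by (rule mult_left_mono) simp
    also have "\<dots> \<le> 10 ^ 8 * (real q * 1)" by simp
    also have "\<dots> \<le> 10 ^ 8 * (real q * ?\<rho>)" using \<rho>1 by (intro mult_left_mono) auto
    finally show ?thesis using False by (simp add: round_cost_def)
  qed
  then show ?thesis using up(1)[OF q(1)] up(1)[OF n2] lb b1
    by (intro exI[of _ l] exI[of _ b]) (simp add: l_def b_def)
qed

text \<open>A finite expectation forces the infinite penalty for wrong outputs to have probability
  0; dropping the penalty leaves the number of queries.\<close>

lemma zero_error_and_expected_queries:
  assumes "query_cost (\<lambda>S. card (cut E S)) ok A \<le> ennreal c"
  shows "zero_error E A ok" "expected_queries E A \<le> ennreal c"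
proof -
  let ?M = "measure_pmf (run_cut E A)"
  let ?g = "\<lambda>(x, k). of_nat k + (if ok x then 0 else \<infinity>) :: ennreal"
  have q: "(\<integral>\<^sup>+ z. ?g z \<partial>?M) \<le> ennreal c" using assms by (simp add: query_cost_def run_cut_def)
  then have "(\<integral>\<^sup>+ z. ?g z \<partial>?M) \<noteq> \<infinity>" by (auto simp: top_unique)
  then have "AE z in ?M. ?g z \<noteq> \<infinity>" by (intro nn_integral_noteq_infinite) auto
  then have "\<forall>z\<in>set_pmf (run_cut E A). ?g z \<noteq> \<infinity>" by (simp add: AE_measure_pmf_iff)
  then show "zero_error E A ok" unfolding zero_error_def by (auto split: if_splits)
  have "expected_queries E A \<le> (\<integral>\<^sup>+ z. ?g z \<partial>?M)"
    unfolding expected_queries_def by (intro nn_integral_mono) auto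
  with q show "expected_queries E A \<le> ennreal c" by simp
qed

lemma exists_certificate_algorithm:
  fixes V :: "nat set"
  assumes V: "finite V" and P: "partition_on V P"
  shows "\<exists>A. \<forall>E. simple_graph V E \<longrightarrow>
    query_cost (\<lambda>S. card (cut E S)) (\<lambda>F. sparse_certificate r P (contract P E) F) A \<le>
      ennreal (10 ^ 8 * (real (card V) + real r * real (card P) * log 2 (real (card V)) / log 2 (real (card P))))"
proof -
  let ?orc = "\<lambda>E S. card (cut E S)" and ?ok = "\<lambda>E F. sparse_certificate r P (contract P E) F"
  let ?c = "10 ^ 8 * (real (card V) + real r * real (card P) * log 2 (real (card V)) / log 2 (real (card P)))"
  let ?I = "{E. simple_graph V E}"
  have finP: "finite P" using finite_elements[OF V P] .
  have PV: "card P \<le> card V"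
  proof -
    have fin: "finite A" if "A \<in> P" for A
      using that P by (intro finite_subset[OF _ V]) (auto simp: partition_on_def)
    have nonempty: "1 \<le> card A" if "A \<in> P" for A
    proof -
      have "A \<noteq> {}" "finite A" using that P fin by (auto simp: partition_on_def)
      then show ?thesis by (simp add: Suc_le_eq card_gt_0_iff)
    qed
    have "card P = (\<Sum>A\<in>P. 1)" by simp
    also have "\<dots> \<le> (\<Sum>A\<in>P. card A)" by (rule sum_mono[OF nonempty])
    also have "\<dots> = card V"       by (rule product_partition[OF P fin, symmetric])
    finally show ?thesis .
  qed
  have "query_problem.solvable ?orc ?ok ?I (\<lambda>_. ?c)"
  proof (cases "card P \<ge> 2")
    \<comment> \<open>With at most one supervertex the contraction has no edges and nothing is
      asked. In the bound \<open>log 2\<close> of 0 and of 1 is 0 and division by 0 yields 0, so the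
      right-hand side is still nonnegative.\<close>
    case False
    have "contract P E = {#}" for E
    proof -
      have "card (parts_met P e) \<noteq> 2" for e
        using card_mono[OF finP, of "parts_met P e"] False by (auto simp: parts_met_def)
      then show ?thesis by (simp add: contract_def)
    qed
    then have "query_problem.solvable ?orc ?ok ?I (\<lambda>_. 0)"
      by (intro query_problem.solvable_output[of _ _ "{#}"]) (simp add: sparse_certificate_def mcut_def)
    moreover have "log 2 (real (card P)) = 0" using False by (cases "card P = 0") (auto simp: not_le less_Suc_eq numeral_2_eq_2 log_def)
    ultimately show ?thesis by (elim query_problem.solvable_mono) auto
  next
    case True
    obtain l b where lb: "card P \<le> 2 ^ l" "l \<le> b" "card V \<le> 2 ^ b" "1 \<le> b"
      and cost: "round_cost l b (card P) \<le> 10 ^ 8 * (real (card P) * log 2 (card V) / log 2 (card P))"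
      using round_cost_le[OF True PV] by blast
    have "query_problem.solvable ?orc ?ok ?I (\<lambda>_. real (r - 0) * round_cost l b (card P))"
      by (rule solvable_certificate[OF V P lb, where G = "{#}"]) (auto simp: partial_certificate_def)
    then show ?thesis
    proof (rule query_problem.solvable_mono)
      have "real (r - 0) * round_cost l b (card P) \<le> real r * (10 ^ 8 * (real (card P) * log 2 (card V) / log 2 (card P)))"
        using mult_left_mono[OF cost, of "real r"] by simp
      also have "\<dots> = 10 ^ 8 * (0 + real r * real (card P) * log 2 (card V) / log 2 (card P))" by simp
      also have "\<dots> \<le> ?c" by (intro mult_left_mono add_right_mono) auto
      finally show "real (r - 0) * round_cost l b (card P) \<le> ?c" .
    qed simp
  qed
  then show ?thesis by (simp add: query_problem.solvable_def)
qed

theorem theorem5p7: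
  fixes \<epsilon> :: real
  assumes "\<epsilon> > 0"
  shows "\<exists>(C::real) (alg :: nat set \<Rightarrow> nat set set \<Rightarrow> nat \<Rightarrow> (nat, nat set set multiset) query_alg).
    C > 0 \<and>
    (\<forall>V P r E.
       simple_graph V E \<and> partition_on V P \<and> r > 0 \<and>
       real (card P) \<ge> log 2 (real (card V)) powr (2 + \<epsilon>) \<longrightarrow>
       zero_error E (alg V P r) (\<lambda>F. sparse_certificate r P (contract P E) F) \<and>
       expected_queries E (alg V P r) \<le>
         ennreal (C * (real (card V)
           + real r * real (card P) * log 2 (real (card V)) / log 2 (real (card P)))))"
proof -
  let ?good = "\<lambda>V P r A. \<forall>E. simple_graph V E \<longrightarrow>
    query_cost (\<lambda>S. card (cut E S)) (\<lambda>F. sparse_certificate r P (contract P E) F) A \<le>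
      ennreal (10 ^ 8 * (real (card V) + real r * real (card P) * log 2 (real (card V)) / log 2 (real (card P))))"
  \<comment> \<open>The graph is quantified inside \<open>?good\<close>, so the chosen algorithm
    depends on \<open>V\<close>, \<open>P\<close> and \<open>r\<close> only.\<close>
  define alg :: "nat set \<Rightarrow> nat set set \<Rightarrow> nat \<Rightarrow> (nat, nat set set multiset) query_alg"
    where "alg = (\<lambda>V P r. SOME A. ?good V P r A)"
  have good: "?good V P r (alg V P r)" if "finite V" "partition_on V P" for V P r
    unfolding alg_def by (rule someI_ex) (rule exists_certificate_algorithm[OF that])
  show ?thesis
  proof (intro exI[of _ "10 ^ 8"] exI[of _ alg] conjI allI impI; (elim conjE)?)
    fix V :: "nat set" and P r E assume E: "simple_graph V E" and P: "partition_on V P"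
    then have "finite V" by (simp add: simple_graph_def)
    note * = good[OF this P, rule_format, OF E]
    show "zero_error E (alg V P r) (\<lambda>F. sparse_certificate r P (contract P E) F)"
      by (rule zero_error_and_expected_queries(1)[OF *])
    show "expected_queries E (alg V P r) \<le>
       ennreal (10 ^ 8 * (real (card V) + real r * real (card P) * log 2 (real (card V)) / log 2 (real (card P))))"
      by (rule zero_error_and_expected_queries(2)[OF *])
  qed simp
qed

end
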